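(* Let $p_2>3$ be a prime number and let $d_3\ge p_2$ be an integer. Then $(3,p_2,d_3)\in\operatorname{mdeg}(\operatorname{Tame}(\mathbb{C}^3))$ if and only if $d_3\notin\{\,2p_2-3k : k=1,\dots,\lfloor p_2/3\rfloor\,\}$.
   Context: For a polynomial mapping $F=(F_1,\dots,F_n):\mathbb{C}^n\to\mathbb{C}^n$, its multidegree is $\operatorname{mdeg}F=(\deg F_1,\dots,\deg F_n)$. A triangular automorphism of $\mathbb{C}^n$ is a map of the form $(x_1,\dots,x_n)\mapsto (x_1,\,x_2+f_2(x_1),\,\dots,\,x_n+f_n(x_1,\dots,x_{n-1}))$ with polynomials $f_i$. The group $\operatorname{Tame}(\mathbb{C}^n)$ of tame automorphisms is the group generated by the affine linear automorphisms and the triangular automorphisms of $\mathbb{C}^n$. $\operatorname{mdeg}(\operatorname{Tame}(\mathbb{C}^3))$ denotes the set of multidegrees of tame automorphisms of $\mathbb{C}^3$. *)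

theory Defs
  imports Complex_Main "HOL-Computational_Algebra.Polynomial"
begin

type_synonym pt3 = "complex \<times> complex \<times> complex"
type_synonym map3 = "pt3 \<Rightarrow> pt3"

definition poly3_le :: "(pt3 \<Rightarrow> complex) \<Rightarrow> nat \<Rightarrow> bool" where
  "poly3_le f n \<longleftrightarrow> (\<exists>c :: nat \<Rightarrow> nat \<Rightarrow> nat \<Rightarrow> complex. \<forall>x y z.
     f (x, y, z) = (\<Sum>i\<le>n. \<Sum>j\<le>n. \<Sum>k\<le>n.
        if i + j + k \<le> n then c i j k * x ^ i * y ^ j * z ^ k else 0))"

definition is_poly3 :: "(pt3 \<Rightarrow> complex) \<Rightarrow> bool" where
  "is_poly3 f \<longleftrightarrow> (\<exists>n. poly3_le f n)"

text \<open>Total degree of a polynomial function (over C a polynomial function determines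
  its coefficients, so this is the degree of the representing polynomial).\<close>
definition deg3 :: "(pt3 \<Rightarrow> complex) \<Rightarrow> nat" where
  "deg3 f = (LEAST n. poly3_le f n)"

definition mdeg :: "map3 \<Rightarrow> nat \<times> nat \<times> nat" where
  "mdeg F = (deg3 (\<lambda>v. fst (F v)), deg3 (\<lambda>v. fst (snd (F v))), deg3 (\<lambda>v. snd (snd (F v))))"

definition affine_aut :: "map3 \<Rightarrow> bool" where
  "affine_aut F \<longleftrightarrow> bij F \<and> (\<exists>a :: nat \<Rightarrow> nat \<Rightarrow> complex. \<exists>b :: nat \<Rightarrow> complex.
     \<forall>x y z. F (x, y, z) =
       (a 0 0 * x + a 0 1 * y + a 0 2 * z + b 0,
        a 1 0 * x + a 1 1 * y + a 1 2 * z + b 1,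
        a 2 0 * x + a 2 1 * y + a 2 2 * z + b 2))"

definition triangular_aut :: "map3 \<Rightarrow> bool" where
  "triangular_aut F \<longleftrightarrow> (\<exists>f2 :: complex poly. \<exists>n. \<exists>c :: nat \<Rightarrow> nat \<Rightarrow> complex.
     \<forall>x y z. F (x, y, z) =
       (x, y + poly f2 x, z + (\<Sum>i\<le>n. \<Sum>j\<le>n. c i j * x ^ i * y ^ j)))"

inductive_set Tame3 :: "map3 set" where
  aff: "affine_aut F \<Longrightarrow> F \<in> Tame3"
| tri: "triangular_aut F \<Longrightarrow> F \<in> Tame3"
| comp: "F \<in> Tame3 \<Longrightarrow> G \<in> Tame3 \<Longrightarrow> F \<circ> G \<in> Tame3"
| inv: "F \<in> Tame3 \<Longrightarrow> bij F \<Longrightarrow> inv F \<in> Tame3"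

end

theory Submission
  imports Defs "HOL-Library.Poly_Mapping" "HOL-Library.Product_Plus" "HOL-Library.Multiset"
begin

text \<open>
  Give the variables positive weights that are linearly independent over the rationals. Leading forms are then
  monomials, and if \<open>q = P(f, g)\<close> has smaller degree than its terms suggest, a bound in terms of the degree of
  df \<open>\<and>\<close> dg (the inequality of Shestakov and Umirbaev) limits the loss. Following their peak reduction, let \<open>A\<close>
  be the least class of triples that contains the triples of degrees \<open>(w1, w2, w3)\<close> and is closed under undoing
  elementary reductions and reductions of types I to IV. By induction on the sum of the degrees, \<open>A\<close> is closed
  under all elementary transformations, so it contains every tame automorphism. For weights close to 1 a triple of
  total degrees \<open>(3, p, 2p - 3k)\<close> admits no reduction at all, hence it is not tame.
  Conversely, the remaining \<open>d\<close> have the form \<open>3i + pj\<close>, and \<open>(f, g, z + f\<^sup>i g\<^sup>j)\<close> with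
  \<open>f = x + z\<^sup>3\<close> and \<open>g = y + z\<^sup>p\<close> is tame.
\<close>

section \<open>Polynomials in three variables and weighted degrees\<close>

text \<open>The obstacle is a triple with two competing moves: one entry can be lowered, while
  another is changed without a rise of its degree. If one of the moves uses a polynomial in the
  common entry alone, the two commute. Otherwise leading terms cancel, and the inequality leaves few
  ratios of degrees, above all s : 2 with s odd, where the reductions of types I to IV live. Their
  mechanism is a threshold: for this ratio, cancellation in q = P(g1, g2) forces
  \<open>dd q g2\<close> up to deg g1 + \<open>dd g1 g2\<close>, and linearity of the wedge passes
  this on to one of two entries that differ by q. The rules of \<open>A\<close> lead upwards in
  degree, so a transformation that raises the degree is covered by \<open>elem\<close> and only the
  others need an argument. In the application 3, p and d are pairwise coprime, and the least common
  multiple of any two exceeds what the inequality permits; in the tightest case the margin is 1,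
  which comes from the least degree of a nonzero form and decides how close to 1 the weights must
  be.\<close>

type_synonym mono3 = "nat \<times> nat \<times> nat"
type_synonym poly3 = "mono3 \<Rightarrow>\<^sub>0 complex"

abbreviation lookup where "lookup \<equiv> Poly_Mapping.lookup"
abbreviation keys where "keys \<equiv> Poly_Mapping.keys"
abbreviation single where "single \<equiv> Poly_Mapping.single"

definition C :: "complex \<Rightarrow> poly3" where "C c = single 0 c"

lemma lookup_C_mult: "lookup (C c * f) m = c * lookup f m"
  unfolding C_def mult_map_scale_conv_mult[symmetric] by (simp add: Poly_Mapping.map.rep_eq when_def)

lemma C_0 [simp]: "C 0 = 0" and C_1 [simp]: "C 1 = 1"
  by (simp_all add: C_def)

lemma C_mult: "C (a * b) = C a * C b" by (simp add: C_def mult_single)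
lemma C_add: "C (a + b) = C a + C b" by (simp add: C_def single_add)
lemma C_uminus: "C (- a) = - C a" by (simp add: C_def single_uminus)
lemma C_diff: "C (a - b) = C a - C b" by (simp add: C_def single_diff)
lemma C_eq_0_iff [simp]: "C c = 0 \<longleftrightarrow> c = 0"
  using lookup_C_mult[of c 1 0] by (auto simp: lookup_one when_def)
lemma C_inverse_cancel: "c \<noteq> 0 \<Longrightarrow> C (1 / c) * (C c * f) = f"
  by (simp add: mult.assoc[symmetric] C_mult[symmetric])
lemma poly_mapping_sum_singles: "(\<Sum>m\<in>keys f. single m (lookup f m)) = f"
  by (rule poly_mapping_eqI)
     (auto simp: lookup_sum lookup_single when_def in_keys_iff)

lemma times_eq_sum_singles:
  fixes f g :: "'a::comm_monoid_add \<Rightarrow>\<^sub>0 'b::comm_semiring_1"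
  shows "f * g = (\<Sum>a\<in>keys f. \<Sum>b\<in>keys g. single (a + b) (lookup f a * lookup g b))"
proof -
  have "f * g = (\<Sum>a\<in>keys f. single a (lookup f a)) * (\<Sum>b\<in>keys g. single b (lookup g b))"
    by (simp add: poly_mapping_sum_singles)
  also have "\<dots> = (\<Sum>a\<in>keys f. \<Sum>b\<in>keys g. single (a + b) (lookup f a * lookup g b))"
    by (simp add: sum_product mult_single)
  finally show ?thesis .
qed

text \<open>With rationally independent weights distinct monomials have distinct degrees, so leading forms are
  monomials and two of them are algebraically dependent iff the degrees are commensurable.\<close>
locale weights =
  fixes w1 w2 w3 :: real
  assumes w_pos: "w1 > 0" "w2 > 0" "w3 > 0"
    and w_indep: "\<And>a b c :: int. of_int a * w1 + of_int b * w2 + of_int c * w3 = 0 \<Longrightarrow> a = 0 \<and> b = 0 \<and> c = 0"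
begin

section \<open>Weights of monomials and weighted degrees\<close>

definition W :: "mono3 \<Rightarrow> real" where
  "W m = real (fst m) * w1 + real (fst (snd m)) * w2 + real (snd (snd m)) * w3"

lemma W_add: "W (a + b) = W a + W b"
  by (simp add: W_def algebra_simps)

lemma W_0 [simp]: "W 0 = 0" by (simp add: W_def)

lemma W_nonneg: "W m \<ge> 0"
  using w_pos by (simp add: W_def)

lemma W_comb_eq:
  assumes "real p * W a = real q * W b"
  shows "p * fst a = q * fst b \<and> p * fst (snd a) = q * fst (snd b) \<and> p * snd (snd a) = q * snd (snd b)"
proof -
  have "of_int (int (p * fst a) - int (q * fst b)) * w1
     + of_int (int (p * fst (snd a)) - int (q * fst (snd b))) * w2
     + of_int (int (p * snd (snd a)) - int (q * snd (snd b))) * w3 = 0"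
    using assms by (simp add: W_def algebra_simps)
  from w_indep[OF this] have "int (p * fst a) = int (q * fst b) \<and> int (p * fst (snd a)) = int (q * fst (snd b))
      \<and> int (p * snd (snd a)) = int (q * snd (snd b))" by simp
  then show ?thesis unfolding of_nat_eq_iff .
qed

lemma W_inj: "inj W"
proof (rule injI)
  fix a b assume "W a = W b"
  then have "real 1 * W a = real 1 * W b" by simp
  from W_comb_eq[OF this] show "a = b" by (simp add: prod_eq_iff)
qed

lemma W_eq_iff [simp]: "W a = W b \<longleftrightarrow> a = b"
  using W_inj by (auto dest: injD)

lemma W_eq_0_iff [simp]: "W a = 0 \<longleftrightarrow> a = 0"
  using W_eq_iff[of a 0] by simp

lemma finite_W_le: "finite {m. W m \<le> r}"
proof -
  define N where "N = nat \<lceil>r / w1\<rceil> + nat \<lceil>r / w2\<rceil> + nat \<lceil>r / w3\<rceil>"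
  have N: "nat \<lceil>r / w1\<rceil> \<le> N" "nat \<lceil>r / w2\<rceil> \<le> N" "nat \<lceil>r / w3\<rceil> \<le> N"
    unfolding N_def by linarith+
  have "{m. W m \<le> r} \<subseteq> {..N} \<times> {..N} \<times> {..N}"
  proof
    fix m assume "m \<in> {m. W m \<le> r}"
    then have le: "W m \<le> r" by simp
    have b: "real k \<le> real N" if "real k * w \<le> r" "w > 0" "nat \<lceil>r / w\<rceil> \<le> N" for k w
    proof -
      have "real k \<le> r / w" using that by (simp add: pos_le_divide_eq)
      also have "\<dots> \<le> real (nat \<lceil>r / w\<rceil>)" by (rule real_nat_ceiling_ge)
      finally show ?thesis using that by linarith
    qed
    have p: "real (fst m) * w1 \<ge> 0" "real (fst (snd m)) * w2 \<ge> 0" "real (snd (snd m)) * w3 \<ge> 0"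
      using w_pos by simp_all
    have "real (fst m) * w1 \<le> r" "real (fst (snd m)) * w2 \<le> r" "real (snd (snd m)) * w3 \<le> r"
      using le p unfolding W_def by linarith+
    then have "real (fst m) \<le> real N" "real (fst (snd m)) \<le> real N" "real (snd (snd m)) \<le> real N"
      using b[OF _ w_pos(1)] b[OF _ w_pos(2)] b[OF _ w_pos(3)] N by blast+
    then show "m \<in> {..N} \<times> {..N} \<times> {..N}" by (cases m) auto
  qed
  then show ?thesis by (rule finite_subset) simp
qed

text \<open>The zero polynomial has degree 0, so \<open>deg f = 0\<close> says that f is constant.
  Before leading terms are compared, a degree must be known to be positive or a polynomial to be
  nonzero.\<close>

definition deg :: "poly3 \<Rightarrow> real" where
  "deg f = (if f = 0 then 0 else Max (W ` keys f))"

text \<open>Coefficient of the only monomial of weight r. It is taken at any real r, usually an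
  upper bound for the degree, so that top coefficients can be added and multiplied before it is
  known whether the bound is attained.\<close>

definition cf :: "poly3 \<Rightarrow> real \<Rightarrow> complex" where
  "cf f r = (if r \<in> range W then lookup f (inv W r) else 0)"

lemma cf_W [simp]: "cf f (W m) = lookup f m"
  by (simp add: cf_def inv_f_f[OF W_inj])

lemma cf_add: "cf (f + g) r = cf f r + cf g r"
  by (simp add: cf_def lookup_add)
lemma cf_diff: "cf (f - g) r = cf f r - cf g r"
  by (simp add: cf_def lookup_minus)
lemma cf_0 [simp]: "cf 0 r = 0"
  by (simp add: cf_def)
lemma cf_sum: "cf (\<Sum>x\<in>A. f x) r = (\<Sum>x\<in>A. cf (f x) r)"
  by (simp add: cf_def lookup_sum)
lemma cf_C_mult: "cf (C c * f) r = c * cf f r"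
  by (simp add: cf_def lookup_C_mult)
lemma cf_single: "cf (single m c) r = (if W m = r then c else 0)"
  by (cases "r \<in> range W") (auto simp: cf_def lookup_single when_def inv_f_f[OF W_inj])

lemma deg_0 [simp]: "deg 0 = 0" by (simp add: deg_def)

lemma deg_ge: "m \<in> keys f \<Longrightarrow> W m \<le> deg f"
  by (auto simp: deg_def)

lemma deg_attained: "f \<noteq> 0 \<Longrightarrow> \<exists>m\<in>keys f. deg f = W m"
proof -
  assume "f \<noteq> 0"
  then have "keys f \<noteq> {}" by simp
  then have "Max (W ` keys f) \<in> W ` keys f" by (intro Max_in) auto
  with \<open>f \<noteq> 0\<close> show ?thesis by (auto simp only: deg_def if_False)
qed

lemma deg_in_range: "\<exists>m. deg f = W m"
  by (cases "f = 0") (use deg_attained W_0 deg_0 in metis)+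

lemma deg_nonneg [simp]: "deg f \<ge> 0"
  using deg_in_range[of f] W_nonneg by auto

lemma deg_leI: "r \<ge> 0 \<Longrightarrow> (\<And>m. m \<in> keys f \<Longrightarrow> W m \<le> r) \<Longrightarrow> deg f \<le> r"
  by (cases "f = 0") (auto dest: deg_attained)

lemma cf_above: "deg f < r \<Longrightarrow> cf f r = 0"
proof (cases "r \<in> range W")
  case True
  assume "deg f < r"
  with True obtain m where "r = W m" by auto
  with \<open>deg f < r\<close> show ?thesis using deg_ge[of m f] by (auto simp: in_keys_iff)
qed (simp add: cf_def)

lemma cf_deg: "f \<noteq> 0 \<Longrightarrow> cf f (deg f) \<noteq> 0"
  using deg_attained[of f] by (auto simp: in_keys_iff)

lemma deg_less: "deg f \<le> r \<Longrightarrow> cf f r = 0 \<Longrightarrow> r > 0 \<Longrightarrow> deg f < r"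
  using cf_deg[of f] by (cases "f = 0") (auto simp: less_le)

lemma deg_eqI: "deg f \<le> r \<Longrightarrow> cf f r \<noteq> 0 \<Longrightarrow> deg f = r"
  using cf_above[of f r] by force

lemma deg_add_le: "deg (f + g) \<le> max (deg f) (deg g)"
proof (rule deg_leI)
  fix m assume "m \<in> keys (f + g)"
  then have "m \<in> keys f \<union> keys g" using keys_add[of f g] by blast
  then show "W m \<le> max (deg f) (deg g)" using deg_ge[of m f] deg_ge[of m g] by auto
qed (simp add: le_max_iff_disj)

lemma deg_uminus [simp]: "deg (- f) = deg f"
  by (simp add: deg_def Poly_Mapping.keys_def)

lemma deg_diff_le: "deg (f - g) \<le> max (deg f) (deg g)"
  using deg_add_le[of f "- g"] by simp

lemma deg_add_eq: "deg g < deg f \<Longrightarrow> deg (f + g) = deg f"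
proof -
  assume a: "deg g < deg f"
  then have "f \<noteq> 0" using deg_nonneg[of g] by (auto simp: not_le[symmetric] simp del: deg_nonneg)
  show ?thesis
  proof (rule deg_eqI)
    show "deg (f + g) \<le> deg f" using deg_add_le[of f g] a by simp
    show "cf (f + g) (deg f) \<noteq> 0" using cf_above[OF a] cf_deg[OF \<open>f \<noteq> 0\<close>] by (simp add: cf_add)
  qed
qed

lemma deg_add_eq': "deg f < deg g \<Longrightarrow> deg (f + g) = deg g"
  using deg_add_eq[of f g] by (simp add: add.commute)

lemma deg_add_less: "deg f < r \<Longrightarrow> deg g < r \<Longrightarrow> deg (f + g) < r"
  using deg_add_le[of f g] by simp

lemma deg_add_leI: "deg f \<le> r \<Longrightarrow> deg g \<le> r \<Longrightarrow> deg (f + g) \<le> r"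
  using deg_add_le[of f g] by simp

lemma deg_add_lt_imp_eq: "deg (f + g) < deg f \<Longrightarrow> deg g = deg f"
  using deg_add_eq[of g f] deg_add_eq'[of f g] by (cases "deg f" "deg g" rule: linorder_cases) auto

lemma deg_sum_le: "r \<ge> 0 \<Longrightarrow> (\<And>x. x \<in> A \<Longrightarrow> deg (f x) \<le> r) \<Longrightarrow> deg (\<Sum>x\<in>A. f x) \<le> r"
  by (induction A rule: infinite_finite_induct) (auto intro: deg_add_leI)

lemma deg_single: "c \<noteq> 0 \<Longrightarrow> deg (single m c) = W m"
  by (rule deg_eqI) (auto intro!: deg_leI simp: W_nonneg)

lemma deg_C [simp]: "deg (C c) = 0"
  by (cases "c = 0") (simp_all add: C_def deg_single)

lemma cf_as_sum: "cf f r = (\<Sum>m\<in>keys f. if W m = r then lookup f m else 0)"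
proof -
  have "cf f r = cf (\<Sum>m\<in>keys f. single m (lookup f m)) r" by (simp add: poly_mapping_sum_singles)
  then show ?thesis by (simp add: cf_sum cf_single)
qed

text \<open>Since r and s bound the weights in the two factors, a pair of monomials of total weight
  r + s must have weights exactly r and s.\<close>

lemma cf_mult:
  assumes "deg f \<le> r" "deg g \<le> s"
  shows "cf (f * g) (r + s) = cf f r * cf g s"
proof -
  have "cf (f * g) (r + s)
      = (\<Sum>a\<in>keys f. \<Sum>b\<in>keys g. if W a + W b = r + s then lookup f a * lookup g b else 0)"
    by (simp add: times_eq_sum_singles[of f g] cf_sum cf_single W_add)
  also have "\<dots> = (\<Sum>a\<in>keys f. \<Sum>b\<in>keys g. (if W a = r then lookup f a else 0) * (if W b = s then lookup g b else 0))"
  proof (intro sum.cong refl)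
    fix a b assume "a \<in> keys f" "b \<in> keys g"
    then have "W a \<le> r" "W b \<le> s" using deg_ge[of a f] deg_ge[of b g] assms by linarith+
    then have "W a + W b = r + s \<longleftrightarrow> W a = r \<and> W b = s" by linarith
    then show "(if W a + W b = r + s then lookup f a * lookup g b else 0)
      = (if W a = r then lookup f a else 0) * (if W b = s then lookup g b else 0)" by simp
  qed
  also have "\<dots> = cf f r * cf g s"
    by (simp add: cf_as_sum sum_product)
  finally show ?thesis .
qed

lemma deg_mult_le: "deg (f * g) \<le> deg f + deg g"
  unfolding times_eq_sum_singles[of f g]
proof (intro deg_sum_le)
  fix a b assume "a \<in> keys f" "b \<in> keys g"
  then have "W (a + b) \<le> deg f + deg g" using deg_ge[of a f] deg_ge[of b g] by (simp add: W_add)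
  then show "deg (single (a + b) (lookup f a * lookup g b)) \<le> deg f + deg g"
    by (cases "lookup f a * lookup g b = 0") (auto simp: deg_single)
qed simp_all

lemma mult_nonzero: "f \<noteq> 0 \<Longrightarrow> g \<noteq> 0 \<Longrightarrow> (f::poly3) * g \<noteq> 0"
  using cf_mult[of f "deg f" g "deg g"] cf_deg[of f] cf_deg[of g] by force

lemma mult_eq_0_iff3 [simp]: "(f::poly3) * g = 0 \<longleftrightarrow> f = 0 \<or> g = 0"
  using mult_nonzero by fastforce

lemma deg_mult: "f \<noteq> 0 \<Longrightarrow> g \<noteq> 0 \<Longrightarrow> deg (f * g) = deg f + deg g"
  by (rule deg_eqI[OF deg_mult_le]) (simp add: cf_mult cf_deg)

lemma deg_C_mult [simp]: "c \<noteq> 0 \<Longrightarrow> deg (C c * f) = deg f"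
  by (cases "f = 0") (simp_all add: deg_mult)

lemma deg_C_mult_le: "deg (C c * f) \<le> deg f"
  by (cases "c = 0") simp_all

lemma deg_power [simp]: "deg (f ^ n) = real n * deg f"
proof (cases "f = 0")
  case False
  then have "f ^ n \<noteq> 0 \<and> deg (f ^ n) = real n * deg f"
  proof (induction n)
    case 0
    show ?case using deg_C[of 1] by (simp del: deg_C)
  qed (simp add: deg_mult algebra_simps)
  then show ?thesis by simp
qed (cases n; use deg_C[of 1] in simp)

lemma power_nonzero: "f \<noteq> 0 \<Longrightarrow> (f::poly3) ^ n \<noteq> 0"
  by (induction n) simp_all

lemma cf_power: "deg f \<le> r \<Longrightarrow> cf (f ^ n) (real n * r) = cf f r ^ n"
proof (induction n)
  case 0
  show ?case using cf_W[of 1 0] by (simp add: lookup_one del: cf_W)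
next
  case (Suc n)
  have "real n * deg f \<le> real n * r" using Suc by (simp add: mult_left_mono)
  then have "cf (f * f ^ n) (r + real n * r) = cf f r * cf (f ^ n) (real n * r)"
    using Suc.prems by (intro cf_mult) simp_all
  then show ?case using Suc by (simp add: algebra_simps)
qed

text \<open>Equal degrees mean equal leading monomials, because the weights separate monomials.
  Rational independence thus replaces the study of dependent leading forms.\<close>

lemma lead_cancel:
  assumes "deg f = deg g" "deg f > 0"
  shows "\<exists>c. c \<noteq> 0 \<and> deg (f - C c * g) < deg f"
proof -
  have nz: "f \<noteq> 0" "g \<noteq> 0" using assms by auto
  define c where "c = cf f (deg f) / cf g (deg g)"
  have "c \<noteq> 0" using nz by (simp add: c_def cf_deg)
  have "deg (f - C c * g) < deg f"
  proof (rule deg_less)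
    show "deg (f - C c * g) \<le> deg f" using deg_diff_le[of f "C c * g"] \<open>c \<noteq> 0\<close> assms by simp
    show "cf (f - C c * g) (deg f) = 0"
      using cf_deg[OF nz(2)] assms by (simp add: cf_diff cf_C_mult c_def)
  qed (use assms in simp)
  with \<open>c \<noteq> 0\<close> show ?thesis by blast
qed

text \<open>Degrees are real, but only finitely many monomials lie below a given weight. Counting
  them yields a natural number on which inductions and minimal choices can run.\<close>

definition rk :: "real \<Rightarrow> nat" where "rk r = card {m. W m < r}"

lemma rk_less: "r \<in> range W \<Longrightarrow> r < s \<Longrightarrow> rk r < rk s"
  unfolding rk_def
proof (rule psubset_card_mono)
  show "finite {m. W m < s}" by (rule finite_subset[OF _ finite_W_le[of s]]) auto
  assume "r \<in> range W" "r < s"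
  then show "{m. W m < r} \<subset> {m. W m < s}" by force
qed

end

section \<open>Logarithmic differentials\<close>

definition ex :: "nat \<Rightarrow> mono3 \<Rightarrow> nat" where
  "ex i m = (if i = 0 then fst m else if i = 1 then fst (snd m) else snd (snd m))"

text \<open>The Euler derivation \<open>x\<^sub>i d/dx\<^sub>i\<close>.\<close>
definition D :: "nat \<Rightarrow> poly3 \<Rightarrow> poly3" where
  "D i f = Poly_Mapping.mapp (\<lambda>m c. of_nat (ex i m) * c) f"

lemma lookup_D: "lookup (D i f) m = of_nat (ex i m) * lookup f m"
  by (auto simp: D_def lookup_mapp when_def in_keys_iff)

lemma D_add: "D i (f + g) = D i f + D i g"
  by (rule poly_mapping_eqI) (simp add: lookup_D lookup_add algebra_simps)

lemma D_0 [simp]: "D i 0 = 0"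
  by (rule poly_mapping_eqI) (simp add: lookup_D)

lemma D_sum: "D i (\<Sum>x\<in>A. f x) = (\<Sum>x\<in>A. D i (f x))"
  by (induction A rule: infinite_finite_induct) (simp_all add: D_add)

lemma D_single: "D i (single m c) = single m (of_nat (ex i m) * c)"
  by (rule poly_mapping_eqI) (simp add: lookup_D lookup_single when_def)

lemma ex_add: "ex i (a + b) = ex i a + ex i b"
  by (simp add: ex_def)

lemma D_mult: "D i (f * g) = D i f * g + f * D i g"
proof -
  define s where "s a = single a (lookup f a)" for a
  define t where "t a = single a (lookup g a)" for a
  have f: "f = (\<Sum>a\<in>keys f. s a)" and g: "g = (\<Sum>a\<in>keys g. t a)"
    by (simp_all add: s_def t_def poly_mapping_sum_singles)
  have st: "D i (s a * t b) = D i (s a) * t b + s a * D i (t b)" for a b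
    by (simp add: s_def t_def mult_single D_single ex_add single_add[symmetric] algebra_simps)
  have "D i (f * g) = D i ((\<Sum>a\<in>keys f. s a) * (\<Sum>b\<in>keys g. t b))"
    using f g by simp
  also have "\<dots> = (\<Sum>a\<in>keys f. \<Sum>b\<in>keys g. D i (s a) * t b + s a * D i (t b))"
    by (simp add: sum_product D_sum st)
  also have "\<dots> = (\<Sum>a\<in>keys f. D i (s a)) * (\<Sum>b\<in>keys g. t b) + (\<Sum>a\<in>keys f. s a) * (\<Sum>b\<in>keys g. D i (t b))"
    by (simp add: sum_product sum.distrib)
  also have "\<dots> = D i f * g + f * D i g"
    using f g by (simp add: D_sum[symmetric])
  finally show ?thesis .
qed

lemma ex_0 [simp]: "ex i 0 = 0" by (simp add: ex_def)

lemma D_C [simp]: "D i (C c) = 0"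
  by (simp add: C_def D_single)

section \<open>Two-forms and Jacobian determinants\<close>

type_synonym form = "poly3 \<times> poly3 \<times> poly3"

text \<open>Coefficients of df \<open>\<and>\<close> dg in the basis of the logarithmic forms dx/x, dy/y, dz/z, so that
  forming df does not lower degrees.\<close>
definition wedge :: "poly3 \<Rightarrow> poly3 \<Rightarrow> form" where
  "wedge f g = (D 0 f * D 1 g - D 1 f * D 0 g, D 0 f * D 2 g - D 2 f * D 0 g, D 1 f * D 2 g - D 2 f * D 1 g)"

definition smul :: "poly3 \<Rightarrow> form \<Rightarrow> form" where
  "smul p w = (p * fst w, p * fst (snd w), p * snd (snd w))"

lemma smul_simps:
  "smul p (v + w) = smul p v + smul p w" "smul (p + q) w = smul p w + smul q w"
  "smul p (smul q w) = smul (p * q) w" "smul 0 w = 0" "smul 1 w = w" "smul p 0 = 0"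
  "smul p (- w) = - smul p w" "smul (- p) w = - smul p w"
  by (simp_all add: smul_def prod_eq_iff algebra_simps)

lemma wedge_add_left: "wedge (f + h) g = wedge f g + wedge h g"
  by (simp add: wedge_def D_add algebra_simps)

lemma wedge_swap: "wedge g f = - wedge f g"
  by (simp add: wedge_def algebra_simps)

lemma wedge_add_right: "wedge g (f + h) = wedge g f + wedge g h"
  by (simp add: wedge_def D_add algebra_simps)

lemma wedge_mult_left: "wedge (f * h) g = smul f (wedge h g) + smul h (wedge f g)"
  by (simp add: wedge_def smul_def D_mult algebra_simps)

lemma wedge_mult_right: "wedge g (f * h) = smul f (wedge g h) + smul h (wedge g f)"
  by (simp add: wedge_def smul_def D_mult algebra_simps)

lemma wedge_self [simp]: "wedge f f = 0"
  by (simp add: wedge_def prod_eq_iff algebra_simps)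

lemma wedge_C [simp]: "wedge (C c) g = 0" "wedge g (C c) = 0"
  by (simp_all add: wedge_def prod_eq_iff)

lemma wedge_0 [simp]: "wedge 0 g = 0" "wedge g 0 = 0"
  by (simp_all add: wedge_def prod_eq_iff)

lemma wedge_C_mult: "wedge (C c * f) g = smul (C c) (wedge f g)" "wedge g (C c * f) = smul (C c) (wedge g f)"
  by (simp_all add: wedge_mult_left wedge_mult_right smul_simps)

lemma wedge_sum: "wedge (\<Sum>x\<in>A. f x) g = (\<Sum>x\<in>A. wedge (f x) g)"
  by (induction A rule: infinite_finite_induct) (simp_all add: wedge_add_left)

lemma smul_sum: "smul p (\<Sum>x\<in>A. f x) = (\<Sum>x\<in>A. smul p (f x))"
  by (induction A rule: infinite_finite_induct) (simp_all add: smul_simps)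

lemma smul_sum_left: "smul (\<Sum>x\<in>A. f x) w = (\<Sum>x\<in>A. smul (f x) w)"
  by (induction A rule: infinite_finite_induct) (simp_all add: smul_simps)

text \<open>The additional factor f on both sides avoids the exponent i - 1 of the
  derivative.\<close>

lemma wedge_power: "smul f (wedge (f ^ i) g) = smul (of_nat i * f ^ i) (wedge f g)"
proof (induction i)
  case 0
  show ?case using wedge_C(1)[of 1 g] by (simp add: smul_simps)
next
  case (Suc i)
  have "smul f (wedge (f * f ^ i) g) = smul f (smul f (wedge (f ^ i) g)) + smul (f * f ^ i) (wedge f g)"
    by (simp add: wedge_mult_left smul_simps)
  also have "\<dots> = smul (f * (of_nat i * f ^ i) + f * f ^ i) (wedge f g)"
    by (simp add: Suc smul_simps)
  finally show ?case by (simp add: algebra_simps)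
qed

definition jac :: "poly3 \<Rightarrow> poly3 \<Rightarrow> poly3 \<Rightarrow> poly3" where
  "jac f g h = D 0 f * (D 1 g * D 2 h - D 2 g * D 1 h) - D 1 f * (D 0 g * D 2 h - D 2 g * D 0 h)
             + D 2 f * (D 0 g * D 1 h - D 1 g * D 0 h)"

text \<open>In logarithmic coordinates a Jacobian determinant \<open>c\<close> becomes \<open>c * xyz\<close>.\<close>
definition gt :: "poly3 \<Rightarrow> poly3 \<Rightarrow> poly3 \<Rightarrow> bool" where
  "gt f g h \<longleftrightarrow> (\<exists>c. c \<noteq> 0 \<and> jac f g h = single (1, 1, 1) c)"

lemma jac_perm: "jac g f h = - jac f g h" "jac f h g = - jac f g h"
  by (simp_all add: jac_def algebra_simps)

lemma gt_perm: "gt f g h \<Longrightarrow> gt g f h" "gt f g h \<Longrightarrow> gt f h g"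
proof -
  assume "gt f g h"
  then obtain c where c: "c \<noteq> 0" "jac f g h = single (1, 1, 1) c" by (auto simp: gt_def)
  have "jac g f h = single (1, 1, 1) (- c)" "jac f h g = single (1, 1, 1) (- c)"
    using jac_perm(1)[of g f h] jac_perm(2)[of f h g] c by (simp_all add: single_uminus)
  with c show "gt g f h" "gt f h g" unfolding gt_def by (metis neg_equal_0_iff_equal)+
qed

lemma jac_add: "jac f g (h + k) = jac f g h + jac f g k"
  by (simp add: jac_def D_add algebra_simps)

lemma jac_mult: "jac f g (h * k) = h * jac f g k + k * jac f g h"
  by (simp add: jac_def D_mult algebra_simps)

lemma jac_C: "jac f g (C c) = 0" by (simp add: jac_def)

lemma jac_same: "jac f g f = 0" "jac f g g = 0"
  by (simp_all add: jac_def algebra_simps)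

lemma jac_wedge: "jac f g h = D 2 h * fst (wedge f g) - D 1 h * fst (snd (wedge f g)) + D 0 h * snd (snd (wedge f g))"
  by (simp add: jac_def wedge_def algebra_simps)

text \<open>Contraction of the 3-form df \<and> dg \<and> dh with the three Euler fields: on the
  left the contracted product, on the right the contracted volume form times the Jacobian.\<close>

lemma jac_laplace:
  "smul (D 0 f) (wedge g h) - smul (D 0 g) (wedge f h) + smul (D 0 h) (wedge f g) = (0, 0, jac f g h)"
  "smul (D 1 f) (wedge g h) - smul (D 1 g) (wedge f h) + smul (D 1 h) (wedge f g) = (0, - jac f g h, 0)"
  "smul (D 2 f) (wedge g h) - smul (D 2 g) (wedge f h) + smul (D 2 h) (wedge f g) = (jac f g h, 0, 0)"
  by (simp_all add: jac_def wedge_def smul_def algebra_simps)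

section \<open>Subalgebras generated by two polynomials or by one\<close>

definition alg :: "poly3 \<Rightarrow> poly3 \<Rightarrow> poly3 set" where
  "alg f g = {q. \<exists>S c. finite S \<and> q = (\<Sum>p\<in>S. C (c p) * f ^ fst p * g ^ snd p)}"

definition alg1 :: "poly3 \<Rightarrow> poly3 set" where
  "alg1 f = {q. \<exists>S c. finite S \<and> q = (\<Sum>i\<in>S. C (c i) * f ^ i)}"

lemma alg_add: assumes "p \<in> alg f g" "q \<in> alg f g" shows "p + q \<in> alg f g"
proof -
  from assms obtain S c T d where S: "finite S" "p = (\<Sum>p\<in>S. C (c p) * f ^ fst p * g ^ snd p)"
    and T: "finite T" "q = (\<Sum>p\<in>T. C (d p) * f ^ fst p * g ^ snd p)" unfolding alg_def by auto
  define e where "e p = (if p \<in> S then c p else 0) + (if p \<in> T then d p else 0)" for p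
  have "p = (\<Sum>p\<in>S \<union> T. C (if p \<in> S then c p else 0) * f ^ fst p * g ^ snd p)"
    unfolding S(2) by (rule sum.mono_neutral_cong_left) (use S T in auto)
  moreover have "q = (\<Sum>p\<in>S \<union> T. C (if p \<in> T then d p else 0) * f ^ fst p * g ^ snd p)"
    unfolding T(2) by (rule sum.mono_neutral_cong_left) (use S T in auto)
  ultimately have "p + q = (\<Sum>p\<in>S \<union> T. C (e p) * f ^ fst p * g ^ snd p)"
    by (simp add: sum.distrib[symmetric] e_def C_add algebra_simps)
  then show ?thesis unfolding alg_def using S T by blast
qed

lemma alg_monom: "C c * f ^ i * g ^ j \<in> alg f g"
  unfolding alg_def by (intro CollectI exI[of _ "{(i, j)}"] exI[of _ "\<lambda>_. c"]) simp

lemma alg_C [simp]: "C c \<in> alg f g"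
  using alg_monom[of c f 0 g 0] by simp
lemma alg_gen1 [simp]: "f \<in> alg f g"
  using alg_monom[of 1 f 1 g 0] by simp
lemma alg_gen2 [simp]: "g \<in> alg f g"
  using alg_monom[of 1 f 0 g 1] by simp
lemma alg_0 [simp]: "0 \<in> alg f g" using alg_C[of 0] by (simp del: alg_C)
lemma alg_1 [simp]: "1 \<in> alg f g" using alg_C[of 1] by (simp del: alg_C)

lemma alg_sum: "(\<And>x. x \<in> A \<Longrightarrow> h x \<in> alg f g) \<Longrightarrow> (\<Sum>x\<in>A. h x) \<in> alg f g"
  by (induction A rule: infinite_finite_induct) (auto intro: alg_add)

lemma alg_mult: assumes "p \<in> alg f g" "q \<in> alg f g" shows "p * q \<in> alg f g"
proof -
  from assms obtain S c T d where S: "finite S" "p = (\<Sum>p\<in>S. C (c p) * f ^ fst p * g ^ snd p)"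
    and T: "finite T" "q = (\<Sum>p\<in>T. C (d p) * f ^ fst p * g ^ snd p)" unfolding alg_def by auto
  have "p * q = (\<Sum>a\<in>S. \<Sum>b\<in>T. C (c a * d b) * f ^ (fst a + fst b) * g ^ (snd a + snd b))"
    unfolding S T by (simp add: sum_product C_mult power_add algebra_simps)
  then show ?thesis by (auto intro!: alg_sum alg_monom)
qed

lemma alg_power: "p \<in> alg f g \<Longrightarrow> p ^ n \<in> alg f g"
  by (induction n) (simp_all add: alg_mult)

lemma alg_uminus: "p \<in> alg f g \<Longrightarrow> - p \<in> alg f g"
  using alg_mult[OF alg_C, of p f g "-1"] by (simp only: C_uminus C_1) simp

lemma alg_diff: "p \<in> alg f g \<Longrightarrow> q \<in> alg f g \<Longrightarrow> p - q \<in> alg f g"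
  using alg_add[of p f g "- q"] by (simp add: alg_uminus)

lemma alg_subst: "f' \<in> alg f g \<Longrightarrow> g' \<in> alg f g \<Longrightarrow> q \<in> alg f' g' \<Longrightarrow> q \<in> alg f g"
proof -
  assume a: "f' \<in> alg f g" "g' \<in> alg f g" "q \<in> alg f' g'"
  from a(3) obtain S c where "q = (\<Sum>p\<in>S. C (c p) * f' ^ fst p * g' ^ snd p)" unfolding alg_def by auto
  then show ?thesis using a by (auto intro!: alg_sum alg_mult alg_power)
qed

lemma alg_sym: "alg f g = alg g f"
  using alg_subst[of f g f g] alg_subst[of g f g f] by auto

text \<open>The generator 0 contributes only through 0^0 = 1. All closure properties of
  \<open>alg1\<close> are then inherited from \<open>alg\<close>.\<close>

lemma alg1_eq: "alg1 f = alg f 0"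
proof
  show "alg1 f \<subseteq> alg f 0" unfolding alg1_def
    by (auto intro!: alg_sum alg_mult alg_power)
  show "alg f 0 \<subseteq> alg1 f"
  proof
    fix q assume "q \<in> alg f 0"
    then obtain S c where S: "finite S" "q = (\<Sum>p\<in>S. C (c p) * f ^ fst p * 0 ^ snd p)" unfolding alg_def by auto
    define T where "T = {p \<in> S. snd p = 0}"
    have "q = (\<Sum>p\<in>T. C (c p) * f ^ fst p)"
      unfolding S(2) by (rule sum.mono_neutral_cong_right) (use S in \<open>auto simp: T_def zero_power\<close>)
    also have "\<dots> = (\<Sum>i\<in>fst ` T. C (c (i, 0)) * f ^ i)"
      by (subst sum.reindex) (auto simp: T_def inj_on_def prod_eq_iff intro!: sum.cong)
    finally show "q \<in> alg1 f" unfolding alg1_def mem_Collect_eq using S(1)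
      by (intro exI[of _ "fst ` T"] exI[of _ "\<lambda>i. c (i, 0)"]) (simp add: T_def)
  qed
qed

lemma alg1_add: "p \<in> alg1 f \<Longrightarrow> q \<in> alg1 f \<Longrightarrow> p + q \<in> alg1 f"
  and alg1_mult: "p \<in> alg1 f \<Longrightarrow> q \<in> alg1 f \<Longrightarrow> p * q \<in> alg1 f"
  and alg1_power: "p \<in> alg1 f \<Longrightarrow> p ^ n \<in> alg1 f"
  and alg1_diff: "p \<in> alg1 f \<Longrightarrow> q \<in> alg1 f \<Longrightarrow> p - q \<in> alg1 f"
  and alg1_uminus: "p \<in> alg1 f \<Longrightarrow> - p \<in> alg1 f"
  and alg1_C [simp]: "C c \<in> alg1 f" and alg1_gen [simp]: "f \<in> alg1 f" and alg1_0 [simp]: "0 \<in> alg1 f"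
  unfolding alg1_eq by (simp_all add: alg_add alg_mult alg_power alg_diff alg_uminus)

lemma alg1_sum: "(\<And>x. x \<in> A \<Longrightarrow> h x \<in> alg1 f) \<Longrightarrow> (\<Sum>x\<in>A. h x) \<in> alg1 f"
  unfolding alg1_eq by (rule alg_sum)

lemma alg1_alg: "q \<in> alg1 f \<Longrightarrow> q \<in> alg f g" "q \<in> alg1 f \<Longrightarrow> q \<in> alg g f"
  unfolding alg1_eq using alg_subst[of f f g 0 q] alg_subst[of f g f 0 q] by simp_all

lemma alg1_subst: "f' \<in> alg1 f \<Longrightarrow> q \<in> alg1 f' \<Longrightarrow> q \<in> alg1 f"
  unfolding alg1_eq using alg_subst[of f' f 0 0 q] by simp

text \<open>In its last argument \<open>jac f g\<close> is a derivation, and it kills both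
  generators.\<close>

lemma jac_alg: assumes "q \<in> alg f g" shows "jac f g q = 0"
proof -
  have p: "jac f g (h ^ n) = 0" if "jac f g h = 0" for h n
    using that jac_C[of f g 1] by (induction n) (simp_all add: jac_mult)
  from assms obtain S c where q: "q = (\<Sum>p\<in>S. C (c p) * f ^ fst p * g ^ snd p)" unfolding alg_def by auto
  have s: "jac f g (\<Sum>x\<in>A. h x) = (\<Sum>x\<in>A. jac f g (h x))" for A and h :: "nat \<times> nat \<Rightarrow> poly3"
    using jac_C[of f g 0] by (induction A rule: infinite_finite_induct) (simp_all add: jac_add)
  show ?thesis unfolding q s by (rule sum.neutral) (simp add: jac_mult p jac_same jac_C)
qed

text \<open>Nonsingularity of a Vandermonde matrix with distinct nodes: combining the power sums
  with the coefficients of a polynomial that vanishes at all nodes except k isolates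
  \<open>a k\<close>.\<close>

lemma power_sums_zero:
  fixes a :: "nat \<Rightarrow> complex"
  assumes "finite I" "\<And>r. r < card I \<Longrightarrow> (\<Sum>i\<in>I. a i * of_nat i ^ r) = 0" "k \<in> I"
  shows "a k = 0"
proof -
  define P :: "complex poly" where "P = (\<Prod>j\<in>I - {k}. [:- of_nat j, 1:])"
  have "degree P \<le> (\<Sum>j\<in>I - {k}. degree [:- of_nat j, 1 :: complex:])"
    using degree_prod_sum_le[of "I - {k}" "\<lambda>j. [:- of_nat j, 1 :: complex:]"] assms(1)
    by (simp add: P_def o_def)
  also have "\<dots> = card (I - {k})" by simp
  also have "\<dots> < card I" using assms by (meson card_Diff1_less)
  finally have dP: "degree P < card I" .
  have "(\<Sum>i\<in>I. a i * poly P (of_nat i)) = (\<Sum>i\<in>I. \<Sum>r\<le>degree P. coeff P r * (a i * of_nat i ^ r))"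
    by (simp add: poly_altdef sum_distrib_left algebra_simps)
  also have "\<dots> = (\<Sum>r\<le>degree P. coeff P r * (\<Sum>i\<in>I. a i * of_nat i ^ r))"
    by (subst sum.swap) (simp add: sum_distrib_left)
  also have "\<dots> = 0" using assms(2) dP by simp
  finally have "0 = (\<Sum>i\<in>I. a i * poly P (of_nat i))" by simp
  also have "\<dots> = (\<Sum>i\<in>{k}. a i * poly P (of_nat i))"
    by (rule sum.mono_neutral_right) (use assms in \<open>auto simp: P_def poly_prod\<close>)
  finally have "a k * poly P (of_nat k) = 0" by simp
  moreover have "poly P (of_nat k) \<noteq> 0" using assms by (auto simp: P_def poly_prod)
  ultimately show ?thesis by simp
qed

context weights
begin

section \<open>Degrees of two-forms\<close>

definition fdeg :: "form \<Rightarrow> real" where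
  "fdeg w = max (deg (fst w)) (max (deg (fst (snd w))) (deg (snd (snd w))))"

definition dd :: "poly3 \<Rightarrow> poly3 \<Rightarrow> real" where "dd f g = fdeg (wedge f g)"

lemma fdeg_add_le: "fdeg (v + w) \<le> max (fdeg v) (fdeg w)"
  using deg_add_le[of "fst v" "fst w"] deg_add_le[of "fst (snd v)" "fst (snd w)"]
    deg_add_le[of "snd (snd v)" "snd (snd w)"]
  unfolding fdeg_def by simp linarith

lemma fdeg_uminus [simp]: "fdeg (- w) = fdeg w" by (simp add: fdeg_def)

lemma fdeg_add_eq: "fdeg w < fdeg v \<Longrightarrow> fdeg (v + w) = fdeg v"
  using fdeg_add_le[of v w] fdeg_add_le[of "v + w" "- w"] by auto

lemma fdeg_add_eq': "fdeg w < fdeg v \<Longrightarrow> fdeg (w + v) = fdeg v"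
  using fdeg_add_eq[of w v] by (simp add: add.commute)

lemma deg_mult_0: "deg (p * q) = (if p = 0 \<or> q = 0 then 0 else deg p + deg q)"
  by (auto simp: deg_mult)

lemma fdeg_smul_le: "fdeg (smul p w) \<le> deg p + fdeg w"
  using deg_mult_le[of p "fst w"] deg_mult_le[of p "fst (snd w)"] deg_mult_le[of p "snd (snd w)"]
  unfolding fdeg_def smul_def by simp linarith

lemma fdeg_smul: assumes "p \<noteq> 0" "w \<noteq> 0" shows "fdeg (smul p w) = deg p + fdeg w"
proof (rule antisym[OF fdeg_smul_le])
  have le: "deg p + deg x \<le> fdeg (smul p w)"
    if "x \<in> {fst w, fst (snd w), snd (snd w)}" "x \<noteq> 0" for x
    using that assms by (auto simp: fdeg_def smul_def deg_mult)
  show "deg p + fdeg w \<le> fdeg (smul p w)"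
  proof (cases "fdeg w = 0")
    case True
    obtain x where x: "x \<in> {fst w, fst (snd w), snd (snd w)}" "x \<noteq> 0" using assms by (auto simp: prod_eq_iff)
    show ?thesis using True le[OF x] deg_nonneg[of x] by linarith
  next
    case False
    have "fdeg w \<in> {deg (fst w), deg (fst (snd w)), deg (snd (snd w))}" by (auto simp: fdeg_def max_def)
    then obtain x where x: "x \<in> {fst w, fst (snd w), snd (snd w)}" "fdeg w = deg x" by auto
    with False have "x \<noteq> 0" by auto
    from le[OF x(1) this] x show ?thesis by simp
  qed
qed

lemma smul_eq_0: "smul p w = 0 \<longleftrightarrow> p = 0 \<or> w = 0"
  by (auto simp: smul_def prod_eq_iff)

lemma fdeg_0 [simp]: "fdeg 0 = 0" by (simp add: fdeg_def)

lemma deg_D_le: "deg (D i f) \<le> deg f"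
  by (rule deg_leI) (auto simp: in_keys_iff lookup_D intro!: deg_ge)

lemma dd_sym: "dd f g = dd g f"
  unfolding dd_def wedge_swap[of f g] by simp

lemma dd_le: "dd f g \<le> deg f + deg g"
proof -
  have "deg (D i f * D j g - D j f * D i g) \<le> deg f + deg g" for i j
  proof -
    have "deg (D k f * D l g) \<le> deg f + deg g" for k l
      using deg_mult_le[of "D k f" "D l g"] deg_D_le[of k f] deg_D_le[of l g] by linarith
    from this[of i j] this[of j i] show ?thesis using deg_diff_le[of "D i f * D j g" "D j f * D i g"] by simp
  qed
  then show ?thesis by (simp add: dd_def fdeg_def wedge_def)
qed

lemma lookup_mult_0: "lookup f 0 = 0 \<Longrightarrow> lookup (f * g :: poly3) 0 = 0"
proof -
  assume a: "lookup f 0 = 0"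
  have "lookup (single (k + l) (lookup f k * lookup g l)) 0 = 0" if "k \<in> keys f" for k l :: mono3
  proof -
    have "k \<noteq> 0" using that a by (auto simp: in_keys_iff)
    then have "k + l \<noteq> 0" by (auto simp: prod_eq_iff)
    then show ?thesis by (simp add: lookup_single)
  qed
  then show ?thesis by (simp add: times_eq_sum_singles[of f g] lookup_sum)
qed

text \<open>Euler derivations kill constants, so the coefficients of df \<and> dg have no constant
  term, and each of their monomials weighs at least as much as one variable.\<close>

lemma dd_lower:
  assumes "wedge f g \<noteq> 0" "w1 \<ge> r" "w2 \<ge> r" "w3 \<ge> r" "r \<ge> 0"
  shows "dd f g \<ge> r"
proof -
  have p: "deg h \<ge> r" if "h \<noteq> 0" "lookup h 0 = 0" for h
  proof -
    from that have "keys h \<noteq> {}" by simp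
    then obtain m where m: "m \<in> keys h" by blast
    then have "m \<noteq> 0" using that by (auto simp: in_keys_iff)
    then have m1: "fst m \<ge> 1 \<or> fst (snd m) \<ge> 1 \<or> snd (snd m) \<ge> 1" by (auto simp: prod_eq_iff)
    have w: "real n * w \<ge> r" if "n \<ge> 1" "w \<ge> r" for n w
      using that assms(5) mult_mono[of 1 "real n" r w] by simp
    have nn: "real (fst m) * w1 \<ge> 0" "real (fst (snd m)) * w2 \<ge> 0" "real (snd (snd m)) * w3 \<ge> 0"
      using w_pos by simp_all
    have "W m \<ge> r" using m1 nn w[of "fst m" w1] w[of "fst (snd m)" w2] w[of "snd (snd m)" w3] assms
      unfolding W_def by linarith
    then show ?thesis using deg_ge[OF m] by simp
  qed
  have l0: "lookup (D i f * D j g - D j f * D i g) 0 = 0" for i j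
    by (simp add: lookup_minus lookup_mult_0 lookup_D)
  from assms(1) consider "fst (wedge f g) \<noteq> 0" | "fst (snd (wedge f g)) \<noteq> 0" | "snd (snd (wedge f g)) \<noteq> 0"
    by (auto simp: prod_eq_iff)
  then show ?thesis
    by cases (use p l0 in \<open>auto simp: dd_def fdeg_def wedge_def le_max_iff_disj\<close>)
qed

lemma dd_pos: "wedge f g \<noteq> 0 \<Longrightarrow> dd f g > 0"
  using dd_lower[of f g "min w1 (min w2 w3)"] w_pos by (simp add: min_le_iff_disj) linarith

lemma gt_wedge: "gt f g h \<Longrightarrow> wedge f g \<noteq> 0"
  by (auto simp: gt_def jac_wedge dest!: arg_cong[where f = "\<lambda>p. lookup p (1, 1, 1)"])

lemma gt_dd_pos: "gt f g h \<Longrightarrow> dd f g > 0"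
  by (rule dd_pos[OF gt_wedge])

lemma deg_eq_0_imp_C: "deg f = 0 \<Longrightarrow> f = C (lookup f 0)"
proof (rule poly_mapping_eqI)
  fix m assume "deg f = 0"
  then have "m \<in> keys f \<Longrightarrow> m = 0" using deg_ge[of m f] W_nonneg[of m] W_eq_0_iff[of m] by force
  then show "lookup f m = lookup (C (lookup f 0)) m"
    by (auto simp: C_def lookup_single in_keys_iff when_def)
qed

lemma gt_deg_pos: assumes "gt f g h" shows "deg f > 0"
proof (rule ccontr)
  assume "\<not> deg f > 0"
  then have "deg f = 0" using deg_nonneg[of f] by linarith
  then have "wedge f g = 0" using deg_eq_0_imp_C[of f] wedge_C(1) by metis
  then show False using gt_wedge[OF assms] by simp
qed

lemma jac_deg_le: "deg (jac f g h) \<le> deg h + dd f g"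
proof -
  have p: "deg (D i h * c) \<le> deg h + dd f g" if "deg c \<le> dd f g" for i c
    using deg_mult_le[of "D i h" c] deg_D_le[of i h] that by linarith
  have "deg (fst (wedge f g)) \<le> dd f g" "deg (fst (snd (wedge f g))) \<le> dd f g" "deg (snd (snd (wedge f g))) \<le> dd f g"
    by (auto simp: dd_def fdeg_def)
  then show ?thesis unfolding jac_wedge
    by (intro deg_add_leI order.trans[OF deg_diff_le] max.boundedI p)
qed

lemma deg_D_attained: assumes "deg f > 0" shows "\<exists>i\<in>{0,1,2}. deg (D i f) = deg f \<and> D i f \<noteq> 0"
proof -
  have "f \<noteq> 0" using assms by auto
  then obtain m where m: "m \<in> keys f" "deg f = W m" using deg_attained by blast
  then have "m \<noteq> 0" using assms by auto
  then have "ex 0 m \<noteq> 0 \<or> ex 1 m \<noteq> 0 \<or> ex 2 m \<noteq> 0" by (simp add: prod_eq_iff ex_def)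
  then obtain i where i: "i \<in> {0,1,2}" "ex i m \<noteq> 0" by blast
  then have "m \<in> keys (D i f)" using m by (auto simp: in_keys_iff lookup_D)
  then show ?thesis using deg_ge[of m "D i f"] deg_D_le[of i f] m i by (intro bexI[of _ i]) auto
qed

text \<open>If the left side were strictly larger, it would survive as the degree of the contraction
  of df \<and> dg \<and> dh. But that degree is the one of \<open>jac f g h\<close>, which is at
  most deg h + \<open>dd f g\<close>. Used in all orders of the entries, the lemma says that the
  largest of the three sums occurs twice.\<close>

lemma two_maxima:
  assumes "gt f g h"
  shows "deg f + dd g h \<le> max (deg g + dd f h) (deg h + dd f g)"
proof (rule ccontr)
  assume neg: "\<not> ?thesis"
  obtain i where i: "i \<in> {0,1,2}" "deg (D i f) = deg f" "D i f \<noteq> 0"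
    using deg_D_attained[OF gt_deg_pos[OF assms]] by blast
  have "gt g h f" using gt_perm assms by blast
  then have nz: "wedge g h \<noteq> 0" by (rule gt_wedge)
  obtain c where c: "c \<noteq> 0" "jac f g h = single (1,1,1) c" using assms by (auto simp: gt_def)
  define R where "R = smul (D i f) (wedge g h) - smul (D i g) (wedge f h) + smul (D i h) (wedge f g)"
  have A: "fdeg (smul (D i f) (wedge g h)) = deg f + dd g h"
    using i nz by (simp add: fdeg_smul dd_def)
  have B: "fdeg (smul (D i g) (wedge f h)) \<le> deg g + dd f h"
    using fdeg_smul_le[of "D i g" "wedge f h"] deg_D_le[of i g] by (simp add: dd_def)
  have C: "fdeg (smul (D i h) (wedge f g)) \<le> deg h + dd f g"
    using fdeg_smul_le[of "D i h" "wedge f g"] deg_D_le[of i h] by (simp add: dd_def)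
  have "fdeg (- smul (D i g) (wedge f h) + smul (D i h) (wedge f g)) < deg f + dd g h"
    using fdeg_add_le[of "- smul (D i g) (wedge f h)" "smul (D i h) (wedge f g)"] neg B C by simp
  then have "fdeg R = deg f + dd g h"
    using fdeg_add_eq[of "- smul (D i g) (wedge f h) + smul (D i h) (wedge f g)" "smul (D i f) (wedge g h)"] A
    by (simp add: R_def algebra_simps)
  moreover have "fdeg R = deg (jac f g h)"
  proof -
    have "R = (0, 0, jac f g h) \<or> R = (0, - jac f g h, 0) \<or> R = (jac f g h, 0, 0)"
      unfolding R_def using i(1) jac_laplace[of f g h] by auto
    then show ?thesis by (auto simp: fdeg_def max_def intro: antisym)
  qed
  moreover have "deg (jac f g h) \<le> deg h + dd f g" by (rule jac_deg_le)
  ultimately show False using neg by simp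
qed

lemma fdeg_smul_dd: "p \<noteq> 0 \<Longrightarrow> wedge f g \<noteq> 0 \<Longrightarrow> fdeg (smul p (wedge f g)) = deg p + dd f g"
  by (simp add: fdeg_smul dd_def)

lemma deg_sum_attained:
  assumes "q = (\<Sum>p\<in>S. C (c p) * f ^ fst p * g ^ snd p)" "deg f \<le> u" "deg g \<le> v"
    "finite S" "\<And>p. p \<in> S \<Longrightarrow> real (fst p) * u + real (snd p) * v \<le> V" "V \<ge> 0"
  shows "deg q \<le> V"
    "cf q V = (\<Sum>p\<in>{p\<in>S. real (fst p) * u + real (snd p) * v = V}. c p * cf f u ^ fst p * cf g v ^ snd p)"
proof -
  have t: "deg (C (c p) * f ^ fst p * g ^ snd p) \<le> real (fst p) * u + real (snd p) * v" for p
  proof -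
    have "deg (C (c p) * f ^ fst p * g ^ snd p) \<le> deg (C (c p) * f ^ fst p) + deg (g ^ snd p)"
      by (rule deg_mult_le)
    also have "\<dots> \<le> deg (f ^ fst p) + deg (g ^ snd p)" using deg_C_mult_le[of "c p" "f ^ fst p"] by linarith
    also have "\<dots> \<le> real (fst p) * u + real (snd p) * v"
      using assms by (auto intro!: add_mono mult_left_mono)
    finally show ?thesis .
  qed
  show "deg q \<le> V" unfolding assms(1)
    by (rule deg_sum_le[OF assms(6) order.trans[OF t assms(5)]])
  have "cf q V = (\<Sum>p\<in>S. cf (C (c p) * f ^ fst p * g ^ snd p) V)" by (simp add: assms(1) cf_sum)
  also have "\<dots> = (\<Sum>p\<in>{p\<in>S. real (fst p) * u + real (snd p) * v = V}. c p * cf f u ^ fst p * cf g v ^ snd p)"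
  proof (rule sum.mono_neutral_cong_right)
    show "\<forall>p\<in>S - {p \<in> S. real (fst p) * u + real (snd p) * v = V}. cf (C (c p) * f ^ fst p * g ^ snd p) V = 0"
    proof
      fix p assume "p \<in> S - {p \<in> S. real (fst p) * u + real (snd p) * v = V}"
      with assms(5)[of p] t[of p] show "cf (C (c p) * f ^ fst p * g ^ snd p) V = 0"
        by (intro cf_above) auto
    qed
    fix p assume "p \<in> {p\<in>S. real (fst p) * u + real (snd p) * v = V}"
    then have V: "V = real (fst p) * u + real (snd p) * v" by simp
    have "deg (f ^ fst p) \<le> real (fst p) * u" "deg (g ^ snd p) \<le> real (snd p) * v"
      using assms by (auto intro!: mult_left_mono)
    then show "cf (C (c p) * f ^ fst p * g ^ snd p) V = c p * cf f u ^ fst p * cf g v ^ snd p"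
      unfolding V by (simp add: mult.assoc cf_C_mult cf_mult cf_power assms)
  qed (use assms in auto)
  finally show "cf q V = (\<Sum>p\<in>{p\<in>S. real (fst p) * u + real (snd p) * v = V}. c p * cf f u ^ fst p * cf g v ^ snd p)" .
qed

end

lemma C_of_nat: "C (of_nat n) = of_nat n"
  by (simp add: C_def single_of_nat)

lemma wedge_power_self: "wedge (g ^ j) g = 0"
proof (induction j)
  case 0
  show ?case using wedge_C(1)[of 1 g] by simp
qed (simp add: wedge_mult_left smul_simps)

lemma wedge_monom:
  "smul f (wedge (C k * f ^ i * g ^ j) g) = smul (C (of_nat i * k) * f ^ i * g ^ j) (wedge f g)"
proof -
  have "wedge (C k * f ^ i * g ^ j) g = smul (g ^ j) (smul (C k) (wedge (f ^ i) g))"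
    by (simp add: wedge_mult_left wedge_power_self smul_simps)
  then have "smul f (wedge (C k * f ^ i * g ^ j) g) = smul (g ^ j * C k) (smul f (wedge (f ^ i) g))"
    by (simp add: smul_simps algebra_simps)
  also have "\<dots> = smul (C (of_nat i * k) * f ^ i * g ^ j) (wedge f g)"
    by (simp add: wedge_power smul_simps C_mult C_of_nat algebra_simps)
  finally show ?thesis .
qed

context weights
begin

definition wt :: "poly3 \<Rightarrow> poly3 \<Rightarrow> nat \<times> nat \<Rightarrow> real" where
  "wt f g p = real (fst p) * deg f + real (snd p) * deg g"

section \<open>Degrees in subalgebras with two generators\<close>

text \<open>The expression of \<open>q\<close> as a polynomial in \<open>f\<close> and \<open>g\<close> involves no cancellation of leading terms.\<close>
definition nonc :: "poly3 \<Rightarrow> poly3 \<Rightarrow> poly3 \<Rightarrow> bool" where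
  "nonc f g q \<longleftrightarrow> (\<exists>S c. finite S \<and> q = (\<Sum>p\<in>S. C (c p) * f ^ fst p * g ^ snd p)
     \<and> (\<forall>p\<in>S. c p \<noteq> 0 \<and> wt f g p \<le> deg q) \<and> (q \<noteq> 0 \<longrightarrow> (\<exists>p\<in>S. deg q = wt f g p)))"

text \<open>On a line of constant weight the first exponents are congruent modulo p, where (p, r) is
  the primitive relation between u and v. More than m distinct ones spread over at least m steps of
  length p, so the largest is at least m p and V splits off m copies of p u.\<close>

lemma top_progression:
  fixes T :: "(nat \<times> nat) set"
  assumes "finite T" "card T > m" "m \<ge> 1" "u > 0" "v > 0"
    "\<And>p. p \<in> T \<Longrightarrow> real (fst p) * u + real (snd p) * v = V"
  obtains p r a b where "p \<ge> 1" "r \<ge> 1" "coprime p r" "real p * u = real r * v"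
    "V = real m * (real p * u) + real a * u + real b * v"
proof -
  have inj: "inj_on fst T"
  proof (rule inj_onI)
    fix x y assume xy: "x \<in> T" "y \<in> T" "fst x = fst y"
    then have "real (fst y) * u + real (snd x) * v = real (fst y) * u + real (snd y) * v"
      using assms(6)[of x] assms(6)[of y] by simp
    then have "real (snd x) * v = real (snd y) * v" by linarith
    then show "x = y" using xy assms(5) by (simp add: prod_eq_iff)
  qed
  define I where "I = fst ` T"
  have cI: "finite I" "card I > m" using assms inj by (simp_all add: I_def card_image)
  then have "I \<noteq> {}" by auto
  define i0 where "i0 = Min I"
  have i0: "i0 \<in> I" "\<And>i. i \<in> I \<Longrightarrow> i0 \<le> i" using cI \<open>I \<noteq> {}\<close> by (auto simp: i0_def)
  have diff: "\<exists>k. real (i - i0) * u = real k * v \<and> (i > i0 \<longrightarrow> k \<ge> 1)" if iI: "i \<in> I" for i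
  proof -
    obtain j where j: "(i, j) \<in> T" using iI by (auto simp: I_def)
    obtain j0 where j0: "(i0, j0) \<in> T" using i0 by (auto simp: I_def)
    have eq: "real i * u + real j * v = real i0 * u + real j0 * v"
      using assms(6)[OF j] assms(6)[OF j0] by simp
    have "real i0 * u \<le> real i * u" using i0(2)[OF iI] assms by simp
    then have "real j * v \<le> real j0 * v" using eq by linarith
    then have "j \<le> j0" using assms by simp
    have "real (i - i0) * u = real (j0 - j) * v"
      using eq i0(2)[OF iI] \<open>j \<le> j0\<close> by (simp add: of_nat_diff algebra_simps)
    moreover have "j0 - j \<ge> 1" if "i > i0"
    proof (rule ccontr)
      assume "\<not> j0 - j \<ge> 1"
      then have "j = j0" using \<open>j \<le> j0\<close> by simp
      then have "real i * u = real i0 * u" using eq by simp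
      then show False using that assms by simp
    qed
    ultimately show ?thesis by blast
  qed
  have "\<exists>i\<in>I. i \<noteq> i0"
  proof (rule ccontr)
    assume "\<not> ?thesis"
    then have "I = {i0}" using i0(1) by blast
    then show False using cI assms by simp
  qed
  then obtain i1 where i1: "i1 \<in> I" "i1 \<noteq> i0" by blast
  with i0(2)[OF i1(1)] have i1: "i1 \<in> I" "i1 > i0" by simp_all
  then obtain k where k: "real (i1 - i0) * u = real k * v" "k \<ge> 1" using diff by blast
  define n where "n = i1 - i0"
  have n: "n \<ge> 1" "real n * u = real k * v" using i1 k by (simp_all add: n_def)
  define g where "g = gcd n k"
  have g: "g > 0" using n by (simp add: g_def)
  define p r where "p = n div g" and "r = k div g"
  have np: "n = p * g" "k = r * g" by (simp_all add: p_def r_def g_def)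
  have pr: "p \<ge> 1" "r \<ge> 1" using np n k by (auto simp: Suc_le_eq intro!: Nat.gr0I)
  have cop: "coprime p r" unfolding p_def r_def g_def by (rule div_gcd_coprime) (use n in simp)
  have pu: "real p * u = real r * v"
  proof -
    have "real g * (real p * u) = real g * (real r * v)" using n np by (simp add: algebra_simps)
    then show ?thesis using g by simp
  qed
  have dvd: "p dvd i - i0" if iI: "i \<in> I" for i
  proof -
    obtain k' where k': "real (i - i0) * u = real k' * v" using diff[OF iI] by blast
    have "real (i - i0) * real r * v = real (i - i0) * (real p * u)" using pu by simp
    also have "\<dots> = real p * (real (i - i0) * u)" by simp
    also have "\<dots> = real p * real k' * v" using k' by simp
    finally have "real ((i - i0) * r) = real (p * k')" using assms(5) by simp
    then have "(i - i0) * r = p * k'" unfolding of_nat_eq_iff .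
    then have "p dvd (i - i0) * r" by simp
    then show ?thesis using cop by (simp add: coprime_dvd_mult_left_iff)
  qed
  define h where "h i = (i - i0) div p" for i
  have "inj_on h I"
  proof (rule inj_onI)
    fix x y assume xy: "x \<in> I" "y \<in> I" "h x = h y"
    then have "(x - i0) div p * p = (y - i0) div p * p" by (simp add: h_def)
    then have "x - i0 = y - i0" using dvd[OF xy(1)] dvd[OF xy(2)] by simp
    then show "x = y" using i0(2)[OF xy(1)] i0(2)[OF xy(2)] by simp
  qed
  then have "card (h ` I) > m" using cI by (simp add: card_image)
  then have "\<not> h ` I \<subseteq> {..<m}" using card_mono[of "{..<m}" "h ` I"] by auto
  then obtain i where i: "i \<in> I" "h i \<ge> m" by force
  then have "m * p \<le> (i - i0) div p * p" by (simp add: h_def)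
  also have "\<dots> \<le> i - i0" by simp
  finally have ige: "m * p \<le> i" by simp
  obtain j where j: "(i, j) \<in> T" using i by (auto simp: I_def)
  have V: "V = real m * (real p * u) + real (i - m * p) * u + real j * v"
    using assms(6)[OF j] ige by (simp add: of_nat_diff algebra_simps)
  show thesis by (rule that[OF pr cop pu V])
qed

text \<open>If leading terms cancel in \<open>q = P(f,g)\<close>, differentiating \<open>P\<close> repeatedly by \<open>f d/df\<close> ends in a polynomial
  without cancellation; each step lowers the degree bound by at most \<open>deg f + deg g - dd f g\<close>.\<close>
lemma parachute:
  assumes nz: "wedge f g \<noteq> 0" and u: "deg f > 0" and v: "deg g > 0" and q: "q \<in> alg f g"
  obtains (nonc) "nonc f g q"
  | (canc) p r m a b V where "p \<ge> 1" "r \<ge> 1" "coprime p r" "real p * deg f = real r * deg g" "m \<ge> (1::nat)"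
      "V = real m * (real p * deg f) + real a * deg f + real b * deg g" "deg q < V"
      "deg q \<ge> V - real m * (deg f + deg g - dd f g)"
      "deg f + dd q g \<ge> V - real (m - 1) * (deg f + deg g - dd f g) + dd f g"
proof -
  from q obtain S0 c where S0: "finite S0" "q = (\<Sum>p\<in>S0. C (c p) * f ^ fst p * g ^ snd p)" by (auto simp: alg_def)
  define S where "S = {p\<in>S0. c p \<noteq> 0}"
  have S: "finite S" "\<And>p. p \<in> S \<Longrightarrow> c p \<noteq> 0" using S0 by (auto simp: S_def)
  have qS: "q = (\<Sum>p\<in>S. C (c p) * f ^ fst p * g ^ snd p)"
    unfolding S0(2) by (rule sum.mono_neutral_right) (use S0 in \<open>auto simp: S_def\<close>)
  show thesis
  proof (cases "S = {}")
    case True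
    then have "nonc f g q" unfolding nonc_def using qS by (intro exI[of _ "{}"]) simp
    then show thesis by (rule nonc)
  next
    case False
    define V where "V = Max (wt f g ` S)"
    have V: "\<And>p. p \<in> S \<Longrightarrow> wt f g p \<le> V" using S by (simp add: V_def)
    have "V \<in> wt f g ` S" unfolding V_def using S False by (intro Max_in) auto
    then obtain p0 where p0: "p0 \<in> S" "wt f g p0 = V" by auto
    have V0: "V \<ge> 0" using p0(2) u v by (auto simp: wt_def)
    define T where "T = {p\<in>S. wt f g p = V}"
    have T: "finite T" "p0 \<in> T" using S p0 by (auto simp: T_def)
    \<comment> \<open>\<open>t r\<close> arises from the expression P by applying f d/df r times;
      this multiplies the term with f-exponent i by i^r.\<close>
    define t where "t r = (\<Sum>p\<in>S. C (of_nat (fst p) ^ r * c p) * f ^ fst p * g ^ snd p)" for r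
    define x where "x p = c p * cf f (deg f) ^ fst p * cf g (deg g) ^ snd p" for p
    have fg: "f \<noteq> 0" "g \<noteq> 0" using u v by auto
    have x: "p \<in> T \<Longrightarrow> x p \<noteq> 0" for p
      using S(2)[of p] cf_deg[OF fg(1)] cf_deg[OF fg(2)] by (auto simp: x_def T_def)
    have t0: "t 0 = q" by (simp add: t_def qS)
    have tV: "deg (t r) \<le> V" "cf (t r) V = (\<Sum>p\<in>T. of_nat (fst p) ^ r * x p)" for r
    proof -
      have Tr: "{p\<in>S. real (fst p) * deg f + real (snd p) * deg g = V} = T" by (simp add: T_def wt_def)
      note * = deg_sum_attained[OF t_def[of r] order.refl order.refl S(1) V[unfolded wt_def] V0, unfolded Tr]
      show "deg (t r) \<le> V" by (rule *(1))
      have "cf (t r) V = (\<Sum>p\<in>T. of_nat (fst p) ^ r * c p * cf f (deg f) ^ fst p * cf g (deg g) ^ snd p)"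
        by (rule *(2))
      then show "cf (t r) V = (\<Sum>p\<in>T. of_nat (fst p) ^ r * x p)"
        by (simp add: x_def mult.assoc)
    qed
    have step: "smul f (wedge (t r) g) = smul (t (Suc r)) (wedge f g)" for r
      unfolding t_def wedge_sum smul_sum smul_sum_left
      by (intro sum.cong refl, subst wedge_monom) (simp add: mult.assoc)
    have inj: "inj_on fst T"
    proof (rule inj_onI)
      fix x y assume xy: "x \<in> T" "y \<in> T" "fst x = fst y"
      then have "real (fst y) * deg f + real (snd x) * deg g = real (fst y) * deg f + real (snd y) * deg g"
        unfolding T_def wt_def by (metis (mono_tags, lifting) mem_Collect_eq)
      then have "real (snd x) * deg g = real (snd y) * deg g" by linarith
      then show "x = y" using xy v by (simp add: prod_eq_iff)
    qed
    \<comment> \<open>Otherwise the top coefficients would have vanishing power sums in the distinct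
      f-exponents, and \<open>power_sums_zero\<close> would make all of them 0.\<close>
    have "\<exists>r<card T. cf (t r) V \<noteq> 0"
    proof (rule ccontr)
      assume neg: "\<not> ?thesis"
      define a where "a i = x (inv_into T fst i)" for i
      have ax: "a (fst p) = x p" if "p \<in> T" for p using inj that by (simp add: a_def)
      have "(\<Sum>i\<in>fst ` T. a i * of_nat i ^ r) = 0" if "r < card (fst ` T)" for r
      proof -
        have "(\<Sum>i\<in>fst ` T. a i * of_nat i ^ r) = (\<Sum>p\<in>T. x p * of_nat (fst p) ^ r)"
          by (simp add: sum.reindex[OF inj] ax)
        also have "\<dots> = cf (t r) V" by (simp add: tV mult.commute)
        also have "\<dots> = 0" using neg that inj by (simp add: card_image)
        finally show ?thesis .
      qed
      then have "a (fst p0) = 0" by (rule power_sums_zero[rotated]) (use T in auto)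
      then show False using ax[OF T(2)] x[OF T(2)] by simp
    qed
    define m where "m = (LEAST r. cf (t r) V \<noteq> 0)"
    from \<open>\<exists>r<card T. cf (t r) V \<noteq> 0\<close> obtain r0 where r0: "r0 < card T" "cf (t r0) V \<noteq> 0" by blast
    have m: "cf (t m) V \<noteq> 0" "m < card T"
      unfolding m_def using LeastI[of "\<lambda>r. cf (t r) V \<noteq> 0", OF r0(2)]
        Least_le[of "\<lambda>r. cf (t r) V \<noteq> 0", OF r0(2)] r0(1) by linarith+
    show thesis
    proof (cases "m = 0")
      case True
      then have "cf q V \<noteq> 0" using m t0 by simp
      then have "deg q = V" using deg_eqI[of q V] tV(1)[of 0] t0 by simp
      then have dq: "\<forall>p\<in>S. c p \<noteq> 0 \<and> wt f g p \<le> deg q" "\<exists>p\<in>S. deg q = wt f g p"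
        using S V \<open>deg q = V\<close> by simp (rule bexI[OF _ p0(1)], simp add: p0 \<open>deg q = V\<close>)
      have "nonc f g q" unfolding nonc_def
        by (rule exI[of _ S], rule exI[of _ c]) (intro conjI impI S(1) qS dq)
      then show thesis by (rule nonc)
    next
      case False
      then have m1: "m \<ge> 1" by simp
      define N where "N = deg f + deg g - dd f g"
      have up: "t r \<noteq> 0 \<and> deg f + dd (t r) g = deg (t (Suc r)) + dd f g" if "t (Suc r) \<noteq> 0" for r
      proof -
        have "smul (t (Suc r)) (wedge f g) \<noteq> 0" using that nz by (simp add: smul_eq_0)
        then have w: "wedge (t r) g \<noteq> 0" "f \<noteq> 0" using step[of r] by (auto simp: smul_simps)
        then have "fdeg (smul f (wedge (t r) g)) = deg f + dd (t r) g" by (simp add: fdeg_smul_dd)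
        moreover have "fdeg (smul (t (Suc r)) (wedge f g)) = deg (t (Suc r)) + dd f g"
          using that nz by (simp add: fdeg_smul_dd)
        ultimately show ?thesis using step[of r] w by auto
      qed
      \<comment> \<open>Going back from \<open>t m\<close>, which has the full degree V, each step
        loses at most N, since a wedge has at most the sum of the two degrees.\<close>
      have chain: "t (m - k) \<noteq> 0 \<and> deg (t (m - k)) \<ge> V - real k * N" if "k \<le> m" for k
        using that
      proof (induction k)
        case 0
        have "t m \<noteq> 0" using m by auto
        moreover have "deg (t m) = V" using deg_eqI[OF tV(1) m(1)] .
        ultimately show ?case by simp
      next
        case (Suc k)
        then have e: "Suc (m - Suc k) = m - k" by simp
        have IH: "t (m - k) \<noteq> 0" "deg (t (m - k)) \<ge> V - real k * N" using Suc by auto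
        have "t (m - Suc k) \<noteq> 0" "deg f + dd (t (m - Suc k)) g = deg (t (m - k)) + dd f g"
          using up[of "m - Suc k"] IH e by auto
        moreover have "dd (t (m - Suc k)) g \<le> deg (t (m - Suc k)) + deg g" by (rule dd_le)
        ultimately show ?case using IH by (simp add: N_def algebra_simps)
      qed
      have t1: "t 1 \<noteq> 0" "deg (t 1) \<ge> V - real (m - 1) * N" using chain[of "m - 1"] m1 by auto
      have dq: "deg q \<ge> V - real m * N" using chain[of m] t0 by simp
      \<comment> \<open>In the last step the term \<open>dd q g\<close> is kept instead of being
        estimated by deg q + deg g; this is the version that yields thresholds.\<close>
      have ddq: "deg f + dd q g \<ge> V - real (m - 1) * N + dd f g"
        using up[of 0] t1 t0 by simp
      have Teq: "\<And>p. p \<in> T \<Longrightarrow> real (fst p) * deg f + real (snd p) * deg g = V"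
        by (simp add: T_def wt_def)
      obtain p r a b where P: "p \<ge> 1" "r \<ge> 1" "coprime p r" "real p * deg f = real r * deg g"
        "V = real m * (real p * deg f) + real a * deg f + real b * deg g"
        by (rule top_progression[OF T(1) m(2) m1 u v Teq])
      have "real m * (real p * deg f) > 0" using m1 P(1) u by (intro mult_pos_pos) auto
      moreover have "real a * deg f \<ge> 0" "real b * deg g \<ge> 0" using u v by simp_all
      ultimately have "V > 0" using P(5) by linarith
      moreover have "cf q V = 0"
        using not_less_Least[of 0 "\<lambda>r. cf (t r) V \<noteq> 0"] False t0 by (simp add: m_def)
      ultimately have "deg q < V" using deg_less[of q V] tV(1)[of 0] t0 by simp
      show thesis
        by (rule canc[OF P(1-4) m1 P(5) \<open>deg q < V\<close> dq[unfolded N_def] ddq[unfolded N_def]])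
    qed
  qed
qed

text \<open>The form in which the parachute inequality is used; \<open>L\<close> is the degree of the minimal relation between
  the leading monomials.\<close>
lemma cancel_bound:
  assumes "wedge f g \<noteq> 0" "deg f > 0" "deg g > 0" "q \<in> alg f g" "\<not> nonc f g q"
  obtains p r where "p \<ge> 1" "r \<ge> 1" "coprime p r" "real p * deg f = real r * deg g"
      "real p * deg f \<le> deg q + deg f + deg g - dd f g"
      "deg f + deg g - dd f g \<le> real p * deg f \<Longrightarrow> dd q g \<ge> real p * deg f - deg f + dd f g"
proof (rule parachute[OF assms(1-4)])
  assume "nonc f g q" then show thesis using assms(5) by blast
next
  fix p r a b :: nat and m :: nat and V
  assume P: "p \<ge> 1" "r \<ge> 1" "coprime p r" "real p * deg f = real r * deg g" and m: "m \<ge> 1"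
    and V: "V = real m * (real p * deg f) + real a * deg f + real b * deg g"
    and b: "deg q \<ge> V - real m * (deg f + deg g - dd f g)"
    and d: "deg f + dd q g \<ge> V - real (m - 1) * (deg f + deg g - dd f g) + dd f g"
  define L where "L = real p * deg f"
  define N where "N = deg f + deg g - dd f g"
  have ab: "real a * deg f + real b * deg g \<ge> 0" using assms by simp
  have VL: "V \<ge> real m * L" using V ab by (simp add: L_def)
  have le: "L \<le> deg q + N"
  proof (cases "L \<le> N")
    case False
    then have "1 * (L - N) \<le> real m * (L - N)" using m by (intro mult_right_mono) auto
    then show ?thesis using b VL by (simp add: N_def[symmetric] algebra_simps)
  qed (use deg_nonneg[of q] in linarith)
  show thesis
  proof (rule that[OF P])
    show "real p * deg f \<le> deg q + deg f + deg g - dd f g" using le by (simp add: L_def N_def)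
    assume "deg f + deg g - dd f g \<le> real p * deg f"
    then have NL: "N \<le> L" by (simp add: N_def L_def)
    have "real (m - 1) * N \<le> real (m - 1) * L" using NL by (intro mult_left_mono) auto
    moreover have "real m * L = real (m - 1) * L + L" using m by (simp add: of_nat_diff algebra_simps)
    ultimately have "V - real (m - 1) * N \<ge> L" using VL by linarith
    then show "dd q g \<ge> real p * deg f - deg f + dd f g" using d by (simp add: N_def L_def)
  qed
qed

lemma nonc_degree: "nonc f g q \<Longrightarrow> \<exists>i j. deg q = real i * deg f + real j * deg g"
  unfolding nonc_def wt_def
  by (cases "q = 0") (auto intro: exI[of _ 0] exI[of _ "0::nat"])

text \<open>Serves to read off the shape of q: without cancellation every term of the expression has
  degree at most deg q, so it suffices that a linear space contains these monomials.\<close>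

lemma nonc_monomials:
  assumes "nonc f g q" "\<And>p. wt f g p \<le> deg q \<Longrightarrow> f ^ fst p * g ^ snd p \<in> R"
    "\<And>c x. x \<in> R \<Longrightarrow> C c * x \<in> R" "0 \<in> R" "\<And>x y. x \<in> R \<Longrightarrow> y \<in> R \<Longrightarrow> x + y \<in> R"
  shows "q \<in> R"
proof -
  obtain S c where S: "finite S" "q = (\<Sum>p\<in>S. C (c p) * f ^ fst p * g ^ snd p)" "\<And>p. p \<in> S \<Longrightarrow> wt f g p \<le> deg q"
    using assms(1) unfolding nonc_def by blast
  have "(\<Sum>p\<in>T. C (c p) * f ^ fst p * g ^ snd p) \<in> R" if "finite T" "T \<subseteq> S" for T
    using that
  proof (induction T rule: finite_induct)
    case (insert x T)
    have "C (c x) * (f ^ fst x * g ^ snd x) \<in> R" using insert S assms by blast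
    then show ?case using insert assms(5) by (simp add: mult.assoc)
  qed (simp add: assms)
  then show ?thesis using S by blast
qed

lemma nonc_alg1_snd:
  assumes "nonc f g q" "deg q < deg f" shows "q \<in> alg1 g"
proof (rule nonc_monomials[OF assms(1)])
  fix p assume p: "wt f g p \<le> deg q"
  have "fst p = 0"
  proof (rule ccontr)
    assume "fst p \<noteq> 0"
    then have "deg f \<le> real (fst p) * deg f" using mult_right_mono[of 1 "real (fst p)" "deg f"] by simp
    moreover have "real (snd p) * deg g \<ge> 0" by simp
    ultimately show False using p assms unfolding wt_def by linarith
  qed
  then show "f ^ fst p * g ^ snd p \<in> alg1 g" by (simp add: alg1_power)
qed (auto intro: alg1_mult alg1_add)

text \<open>In powers of a single polynomial no leading terms can cancel. The element q' is the
  derivative of q with respect to f, so that dq = q' df.\<close>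

lemma alg1_degree:
  assumes "q \<in> alg1 f" "deg f > 0"
  obtains i where "deg q = real i * deg f"
    "\<exists>q'\<in>alg1 f. (\<forall>h. wedge q h = smul q' (wedge f h)) \<and> (q' = 0 \<or> deg q' + deg f = deg q)"
proof -
  from assms obtain S0 c where S0: "finite S0" "q = (\<Sum>i\<in>S0. C (c i) * f ^ i)" by (auto simp: alg1_def)
  define S where "S = {i\<in>S0. c i \<noteq> 0}"
  have S: "finite S" "\<And>p. p \<in> S \<Longrightarrow> c p \<noteq> 0" using S0 by (auto simp: S_def)
  have qS: "q = (\<Sum>i\<in>S. C (c i) * f ^ i)"
    unfolding S0(2) by (rule sum.mono_neutral_right) (use S0 in \<open>auto simp: S_def\<close>)
  have fnz: "f \<noteq> 0" using assms by auto
  have top: "deg (\<Sum>i\<in>S. C (b i) * f ^ i) = real (Max S) * deg f"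
    if "S \<noteq> {}" "b (Max S) \<noteq> 0" for b
  proof -
    have mx: "Max S \<in> S" using S that by simp
    have "(\<Sum>i\<in>S. C (b i) * f ^ i) = C (b (Max S)) * f ^ Max S + (\<Sum>i\<in>S - {Max S}. C (b i) * f ^ i)"
      by (rule sum.remove[OF S(1) mx])
    moreover have "deg (\<Sum>i\<in>S - {Max S}. C (b i) * f ^ i) < real (Max S) * deg f \<or> (\<Sum>i\<in>S - {Max S}. C (b i) * f ^ i) = 0"
    proof (cases "S - {Max S} = {}")
      case False
      then obtain i where "i \<in> S - {Max S}" by blast
      then have "i < Max S" using Max_ge[OF S(1), of i] by (auto simp: less_le)
      then have M: "Max S \<ge> 1" by simp
      have "deg (\<Sum>i\<in>S - {Max S}. C (b i) * f ^ i) \<le> real (Max S - 1) * deg f"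
      proof (rule deg_sum_le)
        fix i assume "i \<in> S - {Max S}"
        then have "i < Max S" using Max_ge[OF S(1), of i] by (auto simp: less_le)
        then have "i \<le> Max S - 1" by simp
        then have "real i * deg f \<le> real (Max S - 1) * deg f" by (intro mult_right_mono) auto
        then show "deg (C (b i) * f ^ i) \<le> real (Max S - 1) * deg f"
          using deg_C_mult_le[of "b i" "f ^ i"] by simp
      qed simp
      also have "\<dots> < real (Max S) * deg f" using M assms by simp
      finally show ?thesis by blast
    qed (simp only: sum.empty, simp)
    moreover have "deg (C (b (Max S)) * f ^ Max S) = real (Max S) * deg f" using that by simp
    ultimately show ?thesis using deg_add_eq[of "\<Sum>i\<in>S - {Max S}. C (b i) * f ^ i" "C (b (Max S)) * f ^ Max S"] by auto
  qed
  define q' where "q' = (\<Sum>i\<in>S. C (of_nat i * c i) * f ^ (i - 1))"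
  have q'1: "q' \<in> alg1 f" unfolding q'_def by (auto intro!: alg1_sum alg1_mult alg1_power)
  have fq': "f * q' = (\<Sum>i\<in>S. C (of_nat i * c i) * f ^ i)"
    unfolding q'_def sum_distrib_left
  proof (rule sum.cong[OF refl])
    fix i show "f * (C (of_nat i * c i) * f ^ (i - 1)) = C (of_nat i * c i) * f ^ i"
      by (cases i) (simp_all add: algebra_simps)
  qed
  have wq: "wedge q h = smul q' (wedge f h)" for h
  proof -
    have "smul f (wedge q h) = smul (f * q') (wedge f h)"
      unfolding fq' unfolding qS wedge_sum smul_sum smul_sum_left
    proof (intro sum.cong refl)
      fix i
      have "smul f (wedge (C (c i) * f ^ i) h) = smul (C (c i)) (smul f (wedge (f ^ i) h))"
        by (simp add: wedge_C_mult smul_simps mult.commute[of f "C (c i)"])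
      also have "\<dots> = smul (C (of_nat i * c i) * f ^ i) (wedge f h)"
        by (simp add: wedge_power smul_simps C_mult C_of_nat algebra_simps)
      finally show "smul f (wedge (C (c i) * f ^ i) h) = smul (C (of_nat i * c i) * f ^ i) (wedge f h)" .
    qed
    then have "smul f (wedge q h - smul q' (wedge f h)) = 0"
      by (simp add: smul_def prod_eq_iff algebra_simps)
    then show ?thesis using fnz by (simp add: smul_eq_0)
  qed
  show thesis
  proof (cases "S = {}")
    case True
    then have "q = 0" "q' = 0" by (simp_all add: qS q'_def)
    then show thesis using q'1 wq by (intro that[of 0] bexI[of _ q']) auto
  next
    case False
    then have mx: "Max S \<in> S" using S by simp
    have dq: "deg q = real (Max S) * deg f" using top[OF False, of c] S mx qS by simp
    have "q' = 0 \<or> deg q' + deg f = deg q"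
    proof (cases "Max S = 0")
      case True
      then have "S = {0}" using S(1) mx Max_ge[of S] by force
      then show ?thesis by (simp add: q'_def)
    next
      case False
      then have "deg (f * q') = real (Max S) * deg f"
        unfolding fq' using top[OF \<open>S \<noteq> {}\<close>, of "\<lambda>i. of_nat i * c i"] S mx by simp
      then show ?thesis using dq fnz by (auto simp: deg_mult_0 split: if_splits)
    qed
    then show thesis using that[OF dq] q'1 wq by blast
  qed
qed

end

section \<open>Elementary transformations of one entry of a triple\<close>

lemma mset3_eq:
  "{#a, b, c#} = {#x, y, z#} \<longleftrightarrow>
    (a = x \<and> b = y \<and> c = z) \<or> (a = x \<and> b = z \<and> c = y) \<or> (a = y \<and> b = x \<and> c = z) \<or>
    (a = y \<and> b = z \<and> c = x) \<or> (a = z \<and> b = x \<and> c = y) \<or> (a = z \<and> b = y \<and> c = x)"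
  by (auto simp: add_eq_conv_ex)

text \<open>The scalar factor is included so that the relation is symmetric and transitive.\<close>

definition nb :: "poly3 \<Rightarrow> poly3 \<Rightarrow> poly3 \<Rightarrow> poly3 \<Rightarrow> bool" where
  "nb f g h h' \<longleftrightarrow> (\<exists>c q. c \<noteq> 0 \<and> q \<in> alg f g \<and> h' = C c * h + q)"

lemma nbI: "c \<noteq> 0 \<Longrightarrow> q \<in> alg f g \<Longrightarrow> nb f g h (C c * h + q)"
  unfolding nb_def by blast

lemma nb_add: "q \<in> alg f g \<Longrightarrow> nb f g h (h + q)"
  using nbI[of 1 q f g h] by simp

lemma nb_refl [simp]: "nb f g h h"
  using nbI[of 1 0 f g h] by simp

lemma nb_swap: "nb f g = nb g f"
  by (simp add: nb_def alg_sym fun_eq_iff)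

lemma nb_sym: "nb f g h h' \<Longrightarrow> nb f g h' h"
proof -
  assume "nb f g h h'"
  then obtain c q where c: "c \<noteq> 0" "q \<in> alg f g" "h' = C c * h + q" unfolding nb_def by blast
  have "h = C (1 / c) * h' + C (- (1 / c)) * q"
    using c(1) by (simp add: c(3) C_inverse_cancel distrib_left C_uminus)
  then show ?thesis using c by (metis nbI alg_mult alg_C divide_eq_0_iff zero_neq_one)
qed

lemma nb_trans: "nb f g h h' \<Longrightarrow> nb f g h' h'' \<Longrightarrow> nb f g h h''"
proof -
  assume "nb f g h h'" "nb f g h' h''"
  then obtain c q d r where c: "c \<noteq> 0" "q \<in> alg f g" "h' = C c * h + q" "d \<noteq> 0" "r \<in> alg f g" "h'' = C d * h' + r"
    unfolding nb_def by blast
  have "h'' = C (d * c) * h + (C d * q + r)" by (simp add: c(3,6) C_mult algebra_simps)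
  moreover have "C d * q + r \<in> alg f g" using c by (intro alg_add alg_mult) auto
  ultimately show ?thesis using c(1,4) nbI[of "d * c" "C d * q + r" f g h] by simp
qed

lemma alg_eq1:
  assumes "c \<noteq> 0" "r \<in> alg1 f"
  shows "alg f (C c * g + r) = alg f g" "alg (C c * g + r) f = alg f g"
proof -
  have r: "r \<in> alg f x" for x using assms by (simp add: alg1_alg)
  have "g = C (1 / c) * ((C c * g + r) - r)" using assms by (simp add: C_inverse_cancel)
  then have "g \<in> alg f (C c * g + r)" using r by (metis alg_mult alg_C alg_diff alg_gen2)
  moreover have "C c * g + r \<in> alg f g" using r by (simp add: alg_add alg_mult)
  ultimately show "alg f (C c * g + r) = alg f g"
    using alg_subst[of f f g "C c * g + r"] alg_subst[of f f "C c * g + r" g] by auto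
  then show "alg (C c * g + r) f = alg f g" by (simp add: alg_sym)
qed

lemma jac_C_mult: "jac f g (C c * h) = C c * jac f g h"
  by (simp add: jac_mult jac_C)

lemma gt_nb: "gt f g h \<Longrightarrow> nb f g h h' \<Longrightarrow> gt f g h'"
proof -
  assume "gt f g h" "nb f g h h'"
  then obtain c d q where "c \<noteq> 0" "q \<in> alg f g" "h' = C c * h + q" "d \<noteq> 0" "jac f g h = single (1,1,1) d"
    unfolding nb_def gt_def by blast
  then have "jac f g h' = single (1,1,1) (c * d)" "c * d \<noteq> 0"
    by (simp_all add: jac_add jac_alg jac_C_mult) (simp add: C_def mult_single)
  then show ?thesis unfolding gt_def by blast
qed

lemma gt_mset: "gt f g h \<Longrightarrow> {#f, g, h#} = {#x, y, z#} \<Longrightarrow> gt x y z"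
  unfolding mset3_eq using gt_perm by metis

context weights
begin

text \<open>As q is smaller than a and not a polynomial in b, leading terms cancel, and the minimal
  relation satisfies p deg a < 2 deg a + deg b. If neither p nor r is 1, this leaves p = 2 when a is
  the larger one, and r = 2, p = 3 when b is.\<close>

lemma drop_degree_cases:
  assumes nz: "wedge a b \<noteq> 0" and pos: "deg a > 0" "deg b > 0" and q: "q \<in> alg a b" "deg q < deg a" "q \<notin> alg1 b"
  obtains t where "t \<ge> (1::nat)" "deg a = real t * deg b"
  | s where "s \<ge> (2::nat)" "deg b = real s * deg a"
  | t where "odd t" "t \<ge> (3::nat)" "2 * deg a = real t * deg b" "deg q \<ge> deg a - deg b + dd a b"
  | "2 * deg b = 3 * deg a" "deg q \<ge> deg b - deg a + dd a b"
proof -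
  have nn: "\<not> nonc a b q" using nonc_alg1_snd q by blast
  have e: "dd a b > 0" using dd_pos[OF nz] .
  obtain p r where P: "p \<ge> 1" "r \<ge> 1" "coprime p r" "real p * deg a = real r * deg b"
      "real p * deg a \<le> deg q + deg a + deg b - dd a b"
    by (rule cancel_bound[OF nz pos q(1) nn])
  consider "p = 1" | "p \<ge> 2" "r = 1" | "deg a = deg b" | "p \<ge> 2" "r \<ge> 2" "deg a > deg b" | "p \<ge> 2" "r \<ge> 2" "deg a < deg b"
    using P by linarith
  then show thesis
  proof cases
    case 1 then show thesis using that(1)[of r] P by simp
  next
    case 2 then show thesis using that(2)[of p] P by simp
  next
    case 3 then show thesis using that(1)[of 1] by simp
  next
    case 4
    have "p < 3"
    proof (rule ccontr)
      assume "\<not> p < 3"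
      then have "3 * deg a \<le> real p * deg a" using pos by (intro mult_right_mono) auto
      then show False using P q e 4 by linarith
    qed
    then have p: "p = 2" using 4 by simp
    then have "odd r" using P(3) by auto
    moreover have "r \<ge> 3" using 4 \<open>odd r\<close> by (cases "r = 2") auto
    ultimately show thesis using that(3)[of r] P p by auto
  next
    case 5
    have "r < 3"
    proof (rule ccontr)
      assume "\<not> r < 3"
      then have "3 * deg b \<le> real r * deg b" using pos by (intro mult_right_mono) auto
      then show False using P q e 5 by linarith
    qed
    then have r: "r = 2" using 5 by simp
    then have "odd p" using P(3) by auto
    have "p < 5"
    proof (rule ccontr)
      assume "\<not> p < 5"
      then have "5 * deg a \<le> real p * deg a" using pos by (intro mult_right_mono) auto
      then show False using P q e 5 r by simp
    qed
    then have "p = 2 \<or> p = 3 \<or> p = 4" using 5 by linarith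
    then have p: "p = 3" using \<open>odd p\<close> by auto
    show thesis using that(4) P p r by auto
  qed
qed

lemma ratio_2s:
  assumes "coprime p r" "real p * x = real r * y" "2 * x = real s * y" "odd s" "y > 0"
  shows "p = 2"
proof -
  have "real (p * s) * y = real p * (2 * x)" using assms(3) by simp
  also have "\<dots> = real (2 * r) * y" using assms(2) by simp
  finally have "real (p * s) * y = real (2 * r) * y" .
  then have eq: "p * s = 2 * r" using assms(5) by (simp only: mult_cancel_right of_nat_eq_iff) auto
  then have "p dvd 2 * r" by (metis dvd_triv_left)
  then have "p dvd 2" using assms(1) by (simp add: coprime_dvd_mult_left_iff)
  then have "p \<le> 2" by (auto dest: dvd_imp_le)
  moreover have "p \<noteq> 0" using eq assms(1) by (cases "p = 0") auto
  moreover have "p \<noteq> 1" using eq assms(4) by auto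
  ultimately show ?thesis by simp
qed

text \<open>For the ratio s : 2 the minimal relation has p = 2, so the second bound of
  \<open>cancel_bound\<close> becomes 2 deg g1 - deg g1 + \<open>dd g1 g2\<close>. This is the
  origin of the threshold in \<open>Kcen\<close>.\<close>

lemma cancel_imp_dd_ge:
  assumes nz: "wedge g1 g2 \<noteq> 0" and pos: "deg g1 > 0" "deg g2 > 0" and q: "q \<in> alg g1 g2" "\<not> nonc g1 g2 q"
    and s: "2 * deg g1 = real s * deg g2" "odd s" "s \<ge> 3"
  shows "dd q g2 \<ge> deg g1 + dd g1 g2"
proof (rule cancel_bound[OF nz pos q])
  fix p r
  assume P: "p \<ge> 1" "r \<ge> 1" "coprime p r" "real p * deg g1 = real r * deg g2"
      "deg g1 + deg g2 - dd g1 g2 \<le> real p * deg g1 \<Longrightarrow> dd q g2 \<ge> real p * deg g1 - deg g1 + dd g1 g2"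
  have "p = 2" using ratio_2s[OF P(3,4) s(1,2) pos(2)] .
  moreover have "3 * deg g2 \<le> real s * deg g2" using s pos by (intro mult_right_mono) auto
  then have "deg g2 \<le> deg g1" using s pos by linarith
  ultimately show ?thesis using P(5) dd_pos[OF nz] by simp
qed

section \<open>Reducible triples\<close>

text \<open>The centre \<open>(g1, g2)\<close> and the anchor \<open>f3\<close> of a Shestakov-Umirbaev reduction; \<open>Kf\<close> describes the triples
  of no larger degrees that elementary transformations of the first two entries carry to this centre.\<close>
definition Kcen :: "poly3 \<Rightarrow> poly3 \<Rightarrow> poly3 \<Rightarrow> bool" where
  "Kcen g1 g2 f3 \<longleftrightarrow> gt g1 g2 f3 \<and> (\<exists>s. odd s \<and> s \<ge> (3::nat) \<and> 2 * deg g1 = real s * deg g2)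
     \<and> deg f3 < deg g1 \<and> (\<forall>i::nat. deg f3 \<noteq> real i * deg g2) \<and> dd g2 f3 \<ge> deg g1 + dd g1 g2"

definition Kf :: "poly3 \<Rightarrow> poly3 \<Rightarrow> poly3 \<Rightarrow> poly3 \<Rightarrow> poly3 \<Rightarrow> complex \<Rightarrow> complex \<Rightarrow> complex \<Rightarrow> bool" where
  "Kf g1 g2 f3 f1 f2 a b c \<longleftrightarrow> (\<exists>k1 k2 p e. k1 \<noteq> 0 \<and> k2 \<noteq> 0 \<and> p \<in> alg1 g2 \<and> deg p < deg g1
     \<and> f1 = C k1 * g1 + C a * f3 ^ 2 + C c * f3 + p \<and> f2 = C k2 * g2 + C b * f3 + C e
     \<and> deg f1 \<le> deg g1 \<and> deg f2 = deg g2)"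

text \<open>The triples that are reducible in the sense of Shestakov and Umirbaev. Rule \<open>K1\<close> covers their reductions of
  types I to III, rule \<open>K4\<close> those of type IV.\<close>
inductive A :: "poly3 multiset \<Rightarrow> bool" where
  base: "gt f g h \<Longrightarrow> deg f = w1 \<Longrightarrow> deg g = w2 \<Longrightarrow> deg h = w3 \<Longrightarrow> A {#f, g, h#}"
| elem: "A {#f, g, h'#} \<Longrightarrow> nb f g h h' \<Longrightarrow> deg h' < deg h \<Longrightarrow> A {#f, g, h#}"
| K1: "Kcen g1 g2 f3 \<Longrightarrow> Kf g1 g2 f3 f1 f2 a b c \<Longrightarrow> nb g1 g2 f3 g3 \<Longrightarrow> deg g3 < deg f3
    \<Longrightarrow> A {#g1, g2, g3#} \<Longrightarrow> A {#f1, f2, f3#}"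
| K4: "Kcen g1 g2 f3 \<Longrightarrow> Kf g1 g2 f3 f1 f2 a b c \<Longrightarrow> nb g1 g2 f3 g3 \<Longrightarrow> dd g2 g3 < deg g1 + dd g1 g2
    \<Longrightarrow> 2 * deg g3 = deg g1 \<Longrightarrow> deg f3 \<le> deg g3 \<Longrightarrow> nb g2 g3 g1 g1' \<Longrightarrow> deg g1' < deg g1
    \<Longrightarrow> A {#g1', g2, g3#} \<Longrightarrow> A {#f1, f2, f3#}"

section \<open>Degrees and differentials around a centre\<close>

lemma gt_degs:
  assumes "gt f g h" shows "deg f > 0" "deg g > 0" "deg h > 0" "dd f g > 0" "dd f h > 0" "dd g h > 0"
    "wedge f g \<noteq> 0" "wedge f h \<noteq> 0" "wedge g h \<noteq> 0" "wedge g f \<noteq> 0" "wedge h f \<noteq> 0" "wedge h g \<noteq> 0"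
  using gt_deg_pos[of f g h] gt_deg_pos[of g f h] gt_deg_pos[of h f g] gt_dd_pos[of f g h] gt_dd_pos[of f h g]
    gt_dd_pos[of g h f] gt_wedge[of f g h] gt_wedge[of f h g] gt_wedge[of g h f]
    gt_wedge[of g f h] gt_wedge[of h f g] gt_wedge[of h g f] gt_perm assms by blast+

text \<open>As \<open>dd g2 f3\<close> is at most deg g2 + deg f3, the threshold bounds deg f3 from
  below. It also makes deg f3 + \<open>dd g1 g2\<close> strictly smaller than the other two sums in
  \<open>two_maxima\<close>; these are therefore equal, which determines
  \<open>dd g1 f3\<close>.\<close>

lemma Kcen_facts:
  assumes "Kcen g1 g2 f3"
  shows "gt g1 g2 f3" "deg g2 > 0" "deg g2 < deg g1" "dd g1 g2 > 0" "deg f3 < deg g1"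
    "deg f3 \<ge> deg g1 - deg g2 + dd g1 g2" "dd g2 f3 \<ge> deg g1 + dd g1 g2"
    "dd g1 f3 = dd g2 f3 + deg g1 - deg g2"
    "2 * deg g1 = 3 * deg g2 \<or> 2 * deg g1 \<ge> 5 * deg g2" "deg f3 \<noteq> real i * deg g2" "deg g1 \<noteq> real i * deg g2"
    "deg f3 > 0" "deg f3 \<noteq> deg g2"
proof -
  from assms obtain s where K: "gt g1 g2 f3" "odd s" "s \<ge> (3::nat)" "2 * deg g1 = real s * deg g2"
    "deg f3 < deg g1" "\<And>i::nat. deg f3 \<noteq> real i * deg g2" "dd g2 f3 \<ge> deg g1 + dd g1 g2"
    unfolding Kcen_def by blast
  note d = gt_degs[OF K(1)]
  show "gt g1 g2 f3" "deg g2 > 0" "dd g1 g2 > 0" "deg f3 < deg g1" "dd g2 f3 \<ge> deg g1 + dd g1 g2"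
    "deg f3 \<noteq> real i * deg g2" "deg f3 > 0" using K d by auto
  show "deg f3 \<noteq> deg g2" using K(6)[of 1] by simp
  have s3: "3 * deg g2 \<le> real s * deg g2" using K(3) d by (intro mult_right_mono) auto
  then show g21: "deg g2 < deg g1" using K(4) d by linarith
  show th: "deg f3 \<ge> deg g1 - deg g2 + dd g1 g2" using dd_le[of g2 f3] K(7) by linarith
  show "deg g1 \<noteq> real i * deg g2"
  proof
    assume "deg g1 = real i * deg g2"
    then have "real (2 * i) * deg g2 = real s * deg g2" using K(4) by simp
    then have "2 * i = s" using d by (simp only: mult_cancel_right of_nat_eq_iff) auto
    then show False using K(2) by auto
  qed
  show "2 * deg g1 = 3 * deg g2 \<or> 2 * deg g1 \<ge> 5 * deg g2"
  proof (cases "s = 3")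
    case False
    then have "s \<ge> 5" using K(2,3) by (cases "s = 4") auto
    then have "5 * deg g2 \<le> real s * deg g2" using d by (intro mult_right_mono) auto
    then show ?thesis using K(4) by simp
  qed (use K in simp)
  have t1: "deg g1 + dd g2 f3 \<le> max (deg g2 + dd g1 f3) (deg f3 + dd g1 g2)"
    by (rule two_maxima[OF K(1)])
  have t2: "deg g2 + dd g1 f3 \<le> max (deg g1 + dd g2 f3) (deg f3 + dd g2 g1)"
    using two_maxima[of g2 g1 f3] gt_perm K(1) by blast
  have "deg f3 + dd g1 g2 < deg g1 + dd g2 f3" using K(5,7) d by linarith
  then show "dd g1 f3 = dd g2 f3 + deg g1 - deg g2"
    using t1 t2 by (simp add: dd_sym[of g2 g1])
qed

lemma deg_C_mult_eq: "deg (C c * f) = (if c = 0 then 0 else deg f)"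
  by simp

text \<open>In df1 \<and> df2 the coefficient a contributes f3 df3 \<and> dg2, b contributes dg1
  \<and> df3, and c contributes df3 \<and> dg2. The degrees of these forms decrease in this order
  and all exceed \<open>dd g1 g2\<close>, so \<open>dd f1 f2\<close> reveals the dominating
  coefficient. The degree of f1 can fall below deg g1 only if f3^2 has the degree of g1, and this
  forces s = 3.\<close>

lemma Kf_facts:
  assumes K: "Kcen g1 g2 f3" and F: "Kf g1 g2 f3 f1 f2 a b c"
  shows "gt f1 f2 f3" "dd f2 f3 = dd g2 f3" "dd f1 f3 = dd g1 f3" "deg f2 = deg g2"
    "a \<noteq> 0 \<Longrightarrow> 2 * deg f3 \<le> deg g1 \<and> 2 * deg g1 = 3 * deg g2 \<and> deg f3 < deg g2"
    "b \<noteq> 0 \<Longrightarrow> 2 * deg g1 = 3 * deg g2 \<and> deg f3 < deg g2"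
    "deg f1 = deg g1 \<or> a \<noteq> 0 \<and> 2 * deg f3 = deg g1 \<and> 2 * deg g1 = 3 * deg g2 \<and> deg f1 < deg g1
       \<and> deg f1 \<ge> 5 / 4 * deg g2 + dd g1 g2"
    "dd f1 f2 = (if a \<noteq> 0 then deg f3 + dd g2 f3 else if b \<noteq> 0 then dd g1 f3 else if c \<noteq> 0 then dd g2 f3 else dd g1 g2)"
    "deg f2 < deg f1" "deg f3 < deg f1"
proof -
  note k = Kcen_facts[OF K]
  note d = gt_degs[OF k(1)]
  from F obtain k1 k2 p e where P: "k1 \<noteq> 0" "k2 \<noteq> 0" "p \<in> alg1 g2" "deg p < deg g1"
     "f1 = C k1 * g1 + C a * f3 ^ 2 + C c * f3 + p" "f2 = C k2 * g2 + C b * f3 + C e"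
     "deg f1 \<le> deg g1" "deg f2 = deg g2" unfolding Kf_def by blast
  show "deg f2 = deg g2" by (rule P(8))
  have nz: "f3 \<noteq> 0" "g1 \<noteq> 0" "g2 \<noteq> 0" using d by auto
  obtain p' where p': "\<And>h. wedge p h = smul p' (wedge g2 h)" "p' = 0 \<or> deg p' + deg g2 = deg p"
    using alg1_degree[OF P(3) k(2)] by metis
  show a: "2 * deg f3 \<le> deg g1 \<and> 2 * deg g1 = 3 * deg g2 \<and> deg f3 < deg g2" if "a \<noteq> 0"
  proof -
    have "2 * deg f3 \<le> deg g1"
    proof (rule ccontr)
      assume n: "\<not> 2 * deg f3 \<le> deg g1"
      have "deg (C k1 * g1 + C c * f3 + p) \<le> deg g1"
        by (intro deg_add_leI) (use P k d in \<open>auto simp: deg_C_mult_eq\<close>)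
      moreover have "deg (C a * f3 ^ 2) = 2 * deg f3" using that by simp
      ultimately have "deg (C a * f3 ^ 2 + (C k1 * g1 + C c * f3 + p)) = 2 * deg f3"
        using n deg_add_eq by simp
      moreover have "C a * f3 ^ 2 + (C k1 * g1 + C c * f3 + p) = f1" by (simp add: P(5))
      ultimately show False using P(7) n by simp
    qed
    then show ?thesis using k by linarith
  qed
  show b: "2 * deg g1 = 3 * deg g2 \<and> deg f3 < deg g2" if "b \<noteq> 0"
  proof -
    have "\<not> deg f3 > deg g2"
    proof
      assume n: "deg f3 > deg g2"
      have "deg (C k2 * g2 + C e) \<le> deg g2" by (intro deg_add_leI) (use P d in auto)
      then have "deg (C b * f3 + (C k2 * g2 + C e)) = deg f3" using n that deg_add_eq by simp
      moreover have "C b * f3 + (C k2 * g2 + C e) = f2" by (simp add: P(6))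
      ultimately show False using P(8) n by simp
    qed
    then show ?thesis using k by linarith
  qed
  have w23: "wedge f2 f3 = smul (C k2) (wedge g2 f3)"
    by (simp add: P(6) wedge_add_left wedge_C_mult smul_simps)
  have w33: "wedge (f3 ^ 2) f3 = 0" by (rule wedge_power_self)
  have w13: "wedge f1 f3 = smul (C k1) (wedge g1 f3) + smul p' (wedge g2 f3)"
    by (simp add: P(5) wedge_add_left wedge_C_mult smul_simps p' w33)
  show d23: "dd f2 f3 = dd g2 f3"
    using fdeg_smul_dd[of "C k2" g2 f3] P(2) d(9) by (simp add: dd_def w23)
  have f13: "fdeg (smul (C k1) (wedge g1 f3)) = dd g1 f3" using fdeg_smul_dd[of "C k1" g1 f3] P(1) d(8) by simp
  have "fdeg (smul p' (wedge g2 f3)) < dd g1 f3"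
  proof (cases "p' = 0")
    case False
    then have "fdeg (smul p' (wedge g2 f3)) = deg p' + dd g2 f3" using d by (simp add: fdeg_smul_dd)
    then show ?thesis using False p'(2) P(4) k by linarith
  qed (use d in \<open>simp add: smul_simps\<close>)
  then have fw13: "fdeg (wedge f1 f3) = dd g1 f3" using f13 w13 fdeg_add_eq by simp
  then show d13: "dd f1 f3 = dd g1 f3" by (simp add: dd_def)
  define t where "t = C (2 * a) * f3 + C c"
  have w12: "wedge f1 g2 = smul (C k1) (wedge g1 g2) + smul t (wedge f3 g2)"
  proof -
    have "wedge (f3 ^ 2) g2 = smul (C 2 * f3) (wedge f3 g2)"
      using smul_simps(2)[of f3 f3] C_add[of 1 1]
      by (simp add: power2_eq_square wedge_mult_left ring_distribs)
    then show ?thesis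
      by (simp add: P(5) t_def wedge_add_left wedge_C_mult smul_simps p' C_mult mult.assoc mult.left_commute)
  qed
  have f12: "fdeg (smul (C k1) (wedge g1 g2)) = dd g1 g2" using fdeg_smul_dd[of "C k1" g1 g2] P(1) d(7) by simp
  have dt: "deg t = (if a \<noteq> 0 then deg f3 else 0)" "t = 0 \<longleftrightarrow> a = 0 \<and> c = 0"
  proof -
    show "deg t = (if a \<noteq> 0 then deg f3 else 0)" using d by (auto simp: t_def deg_add_eq)
    then show "t = 0 \<longleftrightarrow> a = 0 \<and> c = 0" using d by (cases "a = 0") (auto simp: t_def)
  qed
  have dd12: "dd f1 g2 = (if a \<noteq> 0 then deg f3 + dd g2 f3 else if c \<noteq> 0 then dd g2 f3 else dd g1 g2)"
  proof (cases "t = 0")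
    case True
    then show ?thesis using dt f12 w12 by (simp add: dd_def smul_simps)
  next
    case False
    then have "fdeg (smul t (wedge f3 g2)) = deg t + dd f3 g2" using d by (intro fdeg_smul_dd) auto
    moreover have "deg t + dd f3 g2 > dd g1 g2" using k(7) d deg_nonneg[of t] dd_sym[of f3 g2] by linarith
    ultimately have "dd f1 g2 = deg t + dd f3 g2" using fdeg_add_eq' f12 w12 by (simp add: dd_def)
    then show ?thesis using False dt dd_sym[of f3 g2] by auto
  qed
  have w12': "wedge f1 f2 = smul (C k2) (wedge f1 g2) + smul (C b) (wedge f1 f3)"
    by (simp add: P(6) wedge_add_right wedge_C_mult)
  have wf: "wedge f1 f3 \<noteq> 0" "wedge f1 g2 \<noteq> 0"
  proof -
    show "wedge f1 f3 \<noteq> 0" using fw13 d by auto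
    have "dd f1 g2 > 0" using dd12 d deg_nonneg[of f3] by (simp split: if_splits)
    then show "wedge f1 g2 \<noteq> 0" by (auto simp: dd_def)
  qed
  have e1: "fdeg (smul (C k2) (wedge f1 g2)) = dd f1 g2" using fdeg_smul_dd[of "C k2" f1 g2] P(2) wf by simp
  show "dd f1 f2 = (if a \<noteq> 0 then deg f3 + dd g2 f3 else if b \<noteq> 0 then dd g1 f3 else if c \<noteq> 0 then dd g2 f3 else dd g1 g2)"
  proof (cases "b = 0")
    case True
    then show ?thesis using e1 w12' dd12 by (simp add: dd_def smul_simps)
  next
    case False
    have e2: "fdeg (smul (C b) (wedge f1 f3)) = dd g1 f3"
      using fdeg_smul_dd[of "C b" f1 f3] False wf d13 by simp
    show ?thesis
    proof (cases "a = 0")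
      case True
      have "dd f1 g2 < dd g1 f3" using dd12 True k d by (auto split: if_splits)
      then show ?thesis using True False e1 e2 w12' fdeg_add_eq' by (simp add: dd_def)
    next
      case a0: False
      have "dd f1 g2 > dd g1 f3" using dd12 a0 k d by auto
      then show ?thesis using a0 e1 e2 w12' fdeg_add_eq dd12 by (simp add: dd_def)
    qed
  qed
  show f1: "deg f1 = deg g1 \<or> a \<noteq> 0 \<and> 2 * deg f3 = deg g1 \<and> 2 * deg g1 = 3 * deg g2 \<and> deg f1 < deg g1
       \<and> deg f1 \<ge> 5 / 4 * deg g2 + dd g1 g2"
  proof (cases "a \<noteq> 0 \<and> 2 * deg f3 = deg g1")
    case True
    have "deg f3 + dd g2 f3 \<le> deg f1 + deg g2" using dd12 dd_le[of f1 g2] True by simp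
    \<comment> \<open>With u = deg g2 one has deg f3 = 3/4 u and \<open>dd g2 f3\<close> at least
      3/2 u + \<open>dd g1 g2\<close>; the constant is 3/4 + 3/2 - 1.\<close>
    then have "deg f1 \<ge> 5 / 4 * deg g2 + dd g1 g2" using True a k by (simp add: field_simps)
    then show ?thesis using True a P(7) by auto
  next
    case False
    have "deg (C a * f3 ^ 2) < deg g1" using False a d by (cases "a = 0") auto
    moreover have "deg (C c * f3) < deg g1" using k d by (simp add: deg_C_mult_eq)
    ultimately have "deg (C a * f3 ^ 2 + C c * f3 + p) < deg g1" using P(4) by (intro deg_add_less)
    then have "deg (C k1 * g1 + (C a * f3 ^ 2 + C c * f3 + p)) = deg g1" using P(1) deg_add_eq by simp
    then show ?thesis by (simp add: P(5) add.assoc)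
  qed
  show "deg f2 < deg f1" using f1 P(8) k d by (auto simp: field_simps)
  show "deg f3 < deg f1" using f1 k d by (auto simp: field_simps)
  have "gt g2 f3 f1"
  proof (rule gt_nb)
    show "gt g2 f3 g1" using k(1) gt_perm by blast
    have "f1 = C k1 * g1 + (C a * f3 ^ 2 + C c * f3 + p)" by (simp add: P(5))
    moreover have "C a * f3 ^ 2 + C c * f3 + p \<in> alg g2 f3"
      using alg1_alg(1)[OF P(3), of f3] by (intro alg_add alg_mult alg_power) auto
    ultimately show "nb g2 f3 g1 f1" using nbI P(1) by simp
  qed
  then have "gt f1 f3 g2" using gt_perm by blast
  moreover have "nb f1 f3 g2 f2"
  proof -
    have "f2 = C k2 * g2 + (C b * f3 + C e)" by (simp add: P(6))
    moreover have "C b * f3 + C e \<in> alg f1 f3" by (intro alg_add alg_mult) auto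
    ultimately show ?thesis using nbI P(2) by simp
  qed
  ultimately have "gt f1 f3 f2" by (rule gt_nb)
  then show "gt f1 f2 f3" using gt_perm by blast
qed

lemma A_gt: "A M \<Longrightarrow> M = {#f, g, h#} \<Longrightarrow> gt f g h"
proof (induction M arbitrary: f g h rule: A.induct)
  case (base f' g' h')
  then show ?case using gt_mset by metis
next
  case (elem f' g' h'' h')
  have "gt f' g' h''" using elem.IH by blast
  then have "gt f' g' h'" using elem.hyps nb_sym gt_nb by blast
  then show ?case using gt_mset elem.prems by metis
next
  case (K1 g1 g2 f3 f1 f2 a b c g3)
  then show ?case using Kf_facts(1) gt_mset by metis
next
  case (K4 g1 g2 f3 f1 f2 a b c g3 g1')
  then show ?case using Kf_facts(1) gt_mset by metis
qed


section \<open>Transformations around a centre that do not raise degrees\<close>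

lemma Kf_alg: assumes "Kf g1 g2 f3 f1 f2 a b c" shows "alg f2 f3 = alg g2 f3"
proof -
  from assms obtain k2 e where f2: "k2 \<noteq> 0" "f2 = C k2 * g2 + (C b * f3 + C e)"
    unfolding Kf_def by (auto simp: add.assoc)
  have "C b * f3 + C e \<in> alg1 f3" by (intro alg1_add alg1_mult) auto
  then show ?thesis using alg_eq1(2)[OF f2(1)] f2(2) by (simp add: alg_sym[of f3 g2])
qed

lemma real_mult_ge: "n \<le> m \<Longrightarrow> 0 \<le> x \<Longrightarrow> real n * x \<le> real m * x"
  by (intro mult_right_mono) auto

text \<open>Since deg f3 exceeds deg g1 - deg g2, which is at least deg g1 / 3, the monomials of
  degree at most deg g1 are powers of g2, f3 and f3^2. Cancellation would need a relation of degree
  below deg g2 + deg f3. Both multiplicities in it are at least 2, so its degree is at least twice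
  each of the two degrees, a contradiction.\<close>

lemma noninc_slot1:
  assumes K: "Kcen g1 g2 f3" and q: "q \<in> alg g2 f3" "deg q \<le> deg g1"
  obtains a c p where "p \<in> alg1 g2" "deg p < deg g1" "q = C a * f3 ^ 2 + C c * f3 + p"
proof -
  note k = Kcen_facts[OF K]
  note d = gt_degs[OF k(1)]
  have k9: "3 * deg g2 \<le> 2 * deg g1" using k(2,9) by auto
  define R where "R = {C a * f3 ^ 2 + C c * f3 + p | a c p. p \<in> alg1 g2 \<and> deg p < deg g1}"
  have RI: "p \<in> alg1 g2 \<Longrightarrow> deg p < deg g1 \<Longrightarrow> C a * f3 ^ 2 + C c * f3 + p \<in> R" for a c p
    unfolding R_def by blast
  have "q \<in> R"
  proof (cases "nonc g2 f3 q")
    case True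
    then show ?thesis
    proof (rule nonc_monomials)
      fix m assume m: "wt g2 f3 m \<le> deg q"
      obtain i j where ij: "m = (i, j)" by (cases m)
      have w: "real i * deg g2 + real j * deg f3 \<le> deg g1" using m q ij by (simp add: wt_def)
      show "g2 ^ fst m * f3 ^ snd m \<in> R"
      proof (cases "j = 0")
        case True
        have "real i * deg g2 < deg g1" using w True k(11)[of i] by simp
        then show ?thesis using RI[of "g2 ^ i" 0 0] True ij by (simp add: alg1_power)
      next
        case False
        have i0: "i = 0"
        proof (rule ccontr)
          assume "i \<noteq> 0"
          then have "deg g2 \<le> real i * deg g2" using real_mult_ge[of 1 i "deg g2"] by simp
          moreover have "deg f3 \<le> real j * deg f3" using False real_mult_ge[of 1 j "deg f3"] by simp
          ultimately show False using w k by linarith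
        qed
        have "\<not> j \<ge> 3"
        proof
          assume "j \<ge> 3"
          then have "3 * deg f3 \<le> real j * deg f3" using real_mult_ge[of 3 j "deg f3"] by simp
          moreover have "real j * deg f3 \<le> deg g1" using w i0 by simp
          ultimately show False using k(6,4) k9 by linarith
        qed
        then consider "j = 1" | "j = 2" using False by linarith
        then show ?thesis
          by cases (use RI[of 0 0 1] RI[of 0 1 0] i0 ij d in auto)
      qed
    next
      fix c x assume "x \<in> R"
      then obtain a b p where x: "x = C a * f3 ^ 2 + C b * f3 + p" "p \<in> alg1 g2" "deg p < deg g1" unfolding R_def by blast
      have "C c * x = C (c * a) * f3 ^ 2 + C (c * b) * f3 + C c * p" by (simp add: x(1) C_mult distrib_left mult.assoc)
      moreover have "deg (C c * p) < deg g1" using deg_C_mult_le[of c p] x by linarith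
      ultimately show "C c * x \<in> R" using RI[of "C c * p"] x by (simp add: alg1_mult)
    next
      show "0 \<in> R" using RI[of 0 0 0] d by simp
    next
      fix x y assume "x \<in> R" "y \<in> R"
      then obtain a b p a' b' p' where x: "x = C a * f3 ^ 2 + C b * f3 + p" "p \<in> alg1 g2" "deg p < deg g1"
        "y = C a' * f3 ^ 2 + C b' * f3 + p'" "p' \<in> alg1 g2" "deg p' < deg g1" unfolding R_def by blast
      have "x + y = C (a + a') * f3 ^ 2 + C (b + b') * f3 + (p + p')" by (simp add: x(1,4) C_add distrib_right)
      then show "x + y \<in> R" using RI[of "p + p'" "a + a'" "b + b'"] alg1_add[OF x(2,5)] deg_add_less[OF x(3,6)] by simp
    qed
  next
    case False
    obtain p r where P: "p \<ge> 1" "r \<ge> 1" "coprime p r" "real p * deg g2 = real r * deg f3"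
      "real p * deg g2 \<le> deg q + deg g2 + deg f3 - dd g2 f3"
      by (rule cancel_bound[OF d(9) k(2) k(12) q(1) False])
    have up: "real p * deg g2 < deg g2 + deg f3" using P(5) q k by linarith
    have "r \<noteq> 1" using P(4) k(10)[of p] by auto
    then have r2: "2 * deg f3 \<le> real r * deg f3" using P(2) real_mult_ge[of 2 r "deg f3"] by simp
    have "p \<noteq> 1"
    proof
      assume "p = 1"
      then have "real r * deg f3 = deg g2" using P(4) by simp
      then show False using r2 k(4,6) k9 by linarith
    qed
    then have "2 * deg g2 \<le> real p * deg g2" using P(1) real_mult_ge[of 2 p "deg g2"] by simp
    then have False using up r2 P(4) by linarith
    then show ?thesis ..
  qed
  then show thesis using that unfolding R_def by blast
qed

text \<open>The only monomials in f1 and f3 of degree at most deg g2 are 1 and f3, and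
  \<open>dd f1 f3\<close> is too large for a cancellation.\<close>

lemma noninc_slot2:
  assumes K: "Kcen g1 g2 f3" and F: "Kf g1 g2 f3 f1 f2 a b c" and q: "q \<in> alg f1 f3" "deg q \<le> deg g2"
  obtains b' e where "q = C b' * f3 + C e"
proof -
  note k = Kcen_facts[OF K] and fc = Kf_facts[OF K F]
  note d = gt_degs[OF fc(1)] and d' = gt_degs[OF k(1)]
  have k9: "3 * deg g2 \<le> 2 * deg g1" using k(2,9) by auto
  define R where "R = {C b * f3 + C e | b e. True}"
  have "q \<in> R"
  proof (cases "nonc f1 f3 q")
    case True
    then show ?thesis
    proof (rule nonc_monomials)
      fix m assume m: "wt f1 f3 m \<le> deg q"
      obtain i j where ij: "m = (i, j)" by (cases m)
      have w: "real i * deg f1 + real j * deg f3 \<le> deg g2" using m q ij by (simp add: wt_def)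
      have nn: "real i * deg f1 \<ge> 0" "real j * deg f3 \<ge> 0" by simp_all
      have i0: "i = 0"
      proof (rule ccontr)
        assume "i \<noteq> 0"
        then have "deg f1 \<le> real i * deg f1" using real_mult_ge[of 1 i "deg f1"] by simp
        then show False using w nn fc(4,9) by linarith
      qed
      have "\<not> j \<ge> 2"
      proof
        assume "j \<ge> 2"
        then have "2 * deg f3 \<le> real j * deg f3" using real_mult_ge[of 2 j "deg f3"] by simp
        then show False using w nn k by linarith
      qed
      then consider "j = 0" | "j = 1" by linarith
      then show "f1 ^ fst m * f3 ^ snd m \<in> R" unfolding R_def
      proof cases
        case 1
        have "f1 ^ fst m * f3 ^ snd m = C 0 * f3 + C 1" using i0 ij 1 by simp
        then show "f1 ^ fst m * f3 ^ snd m \<in> {C b * f3 + C e | b e. True}" by blast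
      next
        case 2
        have "f1 ^ fst m * f3 ^ snd m = C 1 * f3 + C 0" using i0 ij 2 by simp
        then show "f1 ^ fst m * f3 ^ snd m \<in> {C b * f3 + C e | b e. True}" by blast
      qed
    next
      fix c x assume "x \<in> R"
      then obtain b e where "x = C b * f3 + C e" unfolding R_def by blast
      then have "C c * x = C (c * b) * f3 + C (c * e)" by (simp add: C_mult distrib_left mult.assoc)
      then show "C c * x \<in> R" unfolding R_def by blast
    next
      have "0 = C 0 * f3 + C 0" by simp
      then show "0 \<in> R" unfolding R_def by blast
    next
      fix x y assume "x \<in> R" "y \<in> R"
      then obtain b e b' e' where "x = C b * f3 + C e" "y = C b' * f3 + C e'" unfolding R_def by blast
      then have "x + y = C (b + b') * f3 + C (e + e')" by (simp add: C_add distrib_right)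
      then show "x + y \<in> R" unfolding R_def by blast
    qed
  next
    case False
    obtain p r where P: "p \<ge> 1" "r \<ge> 1" "coprime p r" "real p * deg f1 = real r * deg f3"
      "real p * deg f1 \<le> deg q + deg f1 + deg f3 - dd f1 f3"
      by (rule cancel_bound[OF d(8) d(1) d(3) q(1) False])
    have f1: "deg f1 \<le> deg g1" using fc(7) by auto
    have L: "real p * deg f1 \<le> 2 * deg g2 + deg f1 + deg f3 - 2 * deg g1 - dd g1 g2"
      using P(5) q(2) fc(3) k(7,8) by linarith
    have False
    proof (cases "p = 1")
      case True
      have e: "deg f1 = real r * deg f3" using P(4) True by simp
      have "r \<noteq> 1" using e fc(10) by auto
      then have "r \<ge> 2" using P(2) by simp
      then have "2 * deg f3 \<le> deg f1" unfolding e using real_mult_ge[of 2 r "deg f3"] by simp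
      moreover have "deg f1 \<le> 2 * deg g2 + deg f1 + deg f3 - 2 * deg g1 - dd g1 g2" using L True by simp
      ultimately show False using f1 k9 k(2,4) by linarith
    next
      case False
      then have "2 * deg f1 \<le> real p * deg f1" using P(1) real_mult_ge[of 2 p "deg f1"] by simp
      then show False using L fc(10) k by linarith
    qed
    then show ?thesis ..
  qed
  then show thesis using that unfolding R_def by blast
qed

text \<open>A nonzero a, b or c lifts \<open>dd f1 f2\<close> to at least deg g1 +
  \<open>dd g1 g2\<close>, which leaves no room for cancellation. For a = b = c = 0 cancellation can
  occur; \<open>K_closed3_new\<close> deals with it.\<close>

lemma noninc_slot3:
  assumes K: "Kcen g1 g2 f3" and F: "Kf g1 g2 f3 f1 f2 a b c" and nz: "a \<noteq> 0 \<or> b \<noteq> 0 \<or> c \<noteq> 0"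
    and q: "q \<in> alg f1 f2" "deg q \<le> deg f3"
  shows "q \<in> alg1 f2"
proof (cases "nonc f1 f2 q")
  case True
  then show ?thesis using nonc_alg1_snd q Kf_facts(10)[OF K F] by force
next
  case False
  note k = Kcen_facts[OF K] and fc = Kf_facts[OF K F]
  note d = gt_degs[OF fc(1)]
  have E: "dd f1 f2 \<ge> deg g1 + dd g1 g2" using fc(8) nz k by auto
  obtain p r where P: "p \<ge> 1" "r \<ge> 1" "coprime p r" "real p * deg f1 = real r * deg f2"
      "real p * deg f1 \<le> deg q + deg f1 + deg f2 - dd f1 f2"
    by (rule cancel_bound[OF d(7) d(1) d(2) q(1) False])
  show ?thesis
  proof (cases "p = 1")
    case True
    then have e: "deg f1 = real r * deg g2" using P(4) fc(4) by simp
    then have "deg f1 \<noteq> deg g1" using k(11)[of r] by auto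
    then have f1: "deg f1 < 3 / 2 * deg g2" "deg f1 > deg g2" using fc(7) k by auto
    then have "r \<noteq> 1" using e by auto
    then have "2 * deg g2 \<le> deg f1" using P(2) real_mult_ge[of 2 r "deg g2"] e by simp
    then show ?thesis using f1 k by linarith
  next
    case False
    then have "2 * deg f1 \<le> real p * deg f1" using P(1) real_mult_ge[of 2 p "deg f1"] by simp
    then show ?thesis using P(5) q E fc(4,10) k by linarith
  qed
qed

lemma nb_noninc:
  assumes "nb f g h h'" "deg h' \<le> B" "deg h \<le> B"
  obtains k q where "k \<noteq> 0" "q \<in> alg f g" "h' = C k * h + q" "deg q \<le> B"
proof -
  from assms(1) obtain k q where h: "k \<noteq> 0" "q \<in> alg f g" "h' = C k * h + q" unfolding nb_def by blast
  have "q = h' - C k * h" by (simp add: h)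
  then have "deg q \<le> B" using deg_diff_le[of h' "C k * h"] assms(2,3) h(1) by simp
  then show thesis using that h by blast
qed

lemma nb_dec:
  assumes "nb f g h h'" "deg h' < deg h"
  obtains k q where "k \<noteq> 0" "q \<in> alg f g" "h' = C k * h + q" "deg q = deg h"
proof -
  from assms(1) obtain k q where h: "k \<noteq> 0" "q \<in> alg f g" "h' = C k * h + q" unfolding nb_def by blast
  have "deg q = deg (C k * h)" by (rule deg_add_lt_imp_eq) (use h assms in simp)
  then show thesis using that h by simp
qed

lemma Kstep1:
  assumes K: "Kcen g1 g2 f3" and F: "Kf g1 g2 f3 f1 f2 a b c" and n: "nb f2 f3 f1 f1'" "deg f1' \<le> deg g1"
  obtains a' c' where "Kf g1 g2 f3 f1' f2 a' b c'"
proof -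
  have f1: "deg f1 \<le> deg g1" using Kf_facts(7)[OF K F] by auto
  obtain k q where h: "k \<noteq> 0" "q \<in> alg f2 f3" "f1' = C k * f1 + q" "deg q \<le> deg g1"
    by (rule nb_noninc[OF n f1])
  have "q \<in> alg g2 f3" using h Kf_alg[OF F] by simp
  then obtain a2 c2 p2 where q: "p2 \<in> alg1 g2" "deg p2 < deg g1" "q = C a2 * f3 ^ 2 + C c2 * f3 + p2"
    using noninc_slot1[OF K _ h(4)] by blast
  from F obtain k1 k2 p e where P: "k1 \<noteq> 0" "k2 \<noteq> 0" "p \<in> alg1 g2" "deg p < deg g1"
     "f1 = C k1 * g1 + C a * f3 ^ 2 + C c * f3 + p" "f2 = C k2 * g2 + C b * f3 + C e" "deg f2 = deg g2" unfolding Kf_def by blast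
  have eq: "f1' = C (k * k1) * g1 + C (k * a + a2) * f3 ^ 2 + C (k * c + c2) * f3 + (C k * p + p2)"
    by (simp add: h(3) P(5) q(3) C_add C_mult algebra_simps)
  have "Kf g1 g2 f3 f1' f2 (k * a + a2) b (k * c + c2)"
    unfolding Kf_def
    by (rule exI[of _ "k * k1"], rule exI[of _ k2], rule exI[of _ "C k * p + p2"], rule exI[of _ e])
       (use h(1) P q n(2) eq in \<open>auto intro!: alg1_add alg1_mult deg_add_less\<close>)
  then show thesis by (rule that)
qed

lemma Kstep2:
  assumes K: "Kcen g1 g2 f3" and F: "Kf g1 g2 f3 f1 f2 a b c" and n: "nb f1 f3 f2 f2'" "deg f2' \<le> deg f2"
  obtains b' where "Kf g1 g2 f3 f1 f2' a b' c" "deg f2' = deg f2"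
proof -
  note k = Kcen_facts[OF K] and fc = Kf_facts[OF K F]
  obtain k q where h: "k \<noteq> 0" "q \<in> alg f1 f3" "f2' = C k * f2 + q" "deg q \<le> deg f2"
    by (rule nb_noninc[OF n order.refl])
  obtain b2 e2 where q: "q = C b2 * f3 + C e2" by (rule noninc_slot2[OF K F h(2)]) (use h fc in auto)
  from F obtain k1 k2 p e where P: "k1 \<noteq> 0" "k2 \<noteq> 0" "p \<in> alg1 g2" "deg p < deg g1"
     "f1 = C k1 * g1 + C a * f3 ^ 2 + C c * f3 + p" "f2 = C k2 * g2 + C b * f3 + C e" "deg f1 \<le> deg g1" unfolding Kf_def by blast
  have "deg q < deg f2"
  proof (cases "b2 = 0")
    case True
    then show ?thesis using q k fc(4) by simp
  next
    case False
    then have "deg q = deg f3" using q k by (simp add: deg_add_eq)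
    then show ?thesis using h(4) fc(4) k(13) by linarith
  qed
  then have d2: "deg f2' = deg f2" using h(1,3) deg_add_eq by simp
  have eq: "f2' = C (k * k2) * g2 + C (k * b + b2) * f3 + C (k * e + e2)"
    by (simp add: h(3) P(6) q C_add C_mult algebra_simps)
  have "Kf g1 g2 f3 f1 f2' a (k * b + b2) c"
    unfolding Kf_def
    by (rule exI[of _ k1], rule exI[of _ "k * k2"], rule exI[of _ p], rule exI[of _ "k * e + e2"])
       (use h(1) P d2 fc(4) eq in auto)
  then show thesis using that d2 by blast
qed

lemma wedge_alg1_self: "q \<in> alg1 g \<Longrightarrow> deg g > 0 \<Longrightarrow> wedge g q = 0"
  using alg1_degree[of q g] wedge_self[of g] wedge_swap[of q g] by (metis neg_0_equal_iff_equal smul_simps(6))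

lemma alg1_affine: "k \<noteq> 0 \<Longrightarrow> alg1 (C k * g + C e) = alg1 g"
proof
  assume k: "k \<noteq> 0"
  have "C k * g + C e \<in> alg1 g" by (intro alg1_add alg1_mult) auto
  then show "alg1 (C k * g + C e) \<subseteq> alg1 g" using alg1_subst by blast
  have "g = C (1 / k) * ((C k * g + C e) - C e)" using k by (simp add: C_inverse_cancel)
  then have "g \<in> alg1 (C k * g + C e)" by (metis alg1_C alg1_gen alg1_diff alg1_mult)
  then show "alg1 g \<subseteq> alg1 (C k * g + C e)" using alg1_subst by blast
qed

lemma alg1_deg_lt_const:
  assumes "q \<in> alg1 f" "deg q < deg f" shows "q = C (lookup q 0)"
proof (rule deg_eq_0_imp_C)
  obtain i where i: "deg q = real i * deg f" using alg1_degree[OF assms(1)] assms(2) deg_nonneg[of q] by (metis le_less_trans)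
  then have "i = 0" using assms(2) real_mult_ge[of 1 i "deg f"] by (cases "i = 0") auto
  then show "deg q = 0" using i by simp
qed

lemma alg1_deg_mult: "q \<in> alg1 f \<Longrightarrow> deg f > 0 \<Longrightarrow> \<exists>i. deg q = real i * deg f"
  using alg1_degree by metis

text \<open>The degree of q is a multiple of deg g2 while deg f3 is not, so q does not touch the
  leading term of f3. As dg2 \<and> dq = 0, the threshold is preserved.\<close>

lemma Kcen_shift:
  assumes K: "Kcen g1 g2 f3" and q: "k \<noteq> 0" "q \<in> alg1 g2" "deg q \<le> deg f3"
  shows "Kcen g1 g2 (C k * f3 + q)" "deg (C k * f3 + q) = deg f3" "deg q < deg f3"
proof -
  note k = Kcen_facts[OF K]
  obtain i where "deg q = real i * deg g2" using alg1_deg_mult[OF q(2) k(2)] by blast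
  then show dq: "deg q < deg f3" using q(3) k(10)[of i] by linarith
  then show d: "deg (C k * f3 + q) = deg f3" using q(1) deg_add_eq by simp
  have "gt g1 g2 (C k * f3 + q)" using gt_nb[OF k(1) nbI] q alg1_alg(2) by blast
  moreover have "wedge g2 (C k * f3 + q) = smul (C k) (wedge g2 f3)"
    using wedge_alg1_self[OF q(2) k(2)] by (simp add: wedge_add_right wedge_C_mult)
  then have "dd g2 (C k * f3 + q) = dd g2 f3"
    using fdeg_smul_dd[of "C k" g2 f3] q(1) gt_degs[OF k(1)] by (simp add: dd_def)
  ultimately show "Kcen g1 g2 (C k * f3 + q)" using K d unfolding Kcen_def by simp
qed

text \<open>If a or b is nonzero, then deg f3 < deg g2, so f3 changes only by a scalar and a
  constant, and f3^2 can be rewritten in f3'. If only c is nonzero, the change is a polynomial in g2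
  and goes into the summand p of \<open>Kf\<close>.\<close>

lemma Kstep3:
  assumes K: "Kcen g1 g2 f3" and F: "Kf g1 g2 f3 f1 f2 a b c" and nz: "a \<noteq> 0 \<or> b \<noteq> 0 \<or> c \<noteq> 0"
    and n: "nb f1 f2 f3 f3'" "deg f3' \<le> deg f3"
  obtains a' b' c' where "Kcen g1 g2 f3'" "Kf g1 g2 f3' f1 f2 a' b' c'" "nb g1 g2 f3 f3'" "deg f3' = deg f3"
proof -
  note k = Kcen_facts[OF K] and fc = Kf_facts[OF K F]
  obtain l q where h: "l \<noteq> 0" "q \<in> alg f1 f2" "f3' = C l * f3 + q" "deg q \<le> deg f3"
    by (rule nb_noninc[OF n order.refl])
  have q1: "q \<in> alg1 f2" by (rule noninc_slot3[OF K F nz h(2,4)])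
  from F obtain k1 k2 p e where P: "k1 \<noteq> 0" "k2 \<noteq> 0" "p \<in> alg1 g2" "deg p < deg g1"
     "f1 = C k1 * g1 + C a * f3 ^ 2 + C c * f3 + p" "f2 = C k2 * g2 + C b * f3 + C e"
     "deg f1 \<le> deg g1" "deg f2 = deg g2" unfolding Kf_def by blast
  have qc: "\<exists>e0. q = C e0" if "a \<noteq> 0 \<or> b \<noteq> 0"
  proof -
    have "deg q < deg f2" using that fc(4,5,6) h(4) by auto
    then show ?thesis using alg1_deg_lt_const[OF q1] by blast
  qed
  have qg: "q \<in> alg1 g2"
  proof (cases "b = 0")
    case True
    then show ?thesis using q1 P(2,6) alg1_affine by simp
  qed (use qc in auto)
  note s = Kcen_shift[OF K h(1) qg h(4)]
  have Kc: "Kcen g1 g2 f3'" "deg f3' = deg f3" using s h(3) by simp_all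
  have nb': "nb g1 g2 f3 f3'" using h qg alg1_alg(2) by (auto intro: nbI)
  define m where "m = 1 / l"
  have f3: "f3 = C m * f3' - C m * q" using h(1) by (simp add: m_def h(3) distrib_left C_inverse_cancel)
  have f2': "\<exists>b' e'. f2 = C k2 * g2 + C b' * f3' + C e'"
  proof (cases "b = 0")
    case True
    then show ?thesis using P(6) by (intro exI[of _ 0] exI[of _ e]) simp
  next
    case False
    then obtain e0 where "q = C e0" using qc by blast
    then have "f2 = C k2 * g2 + C (b * m) * f3' + C (e - b * m * e0)"
      using P(6) f3 by (simp add: C_mult C_diff algebra_simps)
    then show ?thesis by blast
  qed
  have f1': "\<exists>a' c' p'. p' \<in> alg1 g2 \<and> deg p' < deg g1 \<and> f1 = C k1 * g1 + C a' * f3' ^ 2 + C c' * f3' + p'"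
  proof (cases "a = 0")
    case True
    have "f1 = C k1 * g1 + C 0 * f3' ^ 2 + C (c * m) * f3' + (p - C (c * m) * q)"
      using P(5) f3 True by (simp add: C_mult algebra_simps)
    moreover have "p - C (c * m) * q \<in> alg1 g2" using P(3) qg by (intro alg1_diff alg1_mult) auto
    moreover have "deg (p - C (c * m) * q) < deg g1"
      using deg_diff_le[of p "C (c * m) * q"] deg_C_mult_le[of "c * m" q] P(4) s(3) k(5) by linarith
    ultimately show ?thesis by blast
  next
    case False
    then obtain e0 where q0: "q = C e0" using qc by blast
    have f3': "f3 = C m * f3' - C (m * e0)" using f3 by (simp add: q0 C_mult)
    have "f3 ^ 2 = C (m * m) * f3' ^ 2 + C (- 2 * m * m * e0) * f3' + C (m * m * e0 * e0)"
      unfolding f3' using C_add[of 1 1] by (simp add: power2_eq_square C_mult C_uminus algebra_simps)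
    then have "f1 = C k1 * g1 + C (a * (m * m)) * f3' ^ 2 + C (a * (- 2 * m * m * e0) + c * m) * f3'
        + (p + C (a * (m * m * e0 * e0) - c * m * e0))"
      using P(5) f3' by (simp only: C_mult C_add C_diff C_uminus) (simp add: algebra_simps)
    moreover have "p + C (a * (m * m * e0 * e0) - c * m * e0) \<in> alg1 g2" using P(3) by (intro alg1_add) auto
    moreover have "deg (p + C (a * (m * m * e0 * e0) - c * m * e0)) < deg g1"
      using P(4) k by (intro deg_add_less) auto
    ultimately show ?thesis by blast
  qed
  from f1' f2' obtain a' b' c' p' e' where *: "p' \<in> alg1 g2" "deg p' < deg g1"
    "f1 = C k1 * g1 + C a' * f3' ^ 2 + C c' * f3' + p'" "f2 = C k2 * g2 + C b' * f3' + C e'" by blast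
  have "Kf g1 g2 f3' f1 f2 a' b' c'"
    unfolding Kf_def
    by (rule exI[of _ k1], rule exI[of _ k2], rule exI[of _ p'], rule exI[of _ e']) (intro conjI P(1,2,7,8) *)
  then show thesis using that Kc nb' by blast
qed

section \<open>How a member of the class can have arisen\<close>

definition red :: "poly3 \<Rightarrow> poly3 \<Rightarrow> poly3 \<Rightarrow> bool" where
  "red f g h \<longleftrightarrow> (\<exists>h'. nb f g h h' \<and> deg h' < deg h \<and> A {#f, g, h'#})"

lemma red_swap: "red f g h \<longleftrightarrow> red g f h"
  by (simp add: red_def nb_swap add_mset_commute)

text \<open>What rules \<open>K1\<close> and \<open>K4\<close> require beyond the centre and the
  shape \<open>Kf\<close>. It depends on f3 only through its class under \<open>nb g1 g2\<close> and
  its degree.\<close>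

definition KD :: "poly3 \<Rightarrow> poly3 \<Rightarrow> poly3 \<Rightarrow> bool" where
  "KD g1 g2 f3 \<longleftrightarrow> (\<exists>g3. nb g1 g2 f3 g3 \<and> deg g3 < deg f3 \<and> A {#g1, g2, g3#}) \<or>
     (\<exists>g3 g1'. nb g1 g2 f3 g3 \<and> dd g2 g3 < deg g1 + dd g1 g2 \<and> 2 * deg g3 = deg g1 \<and> deg f3 \<le> deg g3
       \<and> nb g2 g3 g1 g1' \<and> deg g1' < deg g1 \<and> A {#g1', g2, g3#})"

lemma A_K: "Kcen g1 g2 f3 \<Longrightarrow> Kf g1 g2 f3 f1 f2 a b c \<Longrightarrow> KD g1 g2 f3 \<Longrightarrow> A {#f1, f2, f3#}"
  unfolding KD_def using K1 K4 by blast

lemma A_cases3: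
  assumes "A {#x, y, z#}"
  obtains (base) "{#deg x, deg y, deg z#} = {#w1, w2, w3#}"
  | (e1) "red y z x" | (e2) "red x z y" | (e3) "red x y z"
  | (K) g1 g2 f1 f2 f3 a b c where "{#x, y, z#} = {#f1, f2, f3#}" "Kcen g1 g2 f3" "Kf g1 g2 f3 f1 f2 a b c" "KD g1 g2 f3"
  using assms
proof (cases rule: A.cases)
  case (base f g h)
  then have "{#deg x, deg y, deg z#} = {#w1, w2, w3#}" unfolding mset3_eq by auto
  then show thesis by (rule that(1))
next
  case (elem f g h' h)
  then have r: "red f g h" unfolding red_def by blast
  from elem(1) consider "h = x \<and> (f = y \<and> g = z \<or> f = z \<and> g = y)"
    | "h = y \<and> (f = x \<and> g = z \<or> f = z \<and> g = x)" | "h = z \<and> (f = x \<and> g = y \<or> f = y \<and> g = x)"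
    unfolding mset3_eq by blast
  then show thesis
    by cases (use r red_swap that(2-4) in blast)+
next
  case (K1 g1 g2 f3 f1 f2 a b c g3)
  then have "KD g1 g2 f3" unfolding KD_def by blast
  then show thesis using that(5) K1 by blast
next
  case (K4 g1 g2 f3 f1 f2 a b c g3 g1')
  then have "KD g1 g2 f3" unfolding KD_def by blast
  then show thesis using that(5) K4 by blast
qed

lemma weights_commensurable_imp_eq:
  assumes "x \<in> {w1, w2, w3}" "y \<in> {w1, w2, w3}" "real m * x = real n * y" "m > 0"
  shows "x = y"
proof (rule ccontr)
  assume "x \<noteq> y"
  have i: "a = 0 \<and> b = 0 \<and> c = 0" if "of_int a * w1 + of_int b * w2 + of_int c * w3 = 0" for a b c
    using w_indep[OF that] .
  show False
    using assms \<open>x \<noteq> y\<close> i[of "int m" "- int n" 0] i[of "- int n" "int m" 0] i[of "int m" 0 "- int n"]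
      i[of "- int n" 0 "int m"] i[of 0 "int m" "- int n"] i[of 0 "- int n" "int m"] by auto
qed

text \<open>After removal of the f3-terms of the second description, its centre has the shape
  \<open>Kf\<close> over the first one, with coefficients a - a', b - b', c - c'. Its differential
  degree is below deg g1, whereas by \<open>Kf_facts\<close> a nonzero coefficient would lift it
  above that value.\<close>

lemma Kf_same_roles:
  assumes K: "Kcen g1 g2 f3" and F: "Kf g1 g2 f3 f1 f2 a b c"
    and K': "Kcen g1' g2' f3" and F': "Kf g1' g2' f3 f1 f2 a' b' c'"
  obtains k1 k2 p e where "k1 \<noteq> 0" "k2 \<noteq> 0" "p \<in> alg1 g2" "deg p < deg g1" "g1' = C k1 * g1 + p" "g2' = C k2 * g2 + C e"
proof -
  note k = Kcen_facts[OF K] and fc = Kf_facts[OF K F]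
  note k' = Kcen_facts[OF K'] and fc' = Kf_facts[OF K' F']
  note d' = gt_degs[OF k'(1)]
  from F obtain l1 l2 p e where P: "l1 \<noteq> 0" "l2 \<noteq> 0" "p \<in> alg1 g2" "deg p < deg g1"
     "f1 = C l1 * g1 + C a * f3 ^ 2 + C c * f3 + p" "f2 = C l2 * g2 + C b * f3 + C e"
     unfolding Kf_def by blast
  from F' obtain l1' l2' p' e' where P': "l1' \<noteq> 0" "l2' \<noteq> 0" "p' \<in> alg1 g2'" "deg p' < deg g1'"
     "f1 = C l1' * g1' + C a' * f3 ^ 2 + C c' * f3 + p'" "f2 = C l2' * g2' + C b' * f3 + C e'"
     unfolding Kf_def by blast
  have G2: "deg g2' = deg g2" using fc(4) fc'(4) by simp
  have G1: "deg g1' = deg g1" using fc(7) fc'(7) k(9) k'(9) G2 k(2,4) k'(4) by (auto simp: field_simps)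
  define h1 where "h1 = C l1' * g1' + p'"
  define h2 where "h2 = C l2' * g2' + C e'"
  have h1: "h1 = C l1 * g1 + C (a - a') * f3 ^ 2 + C (c - c') * f3 + p"
    using P(5) P'(5) by (simp add: h1_def C_diff algebra_simps)
  have h2: "h2 = C l2 * g2 + C (b - b') * f3 + C e"
    using P(6) P'(6) by (simp add: h2_def C_diff algebra_simps)
  have dh1: "deg h1 = deg g1" using P'(1,4) G1 by (simp add: h1_def deg_add_eq)
  have dh2: "deg h2 = deg g2" using P'(2) k'(2) G2 by (simp add: h2_def deg_add_eq)
  have Fh: "Kf g1 g2 f3 h1 h2 (a - a') (b - b') (c - c')"
    unfolding Kf_def
    by (rule exI[of _ l1], rule exI[of _ l2], rule exI[of _ p], rule exI[of _ e])
       (use P(1-4) h1 h2 dh1 dh2 in auto)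
  have "wedge h1 h2 = smul (C (l1' * l2')) (wedge g1' g2')"
  proof -
    have "wedge p' g2' = 0" using wedge_alg1_self[OF P'(3) k'(2)] wedge_swap[of p' g2'] by simp
    then have "wedge h1 h2 = smul (C l2') (smul (C l1') (wedge g1' g2'))"
      by (simp add: h1_def h2_def wedge_add_left wedge_add_right wedge_C_mult smul_simps)
    then show ?thesis by (simp add: smul_simps C_mult mult.commute)
  qed
  then have "dd h1 h2 = dd g1' g2'"
    using fdeg_smul_dd[of "C (l1' * l2')" g1' g2'] P'(1,2) d' by (simp add: dd_def)
  moreover have "dd g1' g2' < deg g1" using k'(5,6) G1 G2 k(3) by linarith
  ultimately have z: "a - a' = 0" "b - b' = 0" "c - c' = 0"
    using Kf_facts(8)[OF K Fh] k(4,7,8) k(3) k(12) by (auto split: if_splits)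
  define m1 m2 where "m1 = 1 / l1'" and "m2 = 1 / l2'"
  have m: "m1 \<noteq> 0" "m2 \<noteq> 0" using P'(1,2) by (simp_all add: m1_def m2_def)
  have g2': "g2' = C (m2 * l2) * g2 + C (m2 * (e - e'))"
  proof -
    have "g2' = C m2 * (h2 - C e')" using P'(2) by (simp add: h2_def C_inverse_cancel m2_def)
    also have "\<dots> = C (m2 * l2) * g2 + C (m2 * (e - e'))"
      unfolding h2 z by (simp add: C_mult C_diff algebra_simps)
    finally show ?thesis .
  qed
  have g1': "g1' = C (m1 * l1) * g1 + C m1 * (p - p')"
  proof -
    have "g1' = C m1 * (h1 - p')" using P'(1) by (simp add: h1_def C_inverse_cancel m1_def)
    also have "\<dots> = C (m1 * l1) * g1 + C m1 * (p - p')"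
      unfolding h1 z by (simp add: C_mult C_diff algebra_simps)
    finally show ?thesis .
  qed
  have "alg1 g2' = alg1 g2" unfolding g2' by (rule alg1_affine) (use P(2) m in simp)
  then have "C m1 * (p - p') \<in> alg1 g2" using P(3) P'(3) by (intro alg1_mult alg1_diff) auto
  moreover have "deg (C m1 * (p - p')) < deg g1"
    using deg_C_mult_le[of m1 "p - p'"] deg_diff_le[of p p'] P(4) P'(4) G1 by linarith
  ultimately show thesis using that[OF _ _ _ _ g1' g2'] P(1,2) m by simp
qed

text \<open>Both descriptions determine \<open>dd f1 f2\<close>, the second as a pair of first entry
  and anchor, and the values disagree. If the degree of f1 has dropped in one of them, the degree
  bounds are already contradictory.\<close>

lemma Kf_swapped_roles:
  assumes K: "Kcen g1 g2 f3" and F: "Kf g1 g2 f3 f1 f2 a b c"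
    and K': "Kcen g1' g2' f2" and F': "Kf g1' g2' f2 f1 f3 a' b' c'"
  shows False
proof -
  note k = Kcen_facts[OF K] and fc = Kf_facts[OF K F]
  note k' = Kcen_facts[OF K'] and fc' = Kf_facts[OF K' F']
  have x: "dd g2' f2 = dd g2 f3" using fc(2) fc'(2) dd_sym[of f2 f3] by simp
  have y: "dd f1 f2 = dd g2 f3 + deg g1' - deg f3" using fc'(3,4) k'(8) x by simp
  show False
  proof (cases "deg f1 = deg g1 \<and> deg f1 = deg g1'")
    case True
    then show False
      using fc(8) y k(3,4,5,7,8,13) fc(5) k'(9) fc'(4) k(12) by (auto split: if_splits)
  next
    case False
    then show False using fc(4,7) fc'(4,7) k(2,4,9) k'(2,4,9) k(12) by (auto simp: field_simps)
  qed
qed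

text \<open>A member of \<open>A\<close> having the shape of a Shestakov-Umirbaev reducible triple is reducible in the expected way.\<close>
lemma inversion:
  assumes K: "Kcen g1 g2 f3" and F: "Kf g1 g2 f3 f1 f2 a b c" and A: "A {#f1, f2, f3#}"
  obtains (slot3) "a = 0" "b = 0" "c = 0" "red f1 f2 f3"
  | (slot1) "deg f1 = deg g1" "red f2 f3 f1"
  | (data) g1' g2' k1 k2 p e where "k1 \<noteq> 0" "k2 \<noteq> 0" "p \<in> alg1 g2" "deg p < deg g1" "g1' = C k1 * g1 + p"
      "g2' = C k2 * g2 + C e" "Kcen g1' g2' f3" "KD g1' g2' f3"
  using A
proof (cases rule: A_cases3)
  case base
  note k = Kcen_facts[OF K] and fc = Kf_facts[OF K F]
  from base have bs: "deg f1 \<in> {w1, w2, w3}" "deg f2 \<in> {w1, w2, w3}" "deg f3 \<in> {w1, w2, w3}"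
    unfolding mset3_eq by auto
  from K obtain s where s: "2 * deg g1 = real s * deg g2" unfolding Kcen_def by blast
  show thesis
  proof (cases "deg f1 = deg g1")
    case True
    then have "real 2 * deg f1 = real s * deg f2" using s fc by simp
    then have "deg f1 = deg f2" using weights_commensurable_imp_eq[OF bs(1,2), of 2 s] by simp
    then show thesis using fc(9) by simp
  next
    case False
    then have "real 4 * deg f3 = real 3 * deg f2" using fc by auto
    then have "deg f3 = deg f2" using weights_commensurable_imp_eq[OF bs(3,2), of 4 3] by simp
    then show thesis using fc(4) k(13) by simp
  qed
next
  case e1
  note k = Kcen_facts[OF K] and fc = Kf_facts[OF K F]
  show thesis
  proof (cases "deg f1 = deg g1")
    case True
    then show thesis using e1 slot1 by blast
  next
    case False
    \<comment> \<open>Here deg f1 lies strictly between deg g2 and deg g1, but a polynomial of the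
      shape given by \<open>noninc_slot1\<close> has here either the degree of g1 or at most that of
      g2.\<close>
    then have dr: "2 * deg f3 = deg g1" "2 * deg g1 = 3 * deg g2" "deg f1 < deg g1" "deg f1 > deg g2"
      using fc k by auto
    from e1 obtain f1' where n: "nb f2 f3 f1 f1'" "deg f1' < deg f1" unfolding red_def by blast
    obtain l q where h: "l \<noteq> 0" "q \<in> alg f2 f3" "f1' = C l * f1 + q" "deg q = deg f1"
      by (rule nb_dec[OF n])
    have "q \<in> alg g2 f3" using h Kf_alg[OF F] by simp
    then obtain a2 c2 p2 where q: "p2 \<in> alg1 g2" "deg p2 < deg g1" "q = C a2 * f3 ^ 2 + C c2 * f3 + p2"
      by (rule noninc_slot1[OF K]) (use h dr in auto)
    obtain i where i: "deg p2 = real i * deg g2" using alg1_deg_mult[OF q(1) k(2)] by blast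
    have "\<not> i \<ge> 2"
    proof
      assume "i \<ge> 2"
      then have "2 * deg g2 \<le> real i * deg g2" using real_mult_ge[of 2 i "deg g2"] by simp
      then show False using i q dr k by linarith
    qed
    then have p2: "deg p2 \<le> deg g2" using i by (cases "i = 0") (auto simp: not_le less_Suc_eq numeral_2_eq_2)
    have "deg (C c2 * f3) \<le> deg f3" by (rule deg_C_mult_le)
    then have cp: "deg (C c2 * f3 + p2) \<le> deg g2" using p2 dr k by (intro deg_add_leI) auto
    have False
    proof (cases "a2 = 0")
      case True
      then show False using q cp h dr by (simp add: add.assoc)
    next
      case False
      then have "deg (C a2 * f3 ^ 2 + (C c2 * f3 + p2)) = deg g1" using cp dr k by (subst deg_add_eq) auto
      then show False using q h dr by (simp add: add.assoc)
    qed
    then show thesis ..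
  qed
next
  case e2
  note k = Kcen_facts[OF K] and fc = Kf_facts[OF K F]
  from e2 obtain f2' where n: "nb f1 f3 f2 f2'" "deg f2' < deg f2" unfolding red_def by blast
  obtain b' where "deg f2' = deg f2" by (rule Kstep2[OF K F n(1)]) (use n in auto)
  then show thesis using n by simp
next
  case e3
  show thesis
  proof (cases "a = 0 \<and> b = 0 \<and> c = 0")
    case True
    then show thesis using slot3 e3 by blast
  next
    case False
    from e3 obtain f3' where n: "nb f1 f2 f3 f3'" "deg f3' < deg f3" unfolding red_def by blast
    have "deg f3' = deg f3" by (rule Kstep3[OF K F _ n(1)]) (use False n in auto)
    then show thesis using n by simp
  qed
next
  case (K h1 h2 x1 x2 x3 a' b' c')
  note fc = Kf_facts[OF \<open>Kcen g1 g2 f3\<close> F] and fc' = Kf_facts[OF K(2,3)]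
  \<comment> \<open>In either description the first entry is the only one of largest degree, so at
    most the other two can have exchanged roles.\<close>
  from K(1) consider "f1 = x1 \<and> f2 = x2 \<and> f3 = x3" | "f1 = x1 \<and> f2 = x3 \<and> f3 = x2"
    unfolding mset3_eq using fc(9,10) fc'(9,10) by (metis less_asym)
  then show thesis
  proof cases
    case 1
    show thesis
      by (rule Kf_same_roles[OF \<open>Kcen g1 g2 f3\<close> F, of h1 h2 a' b' c']) (use 1 K data in auto)
  next
    case 2
    then show thesis using Kf_swapped_roles[OF \<open>Kcen g1 g2 f3\<close> F, of h1 h2 a' b' c'] K by auto
  qed
qed


section \<open>Closure under elementary transformations\<close>

definition IH :: "real \<Rightarrow> bool" where
  "IH \<nu> \<longleftrightarrow> (\<forall>f g h h'. A {#f, g, h#} \<and> deg f + deg g + deg h < \<nu> \<and> nb f g h h' \<longrightarrow> A {#f, g, h'#})"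

lemma IHD: "IH \<nu> \<Longrightarrow> A {#f, g, h#} \<Longrightarrow> deg f + deg g + deg h < \<nu> \<Longrightarrow> nb f g h h' \<Longrightarrow> A {#f, g, h'#}"
  unfolding IH_def by blast

lemma mset_perms:
  "{#x, y, z#} = {#y, x, z#}" "{#x, y, z#} = {#x, z, y#}" "{#x, y, z#} = {#z, x, y#}" "{#x, y, z#} = {#y, z, x#}" "{#x, y, z#} = {#z, y, x#}"
  by (simp_all add: add_mset_commute)

lemma IHD1: "IH \<nu> \<Longrightarrow> A {#f, g, h#} \<Longrightarrow> deg f + deg g + deg h < \<nu> \<Longrightarrow> nb g h f f' \<Longrightarrow> A {#f', g, h#}"
  using IHD[of \<nu> g h f f'] by (simp add: mset_perms(4)[of f] mset_perms(4)[of f'])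

lemma IHD2: "IH \<nu> \<Longrightarrow> A {#f, g, h#} \<Longrightarrow> deg f + deg g + deg h < \<nu> \<Longrightarrow> nb f h g g' \<Longrightarrow> A {#f, g', h#}"
  using IHD[of \<nu> f h g g'] by (simp add: mset_perms(2)[of f])

text \<open>The transformation factors through the lowered entry, hence through a triple with
  smaller sum of degrees.\<close>

lemma goodD: "IH \<nu> \<Longrightarrow> deg f + deg g + deg h \<le> \<nu> \<Longrightarrow> red f g h \<Longrightarrow> nb f g h h' \<Longrightarrow> A {#f, g, h'#}"
proof -
  assume a: "IH \<nu>" "deg f + deg g + deg h \<le> \<nu>" "red f g h" "nb f g h h'"
  from a(3) obtain k where k: "nb f g h k" "deg k < deg h" "A {#f, g, k#}" unfolding red_def by blast
  have n: "nb f g k h'" by (rule nb_trans[OF nb_sym[OF k(1)] a(4)])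
  show ?thesis by (rule IHD[OF a(1) k(3) _ n]) (use a(2) k(2) in linarith)
qed

lemma nb_alg1: "k \<noteq> 0 \<Longrightarrow> r \<in> alg1 f \<Longrightarrow> nb f x g (C k * g + r)" "k \<noteq> 0 \<Longrightarrow> r \<in> alg1 f \<Longrightarrow> nb x f g (C k * g + r)"
  using nbI alg1_alg by blast+

lemma nb_minus: "r \<in> alg1 f \<Longrightarrow> nb f x g (g - r)" "r \<in> alg1 f \<Longrightarrow> nb x f g (g - r)"
  using nb_alg1[of 1 "- r" f] by (simp_all add: alg1_uminus)

text \<open>Lowering g by a polynomial in f alone does not change the algebra generated by f and g.
  So h can be transformed in the lower triple, where \<open>IH\<close> applies, and g is restored by
  \<open>elem\<close>.\<close>

lemma red_commute_slot1:
  assumes "IH \<nu>" "deg f + deg g + deg h \<le> \<nu>" "red f h g"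
    and w: "k \<noteq> 0" "r \<in> alg1 f" "deg (C k * g + r) < deg g" and n: "nb f g h h'"
  shows "A {#f, g, h'#}"
proof -
  define g' where "g' = C k * g + r"
  have n1: "nb f x g g'" for x unfolding g'_def by (rule nb_alg1(1)[OF w(1,2)])
  have "A {#f, h, g'#}" by (rule goodD[OF assms(1) _ assms(3) n1]) (use assms in simp)
  then have A1: "A {#f, g', h#}" by (simp add: mset_perms(2)[of f])
  have "alg f g' = alg f g" unfolding g'_def by (rule alg_eq1(1)[OF w(1,2)])
  then have "nb f g' h h'" using n by (simp add: nb_def)
  then have "A {#f, g', h'#}" by (rule IHD[OF assms(1) A1, rotated]) (use assms w in \<open>auto simp: g'_def\<close>)
  then have "A {#f, h', g'#}" by (simp add: mset_perms(2)[of f])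
  then have "A {#f, h', g#}" by (rule elem[OF _ n1]) (use w g'_def in simp)
  then show ?thesis by (simp add: mset_perms(2)[of f])
qed

text \<open>A change of h by a polynomial in f alone does not change the algebra generated by f and
  h, so g may be lowered before the change and restored after it.\<close>

lemma red_commute_slot2:
  assumes "IH \<nu>" "deg f + deg g + deg h \<le> \<nu>" "red f h g" and w: "k \<noteq> 0" "p \<in> alg1 f"
  shows "A {#f, g, C k * h + p#}"
proof -
  define h' where "h' = C k * h + p"
  from assms(3) obtain g' where g': "nb f h g g'" "deg g' < deg g" "A {#f, h, g'#}" unfolding red_def by blast
  then have A1: "A {#f, g', h#}" by (simp add: mset_perms(2)[of f])
  have "A {#f, g', h'#}"
    by (rule IHD[OF assms(1) A1]) (use assms g' in \<open>auto simp: h'_def intro: nb_alg1\<close>)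
  then have A2: "A {#f, h', g'#}" by (simp add: mset_perms(2)[of f])
  have "alg f h' = alg f h" unfolding h'_def by (rule alg_eq1(1)[OF w])
  then have "nb f h' g g'" using g' by (simp add: nb_def)
  then have "A {#f, h', g#}" by (rule elem[OF A2 _ g'(2)])
  then show ?thesis by (simp add: mset_perms(2)[of f] h'_def)
qed

lemma lower_by_power:
  assumes "deg g = real i * deg f" "deg g > 0"
  obtains c where "deg (C 1 * g + C (- c) * f ^ i) < deg g" "C (- c) * f ^ i \<in> alg1 f"
proof -
  obtain c where "deg (g - C c * f ^ i) < deg g" using lead_cancel[of g "f ^ i"] assms by auto
  then show thesis using that[of c] by (simp add: C_uminus alg1_mult alg1_power alg1_uminus)
qed

lemma red_commute_slot1_power:
  assumes "IH \<nu>" "deg f + deg g + deg h \<le> \<nu>" "red f h g" "deg g = real i * deg f" "deg g > 0" "nb f g h h'"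
  shows "A {#f, g, h'#}"
proof -
  obtain c where c: "deg (C 1 * g + C (- c) * f ^ i) < deg g" "C (- c) * f ^ i \<in> alg1 f"
    by (rule lower_by_power[OF assms(4,5)])
  show ?thesis by (rule red_commute_slot1[OF assms(1-3) _ c(2,1) assms(6)]) simp
qed

lemma red_commute_slot2_power:
  assumes "IH \<nu>" "deg f + deg g + deg h \<le> \<nu>" "red f h g" "deg h = real i * deg f" "deg h > 0"
  shows "red f g h"
proof -
  obtain c where c: "deg (C 1 * h + C (- c) * f ^ i) < deg h" "C (- c) * f ^ i \<in> alg1 f"
    by (rule lower_by_power[OF assms(4,5)])
  have "A {#f, g, C 1 * h + C (- c) * f ^ i#}" by (rule red_commute_slot2[OF assms(1-3) _ c(2)]) simp
  moreover have "nb f g h (C 1 * h + C (- c) * f ^ i)" by (rule nb_alg1(1)) (use c in auto)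
  ultimately show ?thesis unfolding red_def using c(1) by blast
qed

section \<open>Closure for triples around a centre\<close>

lemma Kf_refl: assumes "Kcen g1 g2 f3" shows "Kf g1 g2 f3 g1 g2 0 0 0"
  unfolding Kf_def
  by (rule exI[of _ 1], rule exI[of _ 1], rule exI[of _ 0], rule exI[of _ 0])
     (use Kcen_facts[OF assms] in auto)

text \<open>The change from (g1, g2) to (g1', g2') is the freedom that \<open>Kf_same_roles\<close>
  leaves in the choice of a centre.\<close>

lemma rel_facts:
  assumes "k1 \<noteq> 0" "k2 \<noteq> 0" "p \<in> alg1 g2" "deg p < deg g1" "g1' = C k1 * g1 + p" "g2' = C k2 * g2 + C e" "deg g2 > 0"
  shows "deg g1' = deg g1" "deg g2' = deg g2" "alg1 g2' = alg1 g2" "alg g1' g2' = alg g1 g2"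
    "dd g2' h = dd g2 h" "dd g1' g2' = dd g1 g2" "alg g2' h = alg g2 h" "nb g2 h g1 g1'" "nb h x g2 g2'"
proof -
  show "deg g1' = deg g1" using assms(1,4) by (simp add: assms(5) deg_add_eq)
  show "deg g2' = deg g2" using assms(2,7) by (simp add: assms(6) deg_add_eq)
  show a1: "alg1 g2' = alg1 g2" unfolding assms(6) by (rule alg1_affine[OF assms(2)])
  have c: "C e \<in> alg1 h" for h by simp
  have al: "alg g2' h = alg g2 h" for h using alg_eq1(2)[OF assms(2) c, of g2 h] assms(6) by (simp add: alg_sym[of h g2])
  then show "alg g2' h = alg g2 h" .
  have "alg g1' g2 = alg g1 g2" unfolding assms(5) using alg_eq1(2)[OF assms(1,3)] by (simp add: alg_sym[of g2])
  then show "alg g1' g2' = alg g1 g2" using al[of g1'] by (simp add: alg_sym[of g1'])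
  have w2: "wedge g2' h = smul (C k2) (wedge g2 h)" for h
    by (simp add: assms(6) wedge_add_left wedge_C_mult)
  have f: "fdeg (smul (C k) w) = fdeg w" if "k \<noteq> 0" for k w
    using that fdeg_smul[of "C k" w] by (cases "w = 0") (auto simp: smul_simps)
  show d2: "dd g2' h = dd g2 h" for h using f[OF assms(2)] by (simp add: dd_def w2)
  have "wedge g2 g1' = smul (C k1) (wedge g2 g1)"
    using wedge_alg1_self[OF assms(3,7)] by (simp add: assms(5) wedge_add_right wedge_C_mult)
  then have "dd g2 g1' = dd g2 g1" using f[OF assms(1)] by (simp add: dd_def)
  then show "dd g1' g2' = dd g1 g2" using d2[of g1'] by (simp add: dd_sym[of g1] dd_sym[of g1'])
  show "nb g2 h g1 g1'" unfolding assms(5) by (rule nb_alg1(1)[OF assms(1,3)])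
  show "nb h x g2 g2'" unfolding assms(6) by (rule nbI[OF assms(2)]) simp
qed

lemma rel_rebase:
  assumes "k1 \<noteq> 0" "k2 \<noteq> 0" "p \<in> alg1 g2" "deg p < deg g1" "g1' = C k1 * g1 + p" "g2' = C k2 * g2 + C e" "deg g2 > 0"
  shows "Kf g1' g2' f3 g1 g2 0 0 0"
proof -
  note r = rel_facts[OF assms]
  have "g1 = C (1 / k1) * g1' + C (- (1 / k1)) * p"
    using assms(1) by (simp add: assms(5) distrib_left C_inverse_cancel C_uminus)
  moreover have "g2 = C (1 / k2) * g2' + C (- (1 / k2) * e)"
    using assms(2) by (simp add: assms(6) distrib_left C_inverse_cancel C_uminus C_mult[symmetric])
  moreover have "C (- (1 / k1)) * p \<in> alg1 g2'" using assms(3) r(3) by (intro alg1_mult) auto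
  moreover have "deg (C (- (1 / k1)) * p) < deg g1'" using assms(1,4) r(1) by simp
  ultimately show ?thesis unfolding Kf_def using assms(1,2) r(1,2)
    by (intro exI[of _ "1 / k1"] exI[of _ "1 / k2"] exI[of _ "C (- (1 / k1)) * p"] exI[of _ "- (1 / k2) * e"]) simp
qed

text \<open>If g1 can be lowered, the lowered triple has the shape \<open>Kf\<close> over the same
  centre, with a first entry of degree below deg g1. A second use of \<open>inversion\<close>, for
  that triple, leaves only the case in which g3 is an anchor with its data.\<close>

lemma type_IV_recover:
  assumes A: "A {#g1, g2, g3#}" and K: "Kcen g1 g2 g3" and nr: "\<not> red g1 g2 g3"
  obtains g1' g2' k1 k2 p e where "k1 \<noteq> 0" "k2 \<noteq> 0" "p \<in> alg1 g2" "deg p < deg g1" "g1' = C k1 * g1 + p"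
      "g2' = C k2 * g2 + C e" "Kcen g1' g2' g3" "KD g1' g2' g3"
proof (rule inversion[OF K Kf_refl[OF K] A])
  assume "red g1 g2 g3" then show thesis using nr by blast
next
  assume "red g2 g3 g1"
  then obtain f1 where f1: "nb g2 g3 g1 f1" "deg f1 < deg g1" "A {#g2, g3, f1#}" unfolding red_def by blast
  then have A1: "A {#f1, g2, g3#}" by (simp add: mset_perms(4)[of f1])
  obtain a c where F: "Kf g1 g2 g3 f1 g2 a 0 c"
    by (rule Kstep1[OF K Kf_refl[OF K] f1(1)]) (use f1 in auto)
  show thesis
  proof (rule inversion[OF K F A1])
    assume "a = 0"
    then show thesis using Kf_facts(7)[OF K F] f1 by simp
  next
    assume "deg f1 = deg g1" then show thesis using f1 by simp
  qed (rule that)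
qed (rule that)

lemma KD_cong:
  assumes "KD g1 g2 f3" "nb g1 g2 f3 f3'" "deg f3' = deg f3" shows "KD g1 g2 f3'"
proof -
  have "nb g1 g2 f3' g3" if "nb g1 g2 f3 g3" for g3 using that assms(2) nb_sym nb_trans by blast
  then show ?thesis using assms(1,3) unfolding KD_def by metis
qed

lemma dd_combine_less:
  assumes "h = C l * f + q" "dd g h < B" "dd g f < B"
  shows "dd g q < B"
proof -
  have "wedge g q = wedge g h + - smul (C l) (wedge g f)" by (simp add: assms(1) wedge_add_right wedge_C_mult)
  moreover have "fdeg (smul (C l) (wedge g f)) \<le> dd g f" using fdeg_smul_le[of "C l" "wedge g f"] by (simp add: dd_def)
  ultimately show ?thesis
    using fdeg_add_le[of "wedge g h" "- smul (C l) (wedge g f)"] assms(2,3) by (simp add: dd_def)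
qed

text \<open>Since f and h differ by q up to a scalar, one of them inherits a large differential
  degree of q. This decides which of two entries is the anchor.\<close>

lemma dd_combine_ge:
  assumes "h = C l * f + q" "dd g f < B" "dd g q \<ge> B"
  shows "dd g h \<ge> B"
proof (rule ccontr)
  assume "\<not> ?thesis"
  then have "dd g q < B" using dd_combine_less[OF assms(1), of g B] assms(2) by simp
  then show False using assms(3) by simp
qed

text \<open>With a = b = c = 0 the passage to f3' may involve cancellation in the algebra of the
  centre. With \<open>K1\<close> data it factors through the lower g3. With \<open>K4\<close> data,
  f3' is again an anchor if it passes the threshold; if not, it is g3 up to a scalar and a constant,
  and the triple is reached from (g1', g2, g3).\<close>

lemma K_closed3_new:
  assumes IH: "IH \<nu>" and s: "deg f1 + deg f2 + deg f3 \<le> \<nu>" and K: "Kcen g1 g2 f3" and F: "Kf g1 g2 f3 f1 f2 0 0 0"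
    and D: "KD g1 g2 f3" and n: "nb f1 f2 f3 f3'" "deg f3' \<le> deg f3"
  shows "A {#f1, f2, f3'#}"
proof -
  note k = Kcen_facts[OF K] and fc = Kf_facts[OF K F]
  note d = gt_degs[OF k(1)]
  from F obtain k1 k2 p e where P: "k1 \<noteq> 0" "k2 \<noteq> 0" "p \<in> alg1 g2" "deg p < deg g1"
     "f1 = C k1 * g1 + p" "f2 = C k2 * g2 + C e" unfolding Kf_def by auto
  note r = rel_facts[OF P k(2)]
  have ng: "nb g1 g2 f3 f3'" using n(1) r(4) by (simp add: nb_def)
  from D consider (1) g3 where "nb g1 g2 f3 g3" "deg g3 < deg f3" "A {#g1, g2, g3#}"
    | (4) g3 g1' where "nb g1 g2 f3 g3" "dd g2 g3 < deg g1 + dd g1 g2" "2 * deg g3 = deg g1" "deg f3 \<le> deg g3"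
       "nb g2 g3 g1 g1'" "deg g1' < deg g1" "A {#g1', g2, g3#}" unfolding KD_def by blast
  then show ?thesis
  proof cases
    case 1
    have A1: "A {#f1, g2, g3#}" by (rule IHD1[OF IH 1(3) _ r(8)]) (use 1 s r in simp)
    have "A {#f1, f2, g3#}" by (rule IHD2[OF IH A1 _ r(9)]) (use 1 s r in simp)
    then show ?thesis
    proof (rule IHD[OF IH])
      show "nb f1 f2 g3 f3'" using nb_trans[OF nb_sym[OF 1(1)] ng] r(4) by (simp add: nb_def)
    qed (use 1 s r in simp)
  next
    case 4
    have G: "2 * deg g1 = 3 * deg g2" using k(2,4,6,9) 4(3,4) by linarith
    show ?thesis
    proof (cases "dd g2 f3' \<ge> deg g1 + dd g1 g2")
      case True
      have df: "deg f3' \<ge> deg g1 - deg g2 + dd g1 g2" using True dd_le[of g2 f3'] by linarith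
      have "deg f3' \<noteq> real i * deg g2" for i
      proof (cases "i = 0")
        case True then show ?thesis using df k(3,4) by simp
      next
        case False
        then have "deg g2 \<le> real i * deg g2" using real_mult_ge[of 1 i "deg g2"] by simp
        then show ?thesis using n(2) 4(3,4) G k(2) by linarith
      qed
      moreover have "gt g1 g2 f3'" using gt_nb k(1) ng by blast
      ultimately have K': "Kcen g1 g2 f3'" using K True n(2) k(5) unfolding Kcen_def by simp
      have D': "KD g1 g2 f3'" unfolding KD_def
      proof (rule disjI2, rule exI[of _ g3], rule exI[of _ g1'], intro conjI)
        show "nb g1 g2 f3' g3" using ng 4(1) nb_sym nb_trans by blast
        show "deg f3' \<le> deg g3" using n(2) 4(4) by simp
      qed (use 4 in auto)
      have "Kf g1 g2 f3' f1 f2 0 0 0" unfolding Kf_def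
        by (rule exI[of _ k1], rule exI[of _ k2], rule exI[of _ p], rule exI[of _ e]) (use P r in simp)
      then show ?thesis using A_K K' D' by blast
    next
      case False
      have "nb g1 g2 g3 f3'" using ng 4(1) nb_sym nb_trans by blast
      then obtain l q where q: "l \<noteq> 0" "q \<in> alg g1 g2" "f3' = C l * g3 + q" "deg q \<le> deg g3"
        by (rule nb_noninc[of _ _ _ _ "deg g3"]) (use n(2) 4(4) in auto)
      have "dd q g2 < deg g1 + dd g1 g2"
        using dd_combine_less[OF q(3), of g2 "deg g1 + dd g1 g2"] False 4(2) by (simp add: dd_sym[of q])
      then have "nonc g1 g2 q" using cancel_imp_dd_ge[OF d(7,1,2) q(2), of 3] G by force
      moreover have "deg q < deg g1" using q(4) 4(3) d(1) by linarith
      ultimately have "q \<in> alg1 g2" by (rule nonc_alg1_snd)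
      then obtain e0 where q0: "q = C e0" using alg1_deg_lt_const q(4) 4(3) G k(2) by fastforce
      have dg3: "deg g3 > 0" using 4(3) d by linarith
      then have df3: "deg f3' = deg g3" using q(1) by (simp add: q(3) q0 deg_add_eq)
      have sm: "deg g1' + deg g2 + deg g3 < \<nu>" using s r 4(4,6) n(2) df3 by simp
      have "nb x y g3 f3'" for x y using q by (auto simp: q0 intro: nbI)
      then have A1: "A {#g1', g2, f3'#}" using IHD[OF IH 4(7) sm] by blast
      have A2: "A {#g1', f2, f3'#}" by (rule IHD2[OF IH A1 _ r(9)]) (use sm df3 in simp)
      have al: "alg f2 f3' = alg g2 g3"
      proof -
        have "alg g2 f3' = alg g2 g3" unfolding q(3) q0 by (rule alg_eq1(1)[OF q(1)]) simp
        then show ?thesis using r(7) by simp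
      qed
      have "nb g2 g3 g1' f1" using 4(5) r(8)[of g3] nb_sym nb_trans by blast
      then have "nb f2 f3' g1' f1" using al by (simp add: nb_def)
      then show ?thesis by (rule IHD1[OF IH A2, rotated]) (use sm df3 r in simp)
    qed
  qed
qed

lemma K_closed:
  assumes IH: "IH \<nu>" and s: "deg f1 + deg f2 + deg f3 \<le> \<nu>" and K: "Kcen g1 g2 f3" and F: "Kf g1 g2 f3 f1 f2 a b c"
    and D: "KD g1 g2 f3"
  shows "nb f2 f3 f1 f1' \<Longrightarrow> deg f1' \<le> deg f1 \<Longrightarrow> A {#f1', f2, f3#}"
    "nb f1 f3 f2 f2' \<Longrightarrow> deg f2' \<le> deg f2 \<Longrightarrow> A {#f1, f2', f3#}"
    "nb f1 f2 f3 f3' \<Longrightarrow> deg f3' \<le> deg f3 \<Longrightarrow> A {#f1, f2, f3'#}"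
proof -
  assume n: "nb f2 f3 f1 f1'" "deg f1' \<le> deg f1"
  have "deg f1' \<le> deg g1" using n Kf_facts(7)[OF K F] by auto
  then obtain a' c' where "Kf g1 g2 f3 f1' f2 a' b c'" using Kstep1[OF K F n(1)] by blast
  then show "A {#f1', f2, f3#}" using A_K K D by blast
next
  assume n: "nb f1 f3 f2 f2'" "deg f2' \<le> deg f2"
  then obtain b' where "Kf g1 g2 f3 f1 f2' a b' c" using Kstep2[OF K F n] by blast
  then show "A {#f1, f2', f3#}" using A_K K D by blast
next
  assume n: "nb f1 f2 f3 f3'" "deg f3' \<le> deg f3"
  show "A {#f1, f2, f3'#}"
  proof (cases "a \<noteq> 0 \<or> b \<noteq> 0 \<or> c \<noteq> 0")
    case True
    obtain a' b' c' where "Kcen g1 g2 f3'" "Kf g1 g2 f3' f1 f2 a' b' c'" "nb g1 g2 f3 f3'" "deg f3' = deg f3"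
      by (rule Kstep3[OF K F True n])
    then show ?thesis using A_K KD_cong[OF D] by blast
  next
    case False
    then show ?thesis using K_closed3_new[OF IH s K _ D n] F by simp
  qed
qed

lemma optimal_exists:
  obtains h' where "nb f g h h'" "\<And>k. nb f g h k \<Longrightarrow> deg h' \<le> deg k"
proof -
  define h' where "h' = arg_min (\<lambda>k. rk (deg k)) (nb f g h)"
  have h': "nb f g h h'" "\<And>k. nb f g h k \<Longrightarrow> rk (deg h') \<le> rk (deg k)"
    unfolding h'_def using arg_min_nat_lemma[of "nb f g h" h "\<lambda>k. rk (deg k)"] nb_refl by auto
  have "deg h' \<le> deg k" if n: "nb f g h k" for k
  proof (rule ccontr)
    assume "\<not> deg h' \<le> deg k"
    moreover obtain m where "deg k = W m" using deg_in_range by blast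
    ultimately show False using h'(2)[OF n] rk_less[of "deg k" "deg h'"] by simp
  qed
  then show thesis using that h' by blast
qed

text \<open>Otherwise a multiple of f^i g^j would cancel the leading term of h and lower its
  degree.\<close>

lemma optimal_nonres:
  assumes "\<And>k. nb f g h k \<Longrightarrow> deg h \<le> deg k" "deg h > 0" "deg f > 0" "deg g > 0"
  shows "deg h \<noteq> real i * deg f + real j * deg g"
proof
  assume e: "deg h = real i * deg f + real j * deg g"
  have "f ^ i \<noteq> 0" "g ^ j \<noteq> 0" using assms(3,4) by (auto intro!: power_nonzero)
  then have "deg (f ^ i * g ^ j) = deg h" by (simp add: deg_mult e)
  then obtain c where c: "deg (h - C c * (f ^ i * g ^ j)) < deg h" using lead_cancel[of h "f ^ i * g ^ j"] assms(2) by auto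
  have "nb f g h (h + - (C c * (f ^ i * g ^ j)))" by (intro nb_add alg_uminus alg_mult alg_power) auto
  then show False using assms(1)[of "h + - (C c * (f ^ i * g ^ j))"] c by simp
qed


section \<open>Pairs of degree ratio s : 2 together with a lowered entry\<close>

lemma red_nb: "nb f g h h' \<Longrightarrow> deg h' < deg h \<Longrightarrow> A {#f, g, h'#} \<Longrightarrow> red f g h"
  unfolding red_def by blast

lemma odd_ratio_ge:
  assumes "2 * x = real s * y" "odd s" "s \<ge> 3" "y > 0"
  shows "3 * y \<le> 2 * x" "y < x" "\<And>i. x \<noteq> real i * y"
proof -
  show a: "3 * y \<le> 2 * x" using real_mult_ge[of 3 s y] assms by simp
  then show "y < x" using assms(4) by linarith
  fix i show "x \<noteq> real i * y"
  proof
    assume "x = real i * y"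
    then have "real (2 * i) * y = real s * y" using assms(1) by simp
    then have "2 * i = s" using assms(4) by (simp only: mult_cancel_right of_nat_eq_iff) auto
    then show False using assms(2) by auto
  qed
qed

text \<open>If slot 3 is good then, with \<open>g3\<close> of least degree in that slot, either \<open>f3\<close> or \<open>g3\<close> satisfies the
  differential condition of \<open>Kcen\<close>; in the second case \<open>type_IV_recover\<close> recovers \<open>f3\<close> as a type IV anchor.\<close>
lemma slot12_closed:
  assumes IH: "IH \<nu>" and sm: "deg g1 + deg g2 + deg f3 \<le> \<nu>" and gt: "gt g1 g2 f3"
    and s: "2 * deg g1 = real s * deg g2" "odd s" "s \<ge> 3" and th: "deg f3 < deg g1" "\<And>i. deg f3 \<noteq> real i * deg g2"
    and r: "red g1 g2 f3"
  shows "nb g2 f3 g1 g1' \<Longrightarrow> deg g1' \<le> deg g1 \<Longrightarrow> A {#g1', g2, f3#}"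
    "nb g1 f3 g2 g2' \<Longrightarrow> deg g2' \<le> deg g2 \<Longrightarrow> A {#g1, g2', f3#}"
proof -
  note d = gt_degs[OF gt]
  note sr = odd_ratio_ge[OF s d(2)]
  have KC: "Kcen g1 g2 h" if "gt g1 g2 h" "deg h < deg g1" "\<And>i. deg h \<noteq> real i * deg g2" "dd g2 h \<ge> deg g1 + dd g1 g2" for h
    unfolding Kcen_def using that s by blast
  have "(\<forall>g1'. nb g2 f3 g1 g1' \<and> deg g1' \<le> deg g1 \<longrightarrow> A {#g1', g2, f3#})
      \<and> (\<forall>g2'. nb g1 f3 g2 g2' \<and> deg g2' \<le> deg g2 \<longrightarrow> A {#g1, g2', f3#})"
  proof (cases "dd g2 f3 \<ge> deg g1 + dd g1 g2")
    case True
    have K: "Kcen g1 g2 f3" by (rule KC[OF gt th True])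
    have D: "KD g1 g2 f3" using r unfolding red_def KD_def by blast
    show ?thesis using K_closed(1,2)[OF IH sm K Kf_refl[OF K] D] by blast
  next
    case False
    obtain g3 where g3: "nb g1 g2 f3 g3" and opt: "\<And>k. nb g1 g2 f3 k \<Longrightarrow> deg g3 \<le> deg k"
      using optimal_exists[of g1 g2 f3] by blast
    have g3lt: "deg g3 < deg f3" using r opt unfolding red_def by force
    have A3: "A {#g1, g2, g3#}" by (rule goodD[OF IH sm r g3])
    have gt3: "gt g1 g2 g3" by (rule gt_nb[OF gt g3])
    have opt3: "\<And>k. nb g1 g2 g3 k \<Longrightarrow> deg g3 \<le> deg k" using opt nb_trans[OF g3] by blast
    have nr: "\<not> red g1 g2 g3" using opt3 unfolding red_def by force
    have res: "deg g3 \<noteq> real i * deg g1 + real j * deg g2" for i j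
      by (rule optimal_nonres[OF opt3]) (use d gt_degs[OF gt3] in auto)
    obtain l q where q: "l \<noteq> 0" "q \<in> alg g1 g2" "g3 = C l * f3 + q" "deg q = deg f3"
      by (rule nb_dec[OF g3 g3lt])
    have "\<not> nonc g1 g2 q"
    proof
      assume "nonc g1 g2 q"
      then have "q \<in> alg1 g2" by (rule nonc_alg1_snd) (use q th in simp)
      then show False using alg1_deg_mult[of q g2] d q th(2) by metis
    qed
    then have "dd q g2 \<ge> deg g1 + dd g1 g2" by (rule cancel_imp_dd_ge[OF d(7,1,2) q(2) _ s])
    then have x3: "dd g2 g3 \<ge> deg g1 + dd g1 g2"
      using dd_combine_ge[OF q(3), of g2 "deg g1 + dd g1 g2"] False by (simp add: dd_sym[of q])
    have K3: "Kcen g1 g2 g3" by (rule KC[OF gt3 _ _ x3]) (use g3lt th res[of 0] in auto)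
    obtain h1 h2 k1 k2 p e where rel: "k1 \<noteq> 0" "k2 \<noteq> 0" "p \<in> alg1 g2" "deg p < deg g1" "h1 = C k1 * g1 + p"
      "h2 = C k2 * g2 + C e" and K': "Kcen h1 h2 g3" and D': "KD h1 h2 g3"
      by (rule type_IV_recover[OF A3 K3 nr])
    note rf = rel_facts[OF rel d(2)]
    have nbh: "nb h1 h2 = nb g1 g2" by (simp add: nb_def fun_eq_iff rf(4))
    from D' obtain g4 g1' where F: "nb g1 g2 g3 g4" "dd g2 g4 < deg g1 + dd g1 g2" "2 * deg g4 = deg g1"
       "deg g3 \<le> deg g4" "nb h2 g4 h1 g1'" "deg g1' < deg g1" "A {#g1', h2, g4#}"
      unfolding KD_def nbh rf(1,2,5,6) using opt3 by force
    \<comment> \<open>The threshold gives deg g3 > deg g1 - deg g2, and the type IV data give deg g3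
      \<le> deg g1 / 2; together they exclude all s above 3.\<close>
    have G: "2 * deg g1 = 3 * deg g2" using Kcen_facts(6,9)[OF K3] F(3,4) sr d by linarith
    have "nb g1 g2 g4 f3" by (rule nb_trans[OF nb_sym[OF F(1)] nb_sym[OF g3]])
    then obtain m t where t: "m \<noteq> 0" "t \<in> alg g1 g2" "f3 = C m * g4 + t" "deg t \<le> max (deg f3) (deg g4)"
      by (rule nb_noninc[of _ _ _ _ "max (deg f3) (deg g4)"]) auto
    have "dd t g2 < deg g1 + dd g1 g2"
      using dd_combine_less[OF t(3), of g2 "deg g1 + dd g1 g2"] False F(2) by (simp add: dd_sym[of t])
    then have "nonc g1 g2 t" using cancel_imp_dd_ge[OF d(7,1,2) t(2) _ s] by force
    moreover have tl: "deg t < deg g1" using t(4) th F(3) d(1) by linarith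
    ultimately have t1: "t \<in> alg1 g2" by (rule nonc_alg1_snd)
    have "deg t < deg g2"
    proof (rule ccontr)
      assume nl: "\<not> deg t < deg g2"
      then have "deg (C m * g4) < deg t" using t(1) F(3) G d by simp
      then have "deg f3 = deg t" unfolding t(3) by (rule deg_add_eq')
      then show False using alg1_deg_mult[OF t1 d(2)] th(2) by metis
    qed
    then obtain e0 where e0: "t = C e0" using alg1_deg_lt_const[OF t1] by blast
    have df3: "deg f3 = deg g4" using t(1) F(3) d(1) by (simp add: t(3) e0 deg_add_eq)
    have s4: "deg g1' + deg g2 + deg f3 < \<nu>" using sm F(6) by linarith
    have "nb g1' h2 g4 f3" unfolding t(3) e0 by (rule nbI[OF t(1)]) simp
    then have A5: "A {#g1', h2, f3#}" using IHD[OF IH F(7)] s4 df3 rf by simp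
    have A6: "A {#g1', g2, f3#}"
      by (rule IHD2[OF IH A5 _ nb_sym[OF rf(9)]]) (use s4 rf in simp)
    have al: "alg h2 g4 = alg g2 f3"
    proof -
      have "alg g2 f3 = alg g2 g4" unfolding t(3) e0 by (rule alg_eq1(1)[OF t(1)]) simp
      then show ?thesis using rf(7) by simp
    qed
    have "nb g2 f3 h1 g1'" using F(5) al by (simp add: nb_def)
    then have n1: "nb g2 f3 g1 g1'" using rf(8)[of f3] nb_trans by blast
    have r1: "red g2 f3 g1"
      by (rule red_nb[OF n1 F(6)]) (use A6 in \<open>simp add: mset_perms(4)[of g1']\<close>)
    show ?thesis
    proof (intro conjI allI impI)
      fix k assume "nb g2 f3 g1 k \<and> deg k \<le> deg g1"
      then have "A {#g2, f3, k#}" using goodD[OF IH _ r1] sm by simp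
      then show "A {#k, g2, f3#}" by (simp add: mset_perms(4)[of k])
    next
      fix k assume n: "nb g1 f3 g2 k \<and> deg k \<le> deg g2"
      \<comment> \<open>Now g1 has twice the degree of f3, so a multiple of f3^2 lowers it, and this
        commutes with the transformation of g2.\<close>
      have "A {#f3, g1, k#}"
      proof (rule red_commute_slot1_power[OF IH])
        show "red f3 g2 g1" using r1 red_swap by blast
        show "deg g1 = real 2 * deg f3" using F(3) df3 by simp
        show "nb f3 g1 g2 k" using n nb_swap by metis
      qed (use sm d in auto)
      then show "A {#g1, k, f3#}" by (simp add: mset_perms(4)[of f3])
    qed
  qed
  then show "nb g2 f3 g1 g1' \<Longrightarrow> deg g1' \<le> deg g1 \<Longrightarrow> A {#g1', g2, f3#}"
    "nb g1 f3 g2 g2' \<Longrightarrow> deg g2' \<le> deg g2 \<Longrightarrow> A {#g1, g2', f3#}" by blast+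
qed

text \<open>This is the situation of type IV. If the passage from f3 to f3' involves cancellation,
  one of the two passes the threshold. If it is f3, \<open>inversion\<close> recovers its data from
  the lowered triple; if only f3' does, then f3 and the lowered g1 are themselves type IV data for
  the anchor f3'.\<close>

lemma half_degree_slot3_closed:
  assumes IH: "IH \<nu>" and sm: "deg g1 + deg g2 + deg f3 \<le> \<nu>" and gt: "gt g1 g2 f3"
    and G: "2 * deg g1 = 3 * deg g2" "2 * deg f3 = deg g1" and r: "red g2 f3 g1"
    and n: "nb g1 g2 f3 f3'" "deg f3' \<le> deg f3"
  shows "A {#g1, g2, f3'#}"
proof -
  note d = gt_degs[OF gt]
  have s: "2 * deg g1 = real 3 * deg g2" "odd (3::nat)" "(3::nat) \<ge> 3" using G by auto
  have small: "deg h \<noteq> real i * deg g2" if "deg h > 0" "deg h \<le> deg f3" for h i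
  proof (cases "i = 0")
    case False
    then have "deg g2 \<le> real i * deg g2" using real_mult_ge[of 1 i "deg g2"] by simp
    then show ?thesis using that G d by linarith
  qed (use that in simp)
  have KC: "Kcen g1 g2 h" if "gt g1 g2 h" "deg h \<le> deg f3" "dd g2 h \<ge> deg g1 + dd g1 g2" for h
    unfolding Kcen_def using that s small[of h] gt_degs[OF that(1)] G d
    by (intro conjI exI[of _ 3]) auto
  obtain l q where q: "l \<noteq> 0" "q \<in> alg g1 g2" "f3' = C l * f3 + q" "deg q \<le> deg f3"
    by (rule nb_noninc[OF n order.refl])
  show ?thesis
  proof (cases "nonc g1 g2 q")
    case True
    then have "q \<in> alg1 g2" by (rule nonc_alg1_snd) (use q G d in linarith)
    then have "A {#g2, g1, f3'#}" unfolding q(3)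
      by (intro red_commute_slot2[OF IH] q(1)) (use sm r red_swap in auto)
    then show ?thesis by (simp add: mset_perms(1)[of g2])
  next
    case False
    then have dq: "dd g2 q \<ge> deg g1 + dd g1 g2" using cancel_imp_dd_ge[OF d(7,1,2) q(2) _ s] dd_sym[of q] by simp
    show ?thesis
    proof (cases "dd g2 f3 \<ge> deg g1 + dd g1 g2")
      case True
      have K: "Kcen g1 g2 f3" by (rule KC[OF gt order.refl True])
      from r obtain f1 where f1: "nb g2 f3 g1 f1" "deg f1 < deg g1" "A {#g2, f3, f1#}" unfolding red_def by blast
      then have A1: "A {#f1, g2, f3#}" by (simp add: mset_perms(4)[of f1])
      obtain a c where F: "Kf g1 g2 f3 f1 g2 a 0 c"
        by (rule Kstep1[OF K Kf_refl[OF K] f1(1)]) (use f1 in auto)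
      show ?thesis
      proof (rule inversion[OF K F A1])
        assume "a = 0"
        then show ?thesis using Kf_facts(7)[OF K F] f1 by simp
      next
        assume "deg f1 = deg g1" then show ?thesis using f1 by simp
      next
        fix h1 h2 k1 k2 p e
        assume rel: "k1 \<noteq> 0" "k2 \<noteq> 0" "p \<in> alg1 g2" "deg p < deg g1" "h1 = C k1 * g1 + p" "h2 = C k2 * g2 + C e"
          and K': "Kcen h1 h2 f3" and D': "KD h1 h2 f3"
        show ?thesis by (rule K_closed(3)[OF IH sm K' rel_rebase[OF rel d(2)] D' n])
      qed
    next
      case False
      have x: "dd g2 f3' \<ge> deg g1 + dd g1 g2"
        using dd_combine_ge[OF q(3), of g2 "deg g1 + dd g1 g2"] False dq by simp
      have K: "Kcen g1 g2 f3'" by (rule KC[OF gt_nb[OF gt n(1)] n(2) x])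
      from r obtain f1 where f1: "nb g2 f3 g1 f1" "deg f1 < deg g1" "A {#g2, f3, f1#}" unfolding red_def by blast
      then have A1: "A {#f1, g2, f3#}" by (simp add: mset_perms(4)[of f1])
      have "KD g1 g2 f3'" unfolding KD_def
        by (rule disjI2, rule exI[of _ f3], rule exI[of _ f1]) (use nb_sym[OF n(1)] False G n(2) f1 A1 in auto)
      then show ?thesis using A_K K Kf_refl by blast
    qed
  qed
qed

text \<open>The element R that lowers g has degree below deg h, so \<open>drop_degree_cases\<close>
  applies to it. Integer ratios give commuting moves, and the others lead to
  \<open>slot12_closed\<close>. If deg f is a multiple of deg h, only a lowering of f is obtained;
  \<open>main_step\<close> continues with f and g exchanged.\<close>

lemma main_step_lower:
  assumes IH: "IH \<nu>" and sm: "deg f + deg g + deg h \<le> \<nu>" and gt: "gt f g h"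
    and lt: "deg g < deg h" and r: "red h f g"
  shows "(\<forall>h'. nb f g h h' \<and> deg h' \<le> deg h \<longrightarrow> A {#f, g, h'#}) \<or> (\<exists>s\<ge>2. deg f = real s * deg h \<and> red g h f)"
proof -
  note d = gt_degs[OF gt]
  have rf: "red f h g" using r red_swap by blast
  from r obtain g' where g': "nb h f g g'" "deg g' < deg g" unfolding red_def by blast
  obtain k R where R: "k \<noteq> 0" "R \<in> alg h f" "g' = C k * g + R" "deg R = deg g" by (rule nb_dec[OF g'])
  show ?thesis
  proof (cases "R \<in> alg1 f")
    case True
    have "A {#f, g, h'#}" if "nb f g h h'" for h'
      by (rule red_commute_slot1[OF IH sm rf R(1) True _ that]) (use R g' in simp)
    then show ?thesis by blast
  next
    case False
    have "deg R < deg h" using R lt by simp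
    then show ?thesis
    proof (rule drop_degree_cases[OF d(11,3,1) R(2) _ False])
      fix t assume t: "deg h = real t * deg f"
      have "red f g h" by (rule red_commute_slot2_power[OF IH sm rf t d(3)])
      then show ?thesis using goodD[OF IH sm] by blast
    next
      fix s :: nat assume s: "s \<ge> 2" "deg f = real s * deg h"
      have "red h g f" by (rule red_commute_slot2_power[OF IH _ _ s(2) d(1)]) (use sm r in auto)
      then show ?thesis using s red_swap by blast
    next
      fix t :: nat assume t: "odd t" "t \<ge> 3" "2 * deg h = real t * deg f"
      show ?thesis
      proof (cases "\<exists>i. deg g = real i * deg f")
        case True
        then obtain i where i: "deg g = real i * deg f" by blast
        have "A {#f, g, h'#}" if "nb f g h h'" for h'
          by (rule red_commute_slot1_power[OF IH sm rf i d(2) that])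
        then show ?thesis by blast
      next
        case False
        have gth: "gt h f g" using gt gt_perm by blast
        have "A {#f, g, h'#}" if n: "nb f g h h'" "deg h' \<le> deg h" for h'
        proof -
          have "A {#h', f, g#}"
            by (rule slot12_closed(1)[OF IH _ gth t(3,1,2) lt _ r n]) (use sm False in auto)
          then show ?thesis by (simp add: mset_perms(4)[of h'])
        qed
        then show ?thesis by blast
      qed
    next
      assume t: "2 * deg f = 3 * deg h"
      have gtf: "gt f h g" using gt gt_perm by blast
      have nr: "deg g \<noteq> real i * deg h" for i
      proof (cases "i = 0")
        case False
        then have "deg h \<le> real i * deg h" using real_mult_ge[of 1 i "deg h"] by simp
        then show ?thesis using lt by linarith
      qed (use d in simp)
      have t3: "2 * deg f = real 3 * deg h" "odd (3::nat)" "(3::nat) \<ge> 3" using t by auto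
      have "A {#f, g, h'#}" if n: "nb f g h h'" "deg h' \<le> deg h" for h'
      proof -
        have "A {#f, h', g#}"
          by (rule slot12_closed(2)[OF IH _ gtf t3 _ nr rf n]) (use sm lt t d in auto)
        then show ?thesis by (simp add: mset_perms(2)[of f h'])
      qed
      then show ?thesis by blast
    qed
  qed
qed

section \<open>Sporadic degree ratios and the general step\<close>

lemma coprime_ratio_unique:
  assumes "coprime p r" "coprime p' r'" "real p * x = real r * y" "real p' * x = real r' * y" "x > 0" "y > 0"
  shows "p = (p'::nat)" "r = r'"
proof -
  have "real (p * r') * (x * y) = (real p * x) * (real r' * y)" by simp
  also have "\<dots> = (real r * y) * (real p' * x)" using assms by simp
  also have "\<dots> = real (p' * r) * (x * y)" by simp
  finally have "real (p * r') = real (p' * r)" using assms(5,6) by simp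
  then have e: "p * r' = p' * r" unfolding of_nat_eq_iff .
  then have "p dvd p'" "p' dvd p" using assms(1,2)
    by (metis coprime_commute coprime_dvd_mult_left_iff dvd_triv_left mult.commute)+
  then show p: "p = p'" by (rule dvd_antisym)
  have "p \<noteq> 0"
  proof
    assume "p = 0"
    then have "real r * y = 0" using assms(3) by simp
    then have "r = 0" using assms(6) by simp
    then show False using assms(1) \<open>p = 0\<close> by simp
  qed
  then show "r = r'" using e p by simp
qed

text \<open>Clearing denominators turns the bounds into inequalities between integers. A parity
  argument excludes p = 2, and for larger p the elimination of r gives (p - 2)(t - 2) < 4. Of the
  few remaining pairs, p = 4 and t = 3 give r = 3 and hence 2 th = G.\<close>

lemma sporadic_arith:
  fixes p r t :: nat and u G th :: real
  assumes u: "u > 0" and G: "2 * G = real t * u" and th: "real p * th = real r * u" and odd: "odd t" "t \<ge> 3"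
    and p: "p \<ge> 2" and c: "coprime p r" and b: "G - u < th" "th < G" "real p * th < G + th + u"
  shows "2 * th = G \<and> t = 3 \<or> (t = 5 \<and> p = 3 \<and> r = 5) \<or> (t = 3 \<and> p = 3 \<and> r = 2) \<or> (t = 3 \<and> p = 5 \<and> r = 3)"
proof -
  have p0: "real p > 0" using p by simp
  have 1: "2 * r < p * t"
  proof -
    have "real p * th < real p * G" using b(2) p0 by simp
    then have "2 * (real p * th) < real p * (2 * G)" by simp
    then have "real (2 * r) * u < real (p * t) * u" unfolding th G by (simp add: algebra_simps)
    then have "real (2 * r) < real (p * t)" using u by simp
    then show ?thesis by (simp only: of_nat_less_iff)
  qed
  have 2: "p * t < 2 * r + 2 * p"
  proof -
    have "real p * G < real p * (th + u)" using b(1) p0 by (intro mult_strict_left_mono) auto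
    then have "real p * (2 * G) < 2 * (real p * th) + 2 * real p * u" by (simp add: algebra_simps)
    then have "real (p * t) * u < real (2 * r + 2 * p) * u" unfolding G th by (simp add: algebra_simps)
    then have "real (p * t) < real (2 * r + 2 * p)" using u by simp
    then show ?thesis by (simp only: of_nat_less_iff)
  qed
  have 3: "2 * p * r < p * t + 2 * r + 2 * p"
  proof -
    have "real p * (real p * th) < real p * (G + th + u)" using b(3) p0 by simp
    then have "2 * real p * (real p * th) < real p * (2 * G) + 2 * (real p * th) + 2 * real p * u" by (simp add: algebra_simps)
    then have "real (2 * p * r) * u < real (p * t + 2 * r + 2 * p) * u" unfolding G th by (simp add: algebra_simps)
    then have "real (2 * p * r) < real (p * t + 2 * r + 2 * p)" using u by simp
    then show ?thesis by (simp only: of_nat_less_iff)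
  qed
  show ?thesis
  proof (cases "p = 2")
    case True
    then have "2 * r < 2 * t" "2 * t < 2 * r + 4" using 1 2 by simp_all
    then have "r + 1 = t" by linarith
    then have "even r" using odd by auto
    then have False using c True by auto
    then show ?thesis ..
  next
    case False
    then have p3: "p \<ge> 3" using p by simp
    have 4: "(p - 1) * (p * t) < (p - 1) * (2 * r + 2 * p)" using 2 p by simp
    have 5: "(p - 1) * (2 * r + 2 * p) < p * t + 2 * p + (p - 1) * (2 * p)"
      using 3 p by (simp add: algebra_simps diff_mult_distrib2)
    have "(p - 1) * (p * t) < p * (t + 2 + 2 * (p - 1))" using 4 5 by (simp add: algebra_simps)
    then have "p * ((p - 1) * t) < p * (t + 2 + 2 * (p - 1))" by (simp add: algebra_simps)
    then have 6: "(p - 1) * t < t + 2 + 2 * (p - 1)" by (simp only: mult_less_cancel1)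
    define m where "m = p - 2"
    have m: "p = m + 2" "m \<ge> 1" using p3 by (simp_all add: m_def)
    have 7: "m * t < 4 + 2 * m" using 6 unfolding m by (simp add: algebra_simps)
    obtain n where n: "t = n + 2" "n \<ge> 1" using odd by (metis One_nat_def add.commute add_Suc_right le_Suc_ex numeral_2_eq_2 numeral_3_eq_3 plus_1_eq_Suc le_add1)
    have 8: "m * n < 4" using 7 by (simp add: n algebra_simps)
    have "m * 1 \<le> m * n" "1 * n \<le> m * n" using m(2) n(2) by (intro mult_le_mono; simp)+
    then have "m < 4" "n < 4" using 8 by linarith+
    then have mm: "m = 1 \<or> m = 2 \<or> m = 3" and "n = 1 \<or> n = 2 \<or> n = 3" using m(2) n(2) by linarith+
    moreover have "n \<noteq> 2" using odd(1) n(1) by auto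
    ultimately have nn: "n = 1 \<or> n = 3" by blast
    from mm nn consider "p = 3" "t = 3" | "p = 3" "t = 5" | "p = 4" "t = 3" | "p = 5" "t = 3"
      using 8 by (elim disjE) (simp_all add: m(1) n(1))
    then show ?thesis
    proof cases
      case p3: 1
      then have "4 * r < 15" "3 < 2 * r" using 2 3 by simp_all
      then have "r = 2 \<or> r = 3" by linarith
      then show ?thesis using c p3 by auto
    next
      case p5: 2
      then have "4 * r < 21" "9 < 2 * r" using 3 \<open>p * t < 2 * r + 2 * p\<close> by simp_all
      then have "r = 5" by linarith
      then show ?thesis using p5 by simp
    next
      case p4: 3
      then have "6 * r < 20" "4 < 2 * r" using 2 \<open>2 * p * r < p * t + 2 * r + 2 * p\<close> by simp_all
      then have "r = 3" by linarith
      then show ?thesis using p4 th G by simp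
    next
      case p5: 4
      then have "8 * r < 25" "5 < 2 * r" using 2 3 by simp_all
      then have "r = 3" by linarith
      then show ?thesis using p5 by simp
    qed
  qed
qed


lemma real_nat_eq: "real m * u = real n * u \<Longrightarrow> u > 0 \<Longrightarrow> m = n"
  by (simp only: mult_cancel_right of_nat_eq_iff) auto

text \<open>The pair (g2, f3) has itself the ratio 3 : 2, and g1' is an anchor over it. Its type IV
  data yield an expression in g2 and f3 of the degree of g1 without cancellation. In units of deg f3
  this makes 9/4 a sum of multiples of 3/2 and 1, against parity.\<close>

lemma K_case2_false:
  assumes IH: "IH \<nu>" and gt: "gt g1 g2 f3" and u: "2 * deg g1 = 3 * deg g2" "3 * deg f3 = 2 * deg g2"
    and e: "dd g1 g2 \<le> deg f3 - deg g1 + deg g2"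
    and n: "nb g2 f3 g1 g1'" and opt: "\<And>k. nb g2 f3 g1' k \<Longrightarrow> deg g1' \<le> deg k"
    and A1: "A {#g1', g2, f3#}" and lt: "deg g1' < deg g2" and y: "dd f3 g1' \<ge> deg g2 + dd g2 f3"
  shows False
proof -
  note d = gt_degs[OF gt]
  have gt2: "gt g2 f3 g1'" using gt_nb[OF _ n] gt gt_perm by blast
  have res: "deg g1' \<noteq> real i * deg g2 + real j * deg f3" for i j
    by (rule optimal_nonres[OF opt]) (use d gt_degs[OF gt2] in auto)
  have s: "2 * deg g2 = real 3 * deg f3" "odd (3::nat)" "(3::nat) \<ge> 3" using u by auto
  have K: "Kcen g2 f3 g1'" unfolding Kcen_def
    using gt2 s lt res[of 0] y by (intro conjI exI[of _ 3]) auto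
  have A2: "A {#g2, f3, g1'#}" using A1 by (simp add: mset_perms(4)[of g1'])
  have nr: "\<not> red g2 f3 g1'" using opt unfolding red_def by force
  obtain h1 h2 k1 k2 p e' where rel: "k1 \<noteq> 0" "k2 \<noteq> 0" "p \<in> alg1 f3" "deg p < deg g2" "h1 = C k1 * g2 + p"
      "h2 = C k2 * f3 + C e'" and K': "Kcen h1 h2 g1'" and D': "KD h1 h2 g1'"
    by (rule type_IV_recover[OF A2 K nr])
  note rf = rel_facts[OF rel d(3)]
  have nbh: "nb h1 h2 = nb g2 f3" by (simp add: nb_def fun_eq_iff rf(4))
  from D' obtain g4 where F: "nb g2 f3 g1' g4" "dd f3 g4 < deg g2 + dd g2 f3" "2 * deg g4 = deg g2"
    unfolding KD_def nbh rf(1,2,5,6) using opt by force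
  have "nb g2 f3 g4 g1" by (rule nb_trans[OF nb_sym[OF F(1)] nb_sym[OF n]])
  then obtain m t where t: "m \<noteq> 0" "t \<in> alg g2 f3" "g1 = C m * g4 + t" unfolding nb_def by blast
  have dt: "deg t = deg g1"
  proof -
    have lt4: "deg (C m * g4) < deg g1" using t(1) F(3) u d by simp
    have "t = g1 + - (C m * g4)" using t(3) by simp
    then show ?thesis using lt4 deg_add_eq[of "- (C m * g4)" g1] by simp
  qed
  have "deg g2 + dd g1 f3 \<le> max (deg g1 + dd g2 f3) (deg f3 + dd g2 g1)"
    by (rule two_maxima) (use gt gt_perm in blast)
  then have "dd g1 f3 < deg g2 + dd g2 f3" using e u d dd_sym[of g2 g1] by auto
  then have "dd t f3 < deg g2 + dd g2 f3"
    using dd_combine_less[OF t(3), of f3 "deg g2 + dd g2 f3"] F(2) dd_sym[of g1 f3] dd_sym[of t f3] by simp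
  then have "nonc g2 f3 t" using cancel_imp_dd_ge[OF d(9,2,3) t(2) _ s] by force
  then obtain i j where ij: "deg g1 = real i * deg g2 + real j * deg f3" using nonc_degree dt by metis
  have e1: "deg g2 = 3/2 * deg f3" and e2: "deg g1 = 9/4 * deg f3" using u by simp_all
  have "9/4 * deg f3 = real i * (3/2 * deg f3) + real j * deg f3" using ij unfolding e2 unfolding e1 .
  then have "real (6 * i + 4 * j) * deg f3 = real 9 * deg f3" by (simp add: field_simps)
  then have "6 * i + 4 * j = 9" using real_nat_eq d by blast
  then show False by presburger
qed

text \<open>Replace g1 by a g1' of least degree in its slot. The lowering needs cancellation, as the
  degrees alone forbid anything else, and this makes \<open>dd g1' g2\<close> and
  \<open>dd f3 g1'\<close> so large that no rule of \<open>A\<close> can have produced the new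
  triple. The case deg g1' < deg g2 survives only for deg f3 = 2/3 deg g2 and is left to
  \<open>K_case2_false\<close>.\<close>

lemma sporadic_false:
  assumes IH: "IH \<nu>" and sm: "deg g1 + deg g2 + deg f3 \<le> \<nu>" and gt: "gt g1 g2 f3" and rd: "red g2 f3 g1"
    and pr: "real p * deg f3 = real r * deg g2"
    and cs: "p = 3 \<and> r = 5 \<and> 2 * deg g1 = 5 * deg g2 \<or> p = 3 \<and> r = 2 \<and> 2 * deg g1 = 3 * deg g2
      \<or> p = 5 \<and> r = (3::nat) \<and> 2 * deg g1 = 3 * deg g2"
    and e: "dd g1 g2 \<le> deg f3 - deg g1 + deg g2"
  shows False
proof -
  note d = gt_degs[OF gt]
  define u where "u = deg g2"
  have u: "u > 0" using d by (simp add: u_def)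
  have cp: "coprime p r" using cs by (elim disjE) (simp_all add: coprime_iff_gcd_eq_1 gcd_non_0_nat)
  have cs': "(p = 3 \<and> r = 5 \<and> deg f3 = 5/3 * u \<and> deg g1 = 5/2 * u) \<or> (p = 3 \<and> r = 2 \<and> deg f3 = 2/3 * u \<and> deg g1 = 3/2 * u)
    \<or> (p = 5 \<and> r = 3 \<and> deg f3 = 3/5 * u \<and> deg g1 = 3/2 * u)"
    using cs pr unfolding u_def by auto
  obtain g1' where n: "nb g2 f3 g1 g1'" and opt1: "\<And>k. nb g2 f3 g1 k \<Longrightarrow> deg g1' \<le> deg k"
    using optimal_exists[of g2 f3 g1] by blast
  have opt: "\<And>k. nb g2 f3 g1' k \<Longrightarrow> deg g1' \<le> deg k" using opt1 nb_trans[OF n] by blast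
  have lt: "deg g1' < deg g1" using rd opt1 unfolding red_def by force
  have A1: "A {#g2, f3, g1'#}" by (rule goodD[OF IH _ rd n]) (use sm in simp)
  then have A2: "A {#g1', g2, f3#}" by (simp add: mset_perms(4)[of g1'])
  have nr: "\<not> red g2 f3 g1'" using opt unfolding red_def by force
  have gt': "gt g1' g2 f3" by (rule A_gt[OF A2 refl])
  note d' = gt_degs[OF gt']
  have res: "deg g1' \<noteq> real i * deg g2 + real j * deg f3" for i j
    by (rule optimal_nonres[OF opt]) (use d d' in auto)
  obtain k R where R: "k \<noteq> 0" "R \<in> alg g2 f3" "g1' = C k * g1 + R" "deg R = deg g1" by (rule nb_dec[OF n lt])
  have "\<not> nonc f3 g2 R"
  proof
    assume "nonc f3 g2 R"
    then obtain i j where ij: "deg g1 = real i * deg f3 + real j * deg g2" using nonc_degree R(4) by metis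
    from cs' show False
    proof (elim disjE conjE)
      assume e1: "deg f3 = 5/3 * u" and e2: "deg g1 = 5/2 * u"
      have "5/2 * u = real i * (5/3 * u) + real j * u" using ij unfolding e1 e2 u_def[symmetric] .
      then have "real (10 * i + 6 * j) * u = real 15 * u" by (simp add: field_simps)
      then have "10 * i + 6 * j = 15" using real_nat_eq u by blast
      then show False by presburger
    next
      assume e1: "deg f3 = 2/3 * u" and e2: "deg g1 = 3/2 * u"
      have "3/2 * u = real i * (2/3 * u) + real j * u" using ij unfolding e1 e2 u_def[symmetric] .
      then have "real (4 * i + 6 * j) * u = real 9 * u" by (simp add: field_simps)
      then have "4 * i + 6 * j = 9" using real_nat_eq u by blast
      then show False by presburger
    next
      assume e1: "deg f3 = 3/5 * u" and e2: "deg g1 = 3/2 * u"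
      have "3/2 * u = real i * (3/5 * u) + real j * u" using ij unfolding e1 e2 u_def[symmetric] .
      then have "real (6 * i + 10 * j) * u = real 15 * u" by (simp add: field_simps)
      then have "6 * i + 10 * j = 15" using real_nat_eq u by blast
      then show False by presburger
    qed
  qed
  moreover have Ra: "R \<in> alg f3 g2" using R alg_sym by blast
  ultimately obtain p' r' where P: "coprime p' r'" "real p' * deg f3 = real r' * deg g2"
     "deg f3 + deg g2 - dd f3 g2 \<le> real p' * deg f3 \<Longrightarrow> dd R g2 \<ge> real p' * deg f3 - deg f3 + dd f3 g2"
    using cancel_bound[OF d(12) d(3) d(2) Ra] by metis
  have pp: "p' = p" using coprime_ratio_unique(1)[OF P(1) cp P(2) pr] d by blast
  have "deg f3 + deg g2 \<le> real r * deg g2" using cs' u u_def[symmetric] by auto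
  then have "deg f3 + deg g2 - dd f3 g2 \<le> real p * deg f3" using pr d dd_sym[of f3 g2] by simp
  then have dR: "dd R g2 \<ge> real r * u - deg f3 + dd g2 f3" using P(3) pp pr dd_sym[of f3 g2] by (simp add: u_def)
  define B where "B = real r * u - deg f3 + dd g2 f3"
  have "dd g2 g1 < B" using e cs' u d(6) dd_sym[of g2 g1] u_def[symmetric] by (auto simp: B_def)
  then have "dd g2 g1' \<ge> B" using dd_combine_ge[OF R(3)] dR dd_sym[of R g2] by (simp add: B_def)
  then have Z: "dd g1' g2 \<ge> real r * u - deg f3 + dd g2 f3" by (simp add: B_def dd_sym[of g1'])
  have "gt f3 g1' g2" using gt' gt_perm by blast
  then have "deg f3 + dd g1' g2 \<le> max (deg g1' + dd f3 g2) (deg g2 + dd f3 g1')" by (rule two_maxima)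
  moreover have "deg g1' + dd f3 g2 < deg f3 + dd g1' g2" using Z lt cs' u dd_sym[of f3 g2] by auto
  ultimately have Y: "dd f3 g1' \<ge> real r * u - u + dd g2 f3" using Z by (auto simp: u_def)
  have T: "deg g1' \<ge> real r * u - deg f3 + dd g2 f3 - u" using Z dd_le[of g1' g2] by (simp add: u_def)
  show False
  proof (cases "deg g1' < u")
    case True
    then have "p = 3 \<and> r = 2 \<and> deg f3 = 2/3 * u \<and> deg g1 = 3/2 * u" using cs' T u d(6) by auto
    then show False
      using K_case2_false[OF IH gt _ _ e n opt A2] True Y by (auto simp: u_def)
  next
    case False
    then have tu: "deg g1' > u" using res[of 1 0] by (simp add: u_def)
    define \<tau> where "\<tau> = deg g1'"
    \<comment> \<open>The bounds T, Z and Y with r = 5, 2 and 3 inserted. In the second line the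
      lower bound u for \<tau> is the case assumption, which is better than T.\<close>
    have N: "(deg f3 = 5/3 * u \<and> deg g1 = 5/2 * u \<and> \<tau> > 7/3 * u \<and> \<tau> < 5/2 * u \<and> dd g1' g2 > 10/3 * u \<and> dd g1' f3 > 4 * u)
     \<or> (deg f3 = 2/3 * u \<and> deg g1 = 3/2 * u \<and> \<tau> > u \<and> \<tau> < 3/2 * u \<and> dd g1' g2 > 4/3 * u \<and> dd g1' f3 > u)
     \<or> (deg f3 = 3/5 * u \<and> deg g1 = 3/2 * u \<and> \<tau> > 7/5 * u \<and> \<tau> < 3/2 * u \<and> dd g1' g2 > 12/5 * u \<and> dd g1' f3 > 2 * u)"
      using cs' T Z Y tu lt d(6) dd_sym[of f3 g1'] by (auto simp: \<tau>_def)
    have th: "deg f3 < \<tau>" "u < \<tau>" using N u by auto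
    have iz: "i = 0" if "b = real i * \<tau> + real j * c" "b < \<tau>" "c \<ge> 0" for i j b c
    proof (rule ccontr)
      assume "i \<noteq> 0"
      then have "\<tau> \<le> real i * \<tau>" using real_mult_ge[of 1 i \<tau>] u th by simp
      moreover have "real j * c \<ge> 0" using that by simp
      ultimately show False using that by linarith
    qed
    have pge: "\<tau> \<le> real q * \<tau>" if "q \<ge> 1" for q using real_mult_ge[of 1 q \<tau>] that u th by simp
    have pge2: "2 * \<tau> \<le> real q * \<tau>" if "q \<ge> 1" "q \<noteq> 1" for q using real_mult_ge[of 2 q \<tau>] that u th by simp
    from A2 show False
    proof (cases rule: A_cases3)
      case base
      then have "deg f3 \<in> {w1, w2, w3}" "deg g2 \<in> {w1, w2, w3}" unfolding mset3_eq by auto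
      then have "deg f3 = deg g2" using weights_commensurable_imp_eq[of "deg f3" "deg g2" p r] pr cs by auto
      then show False using N u by (auto simp: u_def)
    next
      case e1 then show False using nr by blast
    next
      case e2
      then obtain h where h: "nb g1' f3 g2 h" "deg h < deg g2" unfolding red_def by blast
      obtain l q where q: "q \<in> alg g1' f3" "deg q = u" by (rule nb_dec[OF h]) (simp add: u_def)
      show False
      proof (cases "nonc g1' f3 q")
        case True
        then obtain i j where ij: "u = real i * \<tau> + real j * deg f3" using nonc_degree q \<tau>_def by metis
        have "i = 0" by (rule iz[OF ij th(2)]) simp
        then have j: "u = real j * deg f3" using ij by simp
        from N have "deg f3 = 5/3 * u \<or> deg f3 = 2/3 * u \<or> deg f3 = 3/5 * u" by blast
        then have "u = real j * (5/3 * u) \<or> u = real j * (2/3 * u) \<or> u = real j * (3/5 * u)" using j by metis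
        then have "real (5 * j) * u = real 3 * u \<or> real (2 * j) * u = real 3 * u \<or> real (3 * j) * u = real 5 * u"
          by (simp add: field_simps)
        then have "5 * j = 3 \<or> 2 * j = 3 \<or> 3 * j = 5" using real_nat_eq[OF _ u] by blast
        then show False by presburger
      next
        case False
        obtain p2 r2 where P2: "p2 \<ge> 1" "real p2 * \<tau> = real r2 * deg f3" "real p2 * \<tau> \<le> u + \<tau> + deg f3 - dd g1' f3"
          using cancel_bound[OF d'(8,1,3) q(1) False] q(2) unfolding \<tau>_def by metis
        show False
        proof (cases "p2 = 1")
          case True
          then show False using P2(2) res[of 0 r2] by (simp add: \<tau>_def)
        next
          case False
          then show False using pge2[OF P2(1)] P2(3) N u by auto
        qed
      qed
    next
      case e3
      then obtain h where h: "nb g1' g2 f3 h" "deg h < deg f3" unfolding red_def by blast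
      obtain l q where q: "q \<in> alg g1' g2" "deg q = deg f3" by (rule nb_dec[OF h]) simp
      show False
      proof (cases "nonc g1' g2 q")
        case True
        then obtain i j where ij: "deg f3 = real i * \<tau> + real j * u" using nonc_degree q \<tau>_def u_def by metis
        have "i = 0" by (rule iz[OF ij th(1)]) (use u in simp)
        then have j: "deg f3 = real j * u" using ij by simp
        from N have "deg f3 = 5/3 * u \<or> deg f3 = 2/3 * u \<or> deg f3 = 3/5 * u" by blast
        then have "5/3 * u = real j * u \<or> 2/3 * u = real j * u \<or> 3/5 * u = real j * u" using j by metis
        then have "real (3 * j) * u = real 5 * u \<or> real (3 * j) * u = real 2 * u \<or> real (5 * j) * u = real 3 * u"
          by (simp add: field_simps)
        then have "3 * j = 5 \<or> 3 * j = 2 \<or> 5 * j = 3" using real_nat_eq[OF _ u] by blast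
        then show False by presburger
      next
        case False
        obtain p2 r2 where P2: "p2 \<ge> 1" "real p2 * \<tau> = real r2 * u" "real p2 * \<tau> \<le> deg f3 + \<tau> + u - dd g1' g2"
          using cancel_bound[OF d'(7,1,2) q(1) False] q(2) unfolding \<tau>_def u_def by metis
        show False
        proof (cases "p2 = 1")
          case True
          then show False using P2(2) res[of r2 0] by (simp add: \<tau>_def u_def)
        next
          case False
          then show False using pge2[OF P2(1)] P2(3) N u by auto
        qed
      qed
    next
      case (K h1 h2 x1 x2 x3 a b c)
      note k = Kcen_facts[OF K(2)] and fc = Kf_facts[OF K(2,3)]
      have mx: "deg g2 < deg g1'" "deg f3 < deg g1'" using th by (simp_all add: u_def \<tau>_def)
      have "g1' = x1 \<and> (g2 = x2 \<and> f3 = x3 \<or> g2 = x3 \<and> f3 = x2)"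
        using K(1) mx fc(9,10) unfolding mset3_eq by (metis less_asym)
      then have "deg x1 = \<tau> \<and> (u = deg x2 \<and> deg f3 = deg x3 \<or> u = deg x3 \<and> deg f3 = deg x2)"
        by (auto simp: u_def \<tau>_def)
      then show False using fc(4,7) k(9) N u by auto
    qed
  qed
qed

text \<open>Now the change P of h has degree below deg g, and \<open>drop_degree_cases\<close> is
  applied to P. For the ratios s : 2, commuting moves and sporadic degrees apart, some entry turns
  out to have twice the degree of h, which is the case of
  \<open>half_degree_slot3_closed\<close>.\<close>

lemma main_step_higher:
  assumes IH: "IH \<nu>" and sm: "deg f + deg g + deg h \<le> \<nu>" and gt: "gt f g h"
    and lt: "deg h < deg g" and r: "red h f g" and n: "nb f g h h'" "deg h' \<le> deg h"
  shows "A {#f, g, h'#}"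
proof -
  note d = gt_degs[OF gt]
  have rf: "red f h g" using r red_swap by blast
  obtain k P where P: "k \<noteq> 0" "P \<in> alg f g" "h' = C k * h + P" "deg P \<le> deg h"
    by (rule nb_noninc[OF n order.refl])
  from r obtain g' where g': "nb h f g g'" "deg g' < deg g" unfolding red_def by blast
  obtain l R where R: "l \<noteq> 0" "R \<in> alg h f" "g' = C l * g + R" "deg R = deg g" by (rule nb_dec[OF g'])
  show ?thesis
  proof (cases "P \<in> alg1 f")
    case True
    show ?thesis unfolding P(3) by (rule red_commute_slot2[OF IH sm rf P(1) True])
  next
    case False
    have Pa: "P \<in> alg g f" "deg P < deg g" using P lt alg_sym by auto
    show ?thesis
    proof (rule drop_degree_cases[OF d(10,2,1) Pa False])
      fix t assume "deg g = real t * deg f"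
      then show ?thesis by (rule red_commute_slot1_power[OF IH sm rf _ d(2) n(1)])
    next
      fix s :: nat assume s: "s \<ge> 2" "deg f = real s * deg g"
      have s2: "2 * deg g \<le> deg f" using s real_mult_ge[of 2 s "deg g"] d by simp
      have "red g h f"
      proof -
        obtain c where c: "deg (C 1 * f + C (- c) * g ^ s) < deg f" "C (- c) * g ^ s \<in> alg1 g"
          by (rule lower_by_power[OF s(2) d(1)])
        have nf: "nb h g f (C 1 * f + C (- c) * g ^ s)" by (rule nb_alg1(2)) (use c in auto)
        have gth: "gt h g f" using gt gt_perm by blast
        from main_step_lower[OF IH _ gth _ rf] sm s2 d
        have "(\<forall>f'. nb h g f f' \<and> deg f' \<le> deg f \<longrightarrow> A {#h, g, f'#}) \<or> (\<exists>s'\<ge>2. deg h = real s' * deg f \<and> red g f h)"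
          by simp
        then show ?thesis
        proof
          assume "\<forall>f'. nb h g f f' \<and> deg f' \<le> deg f \<longrightarrow> A {#h, g, f'#}"
          then have "A {#h, g, C 1 * f + C (- c) * g ^ s#}" using nf c by force
          then have "red h g f" using red_nb[OF nf c(1)] by blast
          then show ?thesis using red_swap by blast
        next
          assume "\<exists>s'\<ge>2. deg h = real s' * deg f \<and> red g f h"
          then obtain s' :: nat where s': "s' \<ge> 2" "deg h = real s' * deg f" by blast
          then have "2 * deg f \<le> deg h" using real_mult_ge[of 2 s' "deg f"] d by simp
          then show ?thesis using lt s2 d by linarith
        qed
      qed
      moreover have "nb g f h h'" using n nb_swap by metis
      ultimately have "A {#g, f, h'#}" by (intro red_commute_slot1_power[OF IH _ _ s(2) d(1)]) (use sm in simp_all)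
      then show ?thesis by (simp add: mset_perms(1)[of g])
    next
      fix t :: nat assume t: "odd t" "t \<ge> 3" "2 * deg g = real t * deg f" "deg P \<ge> deg g - deg f + dd g f"
      note tr = odd_ratio_ge[OF t(3,1,2) d(1)]
      have gtg: "gt g f h" using gt gt_perm by blast
      have w: "deg h \<ge> deg g - deg f + dd g f" using t P by simp
      have UL': "?thesis" if "2 * deg h = deg g"
      proof -
        have "2 * deg g = 3 * deg f"
        proof -
          have "t < 5"
          proof (rule ccontr)
            assume "\<not> t < 5"
            then have "5 * deg f \<le> real t * deg f" using real_mult_ge[of 5 t "deg f"] by simp
            then show False using w that t(3) d dd_sym[of g f] by linarith
          qed
          then have "t = 3" using t(1,2) by (cases "t = 4") auto
          then show ?thesis using t by simp
        qed
        then have "A {#g, f, h'#}"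
          by (intro half_degree_slot3_closed[OF IH _ gtg _ that rf]) (use sm n nb_swap[of f g] in auto)
        then show ?thesis by (simp add: mset_perms(1)[of g])
      qed
      show ?thesis
      proof (cases "\<exists>i. deg h = real i * deg f")
        case True
        then obtain i where i: "deg h = real i * deg f" by blast
        have "red f g h" by (rule red_commute_slot2_power[OF IH sm rf i d(3)])
        then show ?thesis using goodD[OF IH sm _ n(1)] by blast
      next
        case nres: False
        show ?thesis
        proof (cases "dd f h \<ge> deg g + dd g f")
          case True
          have K: "Kcen g f h" unfolding Kcen_def using gtg t lt nres True by blast
          have "R \<in> alg f h" using R alg_sym by blast
          then obtain a c p where p: "p \<in> alg1 f" "deg p < deg g" "R = C a * h ^ 2 + C c * h + p"
            by (rule noninc_slot1[OF K]) (use R in auto)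
          have cp: "deg (C c * h + p) < deg g" using deg_C_mult_le[of c h] lt p(2) by (intro deg_add_less) auto
          have "2 * deg h = deg g"
          proof (rule ccontr)
            assume ne: "2 * deg h \<noteq> deg g"
            have "a \<noteq> 0" using cp p(3) R(4) by (auto simp: add.assoc)
            then have da: "deg (C a * h ^ 2) = 2 * deg h" by simp
            show False
            proof (cases "2 * deg h < deg g")
              case True
              then have "deg (C a * h ^ 2 + (C c * h + p)) < deg g" using deg_add_less[OF _ cp] da True by simp
              then show False using p(3) R(4) by (simp add: add.assoc)
            next
              case False
              then have "deg (C a * h ^ 2 + (C c * h + p)) = 2 * deg h" using da cp ne deg_add_eq by simp
              then show False using p(3) R(4) ne by (simp add: add.assoc)
            qed
          qed
          then show ?thesis by (rule UL')
        next
          case False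
          show ?thesis
          proof (cases "nonc h f R")
            case True
            then obtain i j where ij: "deg g = real i * deg h + real j * deg f" using nonc_degree R(4) by metis
            have "i \<noteq> 0" using ij tr(3)[of j] by auto
            then have ih: "deg h \<le> real i * deg h" using real_mult_ge[of 1 i "deg h"] by simp
            have "j = 0"
            proof (rule ccontr)
              assume "j \<noteq> 0"
              then have "deg f \<le> real j * deg f" using real_mult_ge[of 1 j "deg f"] by simp
              then show False using ij ih w d dd_sym[of g f] by linarith
            qed
            then have i: "deg g = real i * deg h" using ij by simp
            have "i \<noteq> 1" using i lt by auto
            have "\<not> i \<ge> 3"
            proof
              assume "i \<ge> 3"
              then have "3 * deg h \<le> deg g" using i real_mult_ge[of 3 i "deg h"] by simp
              then show False using w tr(1) d dd_sym[of g f] by linarith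
            qed
            then have "i = 2" using \<open>i \<noteq> 0\<close> \<open>i \<noteq> 1\<close> by linarith
            then show ?thesis using UL' i by simp
          next
            case False
            obtain p q where pq: "p \<ge> 1" "coprime p q" "real p * deg h = real q * deg f"
              "real p * deg h \<le> deg g + deg h + deg f - dd h f"
              using cancel_bound[OF d(11,3,1) R(2) False] R(4) by metis
            have "p \<noteq> 1" using pq(3) nres by auto
            then have p2: "p \<ge> 2" using pq(1) by simp
            have b: "real p * deg h < deg g + deg h + deg f" using pq(4) d dd_sym[of h f] by linarith
            have w': "deg g - deg f < deg h" using w d dd_sym[of g f] by linarith
            consider "2 * deg h = deg g" | "t = 5" "p = 3" "q = 5" | "t = 3" "p = 3" "q = 2" | "t = 3" "p = 5" "q = 3"
              using sporadic_arith[OF d(1) t(3) pq(3) t(1,2) p2 pq(2) w' lt b] by blast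
            then show ?thesis
            proof cases
              case 1 then show ?thesis by (rule UL')
            qed (use sporadic_false[OF IH _ gtg rf pq(3)] sm t w in auto)
          qed
        qed
      qed
    next
      assume t: "2 * deg f = 3 * deg g" "deg P \<ge> deg f - deg g + dd g f"
      have w: "deg h \<ge> deg f - deg g + dd g f" using t P by simp
      have t3: "2 * deg f = real 3 * deg g" "odd (3::nat)" "(3::nat) \<ge> 3" using t by auto
      note tr = odd_ratio_ge[OF t3 d(2)]
      have e: "dd g f > 0" using d dd_sym[of g f] by simp
      have hw: "deg f = 2 * deg h"
      proof (cases "nonc h f R")
        case True
        then obtain i j where ij: "deg g = real i * deg h + real j * deg f" using nonc_degree R(4) by metis
        have nn: "real i * deg h \<ge> 0" "real j * deg f \<ge> 0" by simp_all
        have "j = 0"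
        proof (rule ccontr)
          assume "j \<noteq> 0"
          then have "deg f \<le> real j * deg f" using real_mult_ge[of 1 j "deg f"] by simp
          then show False using ij nn tr by linarith
        qed
        then have i: "deg g = real i * deg h" using ij by simp
        then have "i \<noteq> 0" "i \<noteq> 1" using d lt by auto
        then have "2 * deg h \<le> deg g" using i real_mult_ge[of 2 i "deg h"] by simp
        then show ?thesis using w e t by linarith
      next
        case False
        obtain p q where pq: "p \<ge> 1" "q \<ge> 1" "real p * deg h = real q * deg f"
          "real p * deg h \<le> deg g + deg h + deg f - dd h f"
          using cancel_bound[OF d(11,3,1) R(2) False] R(4) by metis
        have "deg f + dd g h \<le> max (deg g + dd f h) (deg h + dd f g)" by (rule two_maxima[OF gt])
        then have y: "dd h f > deg f - deg g" using w lt t d dd_sym[of g f] dd_sym[of f h] by auto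
        have "q = 1"
        proof (rule ccontr)
          assume "q \<noteq> 1"
          then have "2 * deg f \<le> real q * deg f" using pq real_mult_ge[of 2 q "deg f"] by simp
          then show False using pq y lt t by linarith
        qed
        then have pf: "deg f = real p * deg h" using pq by simp
        have "p \<noteq> 1" using pf lt tr by auto
        have "\<not> p \<ge> 3"
        proof
          assume "p \<ge> 3"
          then have "3 * deg h \<le> deg f" using pf real_mult_ge[of 3 p "deg h"] by simp
          then show False using w e t by linarith
        qed
        then have "p = 2" using pq \<open>p \<noteq> 1\<close> by linarith
        then show ?thesis using pf by simp
      qed
      have "red h g f" by (rule red_commute_slot2_power[OF IH _ r, of 2]) (use sm hw d in auto)
      then have "red g h f" using red_swap by blast
      then show ?thesis by (intro half_degree_slot3_closed[OF IH sm gt t(1)]) (use hw n in auto)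
    qed
  qed
qed

lemma main_step:
  assumes IH: "IH \<nu>" and sm: "deg f + deg g + deg h \<le> \<nu>" and gt: "gt f g h"
    and r: "red h f g" and n: "nb f g h h'" "deg h' \<le> deg h"
  shows "A {#f, g, h'#}"
proof -
  note d = gt_degs[OF gt]
  have rf: "red f h g" using r red_swap by blast
  consider "deg g = deg h" | "deg g < deg h" | "deg h < deg g" by linarith
  then show ?thesis
  proof cases
    case 1
    \<comment> \<open>For equal degrees g is replaced by the smaller g0 = g - c h. The path runs
      through (f, g0, h) and (f, g0, g), after which g0 is turned into h'; both triples have a
      smaller sum of degrees.\<close>
    obtain c where c: "c \<noteq> 0" "deg (g - C c * h) < deg g" using lead_cancel[of g h] 1 d by auto
    define g0 where "g0 = g - C c * h"
    have g: "g = C c * h + g0" by (simp add: g0_def)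
    have n0: "nb f h g g0" using nb_minus(2)[of "C c * h" h f g] by (simp add: g0_def alg1_mult)
    have "A {#f, h, g0#}" by (rule goodD[OF IH _ rf n0]) (use sm in simp)
    then have A1: "A {#f, g0, h#}" by (simp add: mset_perms(2)[of f g0])
    have "nb f g0 h g" unfolding g by (rule nbI[OF c(1)]) simp
    then have "A {#f, g0, g#}" using IHD[OF IH A1] c sm by (simp add: g0_def)
    then have A2: "A {#f, g, g0#}" by (simp add: mset_perms(2)[of f g0])
    have "nb f g g0 h"
    proof -
      have "h = C (- (1 / c)) * g0 + C (1 / c) * g"
        using c(1) by (simp add: g0_def algebra_simps C_uminus C_mult[symmetric] mult.assoc[symmetric])
      moreover have "C (1 / c) * g \<in> alg f g" by (intro alg_mult) auto
      ultimately show ?thesis using nbI[of "- (1 / c)" "C (1 / c) * g" f g g0] c(1) by simp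
    qed
    then have "nb f g g0 h'" using n nb_trans by blast
    then show ?thesis using IHD[OF IH A2] c sm 1 by (simp add: g0_def)
  next
    case 2
    from main_step_lower[OF IH sm gt 2 r] show ?thesis
    proof
      assume "\<exists>s\<ge>2. deg f = real s * deg h \<and> red g h f"
      then obtain s :: nat where s: "s \<ge> 2" "deg f = real s * deg h" "red g h f" by blast
      have "2 * deg h \<le> deg f" using s real_mult_ge[of 2 s "deg h"] d by simp
      then have "deg h < deg f" using d by linarith
      moreover have "gt g f h" using gt gt_perm by blast
      moreover have "nb g f h h'" using n nb_swap by metis
      ultimately have "A {#g, f, h'#}" using s(3) red_swap sm n by (intro main_step_higher[OF IH]) auto
      then show ?thesis by (simp add: mset_perms(1)[of g])
    qed (use n in blast)
  next
    case 3
    then show ?thesis by (rule main_step_higher[OF IH sm gt _ r n])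
  qed
qed

text \<open>The weights are pairwise incommensurable and none is a combination of the others, so an
  entry can be lowered neither with cancellation nor without. The degrees stay the same and
  \<open>base\<close> applies again.\<close>

lemma A_base_closed:
  assumes gt: "gt f g h" and b: "{#deg f, deg g, deg h#} = {#w1, w2, w3#}" and n: "nb f g h h'" "deg h' \<le> deg h"
  shows "A {#f, g, h'#}"
proof -
  note d = gt_degs[OF gt]
  have w: "deg f \<in> {w1, w2, w3}" "deg g \<in> {w1, w2, w3}" "deg h \<in> {w1, w2, w3}" using b unfolding mset3_eq by auto
  have ne: "w1 \<noteq> w2" "w1 \<noteq> w3" "w2 \<noteq> w3"
    using w_indep[of 1 "-1" 0] w_indep[of 1 0 "-1"] w_indep[of 0 1 "-1"] by auto
  have dist: "deg f \<noteq> deg g" "deg f \<noteq> deg h" "deg g \<noteq> deg h" using b ne unfolding mset3_eq by auto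
  have eq: "deg h' = deg h"
  proof (rule ccontr)
    assume "deg h' \<noteq> deg h"
    then have lt: "deg h' < deg h" using n by simp
    obtain k q where q: "q \<in> alg f g" "deg q = deg h" by (rule nb_dec[OF n(1) lt])
    show False
    proof (cases "nonc f g q")
      case True
      then obtain i j where ij: "deg h = real i * deg f + real j * deg g" using nonc_degree q by metis
      show False
        using w dist ij w_indep[of "1" "- int i" "- int j"] w_indep[of "1" "- int j" "- int i"]
          w_indep[of "- int i" 1 "- int j"] w_indep[of "- int j" 1 "- int i"]
          w_indep[of "- int i" "- int j" 1] w_indep[of "- int j" "- int i" 1] by auto
    next
      case False
      obtain p r where "p \<ge> 1" "real p * deg f = real r * deg g"
        using cancel_bound[OF d(7,1,2) q(1) False] by metis
      then have "deg f = deg g" using weights_commensurable_imp_eq[OF w(1,2), of p r] by simp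
      then show False using dist by simp
    qed
  qed
  have gt': "gt f g h'" by (rule gt_nb[OF gt n(1)])
  have bb: "A {#x, y, z#}" if "gt x y z" "deg x = w1" "deg y = w2" "deg z = w3" for x y z using A.base that by blast
  have perm: "gt x y z" if "{#f, g, h'#} = {#x, y, z#}" for x y z using gt_mset[OF gt' that] .
  from b eq consider "deg f = w1 \<and> deg g = w2 \<and> deg h' = w3" | "deg f = w1 \<and> deg g = w3 \<and> deg h' = w2"
    | "deg f = w2 \<and> deg g = w1 \<and> deg h' = w3" | "deg f = w2 \<and> deg g = w3 \<and> deg h' = w1"
    | "deg f = w3 \<and> deg g = w1 \<and> deg h' = w2" | "deg f = w3 \<and> deg g = w2 \<and> deg h' = w1"
    unfolding mset3_eq by auto
  then show ?thesis
  proof cases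
    case 1 then show ?thesis using bb gt' by blast
  next
    case 2
    then have "A {#f, h', g#}" using bb perm[OF mset_perms(2)] by blast
    then show ?thesis unfolding mset_perms(2)[of f h' g] .
  next
    case 3
    then have "A {#g, f, h'#}" using bb perm[OF mset_perms(1)] by blast
    then show ?thesis unfolding mset_perms(1)[of g f h'] .
  next
    case 4
    then have "A {#h', f, g#}" using bb perm[OF mset_perms(3)] by blast
    then show ?thesis unfolding mset_perms(4)[of h' f g] .
  next
    case 5
    then have "A {#g, h', f#}" using bb perm[OF mset_perms(4)] by blast
    then show ?thesis unfolding mset_perms(3)[of g h' f] .
  next
    case 6
    then have "A {#h', g, f#}" using bb perm[OF mset_perms(5)] by blast
    then show ?thesis unfolding mset_perms(5)[of h' g f] .
  qed
qed

lemma A_closed_step: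
  assumes IH: "IH (deg f + deg g + deg h)" and A: "A {#f, g, h#}" and n: "nb f g h h'"
  shows "A {#f, g, h'#}"
proof (cases "deg h' \<le> deg h")
  case False
  show ?thesis by (rule elem[OF A nb_sym[OF n]]) (use False in simp)
next
  case le: True
  have gt: "gt f g h" by (rule A_gt[OF A refl])
  from A show ?thesis
  proof (cases rule: A_cases3)
    case base
    then show ?thesis by (rule A_base_closed[OF gt _ n le])
  next
    case e1
    have gt': "gt g f h" using gt gt_perm(1) by blast
    have rd: "red h g f" using e1 red_swap by blast
    have n': "nb g f h h'" using n nb_swap by metis
    have "A {#g, f, h'#}" by (rule main_step[OF IH _ gt' rd n' le]) simp
    then show ?thesis by (simp add: mset_perms(1)[of g])
  next
    case e2
    have rd: "red h f g" using e2 red_swap by blast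
    show ?thesis by (rule main_step[OF IH order.refl gt rd n le])
  next
    case e3
    show ?thesis by (rule goodD[OF IH order.refl e3 n])
  next
    case (K g1 g2 f1 f2 f3 a b c)
    have sm: "deg f1 + deg f2 + deg f3 \<le> deg f + deg g + deg h" using K(1) unfolding mset3_eq by auto
    note kc = K_closed[OF IH sm K(2,3,4)]
    from K(1) consider "f = f1 \<and> g = f2 \<and> h = f3" | "f = f1 \<and> g = f3 \<and> h = f2" | "f = f2 \<and> g = f1 \<and> h = f3"
      | "f = f2 \<and> g = f3 \<and> h = f1" | "f = f3 \<and> g = f1 \<and> h = f2" | "f = f3 \<and> g = f2 \<and> h = f1"
      unfolding mset3_eq by blast
    then show ?thesis
    proof cases
      case 1 then show ?thesis using kc(3) n le by blast
    next
      case 2 then show ?thesis using kc(2)[of h'] n le by (simp add: mset_perms(2)[of f1 h'])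
    next
      case 3 then show ?thesis using kc(3)[of h'] n le nb_swap[of f g] by (simp add: mset_perms(1)[of f1])
    next
      case 4 then show ?thesis using kc(1)[of h'] n le by (simp add: mset_perms(4)[of h'])
    next
      case 5 then show ?thesis using kc(2)[of h'] n le nb_swap[of f g] by (simp add: mset_perms(4)[of f3])
    next
      case 6 then show ?thesis using kc(1)[of h'] n le nb_swap[of f g] by (simp add: mset_perms(5)[of h'])
    qed
  qed
qed

text \<open>The sums of degrees are real, but they are weights of monomials, so \<open>rk\<close>
  makes the induction well founded.\<close>

theorem A_closed: "A {#f, g, h#} \<Longrightarrow> nb f g h h' \<Longrightarrow> A {#f, g, h'#}"
proof (induction "rk (deg f + deg g + deg h)" arbitrary: f g h h' rule: less_induct)
  case less
  have "IH (deg f + deg g + deg h)"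
    unfolding IH_def
  proof (intro allI impI)
    fix f' g' h1 h2 assume a: "A {#f', g', h1#} \<and> deg f' + deg g' + deg h1 < deg f + deg g + deg h \<and> nb f' g' h1 h2"
    obtain a b c where "deg f' = W a" "deg g' = W b" "deg h1 = W c" using deg_in_range by metis
    then have "deg f' + deg g' + deg h1 = W (a + b + c)" by (simp add: W_add)
    then have "rk (deg f' + deg g' + deg h1) < rk (deg f + deg g + deg h)" using rk_less a by (metis rangeI)
    then show "A {#f', g', h2#}" using less.hyps a by blast
  qed
  then show ?case by (rule A_closed_step[OF _ less.prems])
qed

end

section \<open>Evaluation and total degree\<close>

definition sz :: "mono3 \<Rightarrow> nat" where "sz m = fst m + fst (snd m) + snd (snd m)"

lemma sz_add: "sz (a + b) = sz a + sz b" by (simp add: sz_def)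

definition ev :: "poly3 \<Rightarrow> pt3 \<Rightarrow> complex" where
  "ev f v = (\<Sum>m\<in>keys f. lookup f m * fst v ^ fst m * fst (snd v) ^ fst (snd m) * snd (snd v) ^ snd (snd m))"

lemma ev_superset:
  "finite S \<Longrightarrow> keys f \<subseteq> S \<Longrightarrow>
    ev f v = (\<Sum>m\<in>S. lookup f m * fst v ^ fst m * fst (snd v) ^ fst (snd m) * snd (snd v) ^ snd (snd m))"
  unfolding ev_def by (rule sum.mono_neutral_left) (auto simp: in_keys_iff)

lemma ev_add: "ev (f + g) v = ev f v + ev g v"
proof -
  have S: "finite (keys f \<union> keys g)" "keys f \<subseteq> keys f \<union> keys g" "keys g \<subseteq> keys f \<union> keys g" "keys (f + g) \<subseteq> keys f \<union> keys g"
    using keys_add[of f g] by auto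
  show ?thesis
    unfolding ev_superset[OF S(1,2)] ev_superset[OF S(1,3)] ev_superset[OF S(1,4)]
    by (simp add: lookup_add algebra_simps sum.distrib)
qed

lemma ev_0 [simp]: "ev 0 v = 0" by (simp add: ev_def)

lemma ev_sum: "ev (\<Sum>x\<in>A. f x) v = (\<Sum>x\<in>A. ev (f x) v)"
  by (induction A rule: infinite_finite_induct) (simp_all add: ev_add)

lemma ev_single: "ev (single m c) v = c * fst v ^ fst m * fst (snd v) ^ fst (snd m) * snd (snd v) ^ snd (snd m)"
  by (cases "c = 0") (simp_all add: ev_def)

lemma ev_mult: "ev (f * g) v = ev f v * ev g v"
proof -
  have "ev (f * g) v = (\<Sum>a\<in>keys f. \<Sum>b\<in>keys g. ev (single (a + b) (lookup f a * lookup g b)) v)"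
    by (simp add: times_eq_sum_singles[of f g] ev_sum)
  also have "\<dots> = ev f v * ev g v"
    unfolding ev_def[of f] ev_def[of g] sum_product
    by (intro sum.cong refl) (simp add: ev_single power_add algebra_simps)
  finally show ?thesis .
qed

lemma ev_C [simp]: "ev (C c) v = c" by (simp add: C_def ev_single)

lemma ev_power: "ev (f ^ n) v = ev f v ^ n"
  using ev_C[of 1 v] by (induction n) (simp_all add: ev_mult)

lemma ev_uminus: "ev (- f) v = - ev f v"
  using ev_add[of f "- f" v] by (simp add: eq_neg_iff_add_eq_0 add.commute)

lemma ev_diff: "ev (f - g) v = ev f v - ev g v"
  using ev_add[of f "- g" v] by (simp add: ev_uminus)

text \<open>Kronecker substitution \<open>(t, t^N, t^(N*N))\<close> with \<open>N\<close> above all exponents keeps distinct monomials apart.\<close>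
lemma ev_eq_0_imp: assumes "\<And>v. ev f v = 0" shows "f = 0"
proof (rule ccontr)
  assume nz: "f \<noteq> 0"
  define N where "N = Suc (\<Sum>m\<in>keys f. sz m)"
  have lt: "fst m < N \<and> fst (snd m) < N \<and> snd (snd m) < N" if "m \<in> keys f" for m
  proof -
    have "sz m \<le> (\<Sum>m\<in>keys f. sz m)" using that by (intro member_le_sum) auto
    then show ?thesis by (simp add: N_def sz_def)
  qed
  define \<kappa> where "\<kappa> m = fst m + N * (fst (snd m) + N * snd (snd m))" for m :: mono3
  have inj: "inj_on \<kappa> (keys f)"
  proof (rule inj_onI)
    fix x y assume xy: "x \<in> keys f" "y \<in> keys f" "\<kappa> x = \<kappa> y"
    have "\<kappa> m mod N = fst m \<and> \<kappa> m div N mod N = fst (snd m) \<and> \<kappa> m div N div N = snd (snd m)" if "m \<in> keys f" for m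
      using lt[OF that] by (simp add: \<kappa>_def)
    from this[OF xy(1)] this[OF xy(2)] xy(3) show "x = y" by (simp add: prod_eq_iff)
  qed
  define P where "P = (\<Sum>m\<in>keys f. monom (lookup f m) (\<kappa> m))"
  have "poly P t = ev f (t, t ^ N, t ^ (N * N))" for t
    unfolding P_def ev_def poly_sum poly_monom
    by (intro sum.cong refl) (simp add: \<kappa>_def power_add power_mult algebra_simps)
  then have P0: "P = 0" using assms poly_all_0_iff_0[of P] by simp
  from nz obtain m where m: "m \<in> keys f" by (metis all_not_in_conv keys_eq_empty)
  have "coeff P (\<kappa> m) = (\<Sum>x\<in>keys f. if x = m then lookup f x else 0)"
    unfolding P_def coeff_sum coeff_monom
    by (intro sum.cong refl) (use inj m in \<open>auto dest: inj_onD\<close>)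
  then have "coeff P (\<kappa> m) = lookup f m" using m by simp
  then show False using P0 m by (simp add: in_keys_iff)
qed

lemma ev_inj: assumes "ev f = ev g" shows "f = g"
  using ev_eq_0_imp[of "f - g"] assms by (simp add: ev_diff)

section \<open>Total degree compared with weighted degree\<close>

definition tdeg_le :: "poly3 \<Rightarrow> nat \<Rightarrow> bool" where "tdeg_le f n \<longleftrightarrow> (\<forall>m\<in>keys f. sz m \<le> n)"

lemma poly3_le_ev: assumes "tdeg_le f n" shows "poly3_le (ev f) n"
proof -
  define S where "S = {..n} \<times> {..n} \<times> {..n}"
  have "keys f \<subseteq> S"
  proof
    fix m assume "m \<in> keys f"
    then have "sz m \<le> n" using assms by (simp add: tdeg_le_def)
    then show "m \<in> S" by (cases m) (auto simp: S_def sz_def)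
  qed
  then have e: "ev f (x, y, z) = (\<Sum>m\<in>S. lookup f m * x ^ fst m * y ^ fst (snd m) * z ^ snd (snd m))" for x y z
    using ev_superset[of S f "(x, y, z)"] by (simp add: S_def)
  have "ev f (x, y, z) = (\<Sum>i\<le>n. \<Sum>j\<le>n. \<Sum>k\<le>n. if i + j + k \<le> n then lookup f (i, j, k) * x ^ i * y ^ j * z ^ k else 0)" for x y z
  proof -
    have "ev f (x, y, z) = (\<Sum>i\<le>n. \<Sum>j\<le>n. \<Sum>k\<le>n. lookup f (i, j, k) * x ^ i * y ^ j * z ^ k)"
      unfolding e S_def by (simp add: sum.cartesian_product case_prod_beta)
    also have "\<dots> = (\<Sum>i\<le>n. \<Sum>j\<le>n. \<Sum>k\<le>n. if i + j + k \<le> n then lookup f (i, j, k) * x ^ i * y ^ j * z ^ k else 0)"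
    proof (intro sum.cong refl)
      fix i j k
      show "lookup f (i, j, k) * x ^ i * y ^ j * z ^ k
        = (if i + j + k \<le> n then lookup f (i, j, k) * x ^ i * y ^ j * z ^ k else 0)"
      proof (cases "(i, j, k) \<in> keys f")
        case True
        then show ?thesis using assms by (auto simp: tdeg_le_def sz_def)
      next
        case False
        then show ?thesis by (simp add: in_keys_iff)
      qed
    qed
    finally show ?thesis .
  qed
  then show ?thesis unfolding poly3_le_def by (intro exI[of _ "\<lambda>i j k. lookup f (i, j, k)"]) simp
qed

lemma poly3_le_imp_ev:
  assumes "poly3_le g n" obtains f where "g = ev f" "tdeg_le f n"
proof -
  from assms obtain c where c: "\<And>x y z. g (x, y, z) = (\<Sum>i\<le>n. \<Sum>j\<le>n. \<Sum>k\<le>n.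
        if i + j + k \<le> n then c i j k * x ^ i * y ^ j * z ^ k else 0)" unfolding poly3_le_def by blast
  define f where "f = (\<Sum>i\<le>n. \<Sum>j\<le>n. \<Sum>k\<le>n. if i + j + k \<le> n then single (i, j, k) (c i j k) else 0)"
  have "ev f (x, y, z) = g (x, y, z)" for x y z
    unfolding f_def c ev_sum by (intro sum.cong refl) (simp add: ev_single)
  then have "g = ev f" by (auto simp: fun_eq_iff)
  moreover have "tdeg_le f n"
  proof -
    have ad: "tdeg_le (a + b) n" if "tdeg_le a n" "tdeg_le b n" for a b
      using that keys_add[of a b] unfolding tdeg_le_def by blast
    have sm: "tdeg_le (\<Sum>x\<in>A. h x) n" if "\<And>x. x \<in> A \<Longrightarrow> tdeg_le (h x) n" for A and h :: "nat \<Rightarrow> poly3"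
      using that by (induction A rule: infinite_finite_induct) (simp_all add: ad, simp_all add: tdeg_le_def)
    show ?thesis unfolding f_def by (intro sm) (auto simp: tdeg_le_def sz_def)
  qed
  ultimately show thesis by (rule that)
qed

lemma poly3_le_ev_iff: "poly3_le (ev f) n \<longleftrightarrow> tdeg_le f n"
proof
  assume "poly3_le (ev f) n"
  then obtain g where "ev f = ev g" "tdeg_le g n" by (rule poly3_le_imp_ev)
  then show "tdeg_le f n" using ev_inj by blast
qed (rule poly3_le_ev)

lemma tdeg_le_exists: "\<exists>n. tdeg_le f n"
  unfolding tdeg_le_def using finite_nat_set_iff_bounded_le[of "sz ` keys f"] by auto

lemma deg3_ev: "tdeg_le f (deg3 (ev f))" "tdeg_le f n \<Longrightarrow> deg3 (ev f) \<le> n"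
proof -
  obtain n0 where "poly3_le (ev f) n0" using tdeg_le_exists poly3_le_ev by blast
  then have "poly3_le (ev f) (deg3 (ev f))" unfolding deg3_def by (rule LeastI)
  then show "tdeg_le f (deg3 (ev f))" by (simp add: poly3_le_ev_iff)
  show "tdeg_le f n \<Longrightarrow> deg3 (ev f) \<le> n" unfolding deg3_def by (intro Least_le poly3_le_ev)
qed

lemma deg3_attained: assumes "deg3 (ev f) > 0" shows "\<exists>m\<in>keys f. sz m = deg3 (ev f)"
proof (rule ccontr)
  assume n: "\<not> ?thesis"
  have "tdeg_le f (deg3 (ev f) - 1)" unfolding tdeg_le_def
  proof
    fix m assume m: "m \<in> keys f"
    then have "sz m \<le> deg3 (ev f)" using deg3_ev(1)[of f] by (simp add: tdeg_le_def)
    moreover have "sz m \<noteq> deg3 (ev f)" using n m by blast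
    ultimately show "sz m \<le> deg3 (ev f) - 1" by simp
  qed
  then show False using deg3_ev(2)[of f] assms by fastforce
qed

context weights
begin

lemma W_sz_bounds:
  assumes "1 \<le> w1" "1 \<le> w2" "1 \<le> w3" "w1 \<le> 1 + \<eta>" "w2 \<le> 1 + \<eta>" "w3 \<le> 1 + \<eta>"
  shows "real (sz m) \<le> W m" "W m \<le> real (sz m) * (1 + \<eta>)"
proof -
  have "real n \<le> real n * w \<and> real n * w \<le> real n * (1 + \<eta>)" if "1 \<le> w" "w \<le> 1 + \<eta>" for n w
    using mult_left_mono[of 1 w "real n"] mult_left_mono[of w "1 + \<eta>" "real n"] that by simp
  from this[OF assms(1,4), of "fst m"] this[OF assms(2,5), of "fst (snd m)"] this[OF assms(3,6), of "snd (snd m)"]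
  show "real (sz m) \<le> W m" "W m \<le> real (sz m) * (1 + \<eta>)"
    unfolding W_def sz_def by (auto simp: algebra_simps)
qed

text \<open>For weights close to 1 the leading monomial has maximal total degree.\<close>
lemma deg_deg3:
  assumes w: "1 \<le> w1" "1 \<le> w2" "1 \<le> w3" "w1 \<le> 1 + \<eta>" "w2 \<le> 1 + \<eta>" "w3 \<le> 1 + \<eta>"
    and N: "deg3 (ev f) > 0" "real (deg3 (ev f)) * \<eta> < 1"
  obtains m where "deg f = W m" "sz m = deg3 (ev f)"
proof -
  obtain m0 where m0: "m0 \<in> keys f" "sz m0 = deg3 (ev f)" using deg3_attained[OF N(1)] by blast
  then have "f \<noteq> 0" by auto
  then obtain m where m: "m \<in> keys f" "deg f = W m" using deg_attained by blast
  have le: "sz m \<le> deg3 (ev f)" using deg3_ev(1)[of f] m by (simp add: tdeg_le_def)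
  have "real (deg3 (ev f)) \<le> W m0" using W_sz_bounds(1)[OF w, of m0] m0 by simp
  also have "\<dots> \<le> W m" using deg_ge[OF m0(1)] m by simp
  also have "\<dots> \<le> real (sz m) * (1 + \<eta>)" by (rule W_sz_bounds(2)[OF w])
  finally have "real (deg3 (ev f)) \<le> real (sz m) + real (sz m) * \<eta>" by (simp add: algebra_simps)
  moreover have "real (sz m) * \<eta> < 1"
  proof (cases "\<eta> \<ge> 0")
    case True
    then have "real (sz m) * \<eta> \<le> real (deg3 (ev f)) * \<eta>" using le by (intro mult_right_mono) auto
    then show ?thesis using N by simp
  qed (use w in simp)
  ultimately have "deg3 (ev f) = sz m" using le by linarith
  then show thesis using that m by simp
qed

text \<open>By independence of the weights the relation holds for each exponent separately, hence
  for their sum.\<close>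

lemma W_lin_sz:
  assumes "real k * W a = real i * W b + real j * W c" shows "k * sz a = i * sz b + j * sz c"
proof -
  have "of_int (int (k * fst a) - int (i * fst b + j * fst c)) * w1
     + of_int (int (k * fst (snd a)) - int (i * fst (snd b) + j * fst (snd c))) * w2
     + of_int (int (k * snd (snd a)) - int (i * snd (snd b) + j * snd (snd c))) * w3 = 0"
    using assms by (simp add: W_def algebra_simps)
  from w_indep[OF this] have "int (k * fst a) = int (i * fst b + j * fst c)"
    "int (k * fst (snd a)) = int (i * fst (snd b) + j * fst (snd c))"
    "int (k * snd (snd a)) = int (i * snd (snd b) + j * snd (snd c))" by simp_all
  then have "k * fst a = i * fst b + j * fst c" "k * fst (snd a) = i * fst (snd b) + j * fst (snd c)"
    "k * snd (snd a) = i * snd (snd b) + j * snd (snd c)" unfolding of_nat_eq_iff by simp_all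
  then show ?thesis by (simp add: sz_def add_mult_distrib2)
qed

text \<open>Translates a lowering of h into arithmetic of total degrees. The constant 1 bounds
  \<open>dd f g\<close> from below, as all weights are at least 1.\<close>

lemma red_bound:
  assumes gt: "gt f g h" and r: "red f g h" and w: "1 \<le> w1" "1 \<le> w2" "1 \<le> w3"
    and m: "deg f = W a" "deg g = W b" "deg h = W c"
  shows "(\<exists>i j. sz c = i * sz a + j * sz b) \<or>
    (\<exists>p r. p \<ge> 1 \<and> p * sz a = r * sz b \<and> real p * deg f \<le> deg h + deg f + deg g - 1)"
proof -
  note d = gt_degs[OF gt]
  from r obtain h' where h': "nb f g h h'" "deg h' < deg h" unfolding red_def by blast
  obtain k q where q: "q \<in> alg f g" "deg q = deg h" by (rule nb_dec[OF h'])
  show ?thesis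
  proof (cases "nonc f g q")
    case True
    then obtain i j where "deg h = real i * deg f + real j * deg g" using nonc_degree q by metis
    then have "real 1 * W c = real i * W a + real j * W b" using m by simp
    then have "1 * sz c = i * sz a + j * sz b" by (rule W_lin_sz)
    then show ?thesis by (intro disjI1 exI[of _ i] exI[of _ j]) simp
  next
    case False
    obtain p r where P: "p \<ge> 1" "real p * deg f = real r * deg g" "real p * deg f \<le> deg h + deg f + deg g - dd f g"
      using cancel_bound[OF d(7,1,2) q(1) False] q(2) by metis
    have "dd f g \<ge> 1" by (rule dd_lower[OF d(7) w]) simp
    moreover have "p * sz a = r * sz b + 0 * sz b" by (rule W_lin_sz) (use P m in simp)
    ultimately show ?thesis using P by (intro disjI2 exI[of _ p] exI[of _ r]) auto
  qed
qed

text \<open>As 3, p and d are pairwise coprime, a relation between two leading monomials has degree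
  at least 3p, 3d or pd, too much for \<open>red_bound\<close>; and none of the three numbers is a
  combination of the other two. A centre would make 2d a multiple of 3 or of p, or would need 4p = 9
  or p = 4.\<close>

lemma deg_3_p_d_not_A:
  fixes p d :: nat
  assumes w: "1 \<le> w1" "1 \<le> w2" "1 \<le> w3" "w1 \<le> 1 + \<eta>" "w2 \<le> 1 + \<eta>" "w3 \<le> 1 + \<eta>"
    and \<eta>: "\<eta> \<ge> 0" "real d * \<eta> \<le> 1 / 100"
    and p: "prime p" "p > 3" and k: "d + 3 * k = 2 * p" "k \<ge> 1" "d \<ge> p"
    and m: "deg f1 = W m1" "sz m1 = 3" "deg f2 = W m2" "sz m2 = p" "deg f3 = W m3" "sz m3 = d"
  shows "\<not> A {#f1, f2, f3#}"
proof
  assume A: "A {#f1, f2, f3#}"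
  have gt: "gt f1 f2 f3" by (rule A_gt[OF A refl])
  have p3: "\<not> 3 dvd p" using p by (auto simp: prime_nat_iff)
  have d3: "\<not> 3 dvd d"
  proof
    assume "3 dvd d"
    then have "3 dvd 2 * p" using k(1) by (metis dvd_add dvd_triv_left)
    then have "3 dvd p" using coprime_dvd_mult_right_iff[of 3 2 p] by (simp add: coprime_iff_gcd_eq_1 gcd_non_0_nat)
    then show False using p3 by blast
  qed
  have dp: "d \<noteq> p" "d > p" "d < 2 * p"
  proof -
    show "d \<noteq> p"
    proof
      assume "d = p"
      then have "p = 3 * k" using k(1) by simp
      then show False using p3 by simp
    qed
    then show "d > p" using k(3) by simp
    show "d < 2 * p" using k by simp
  qed
  have d2: "d \<le> 2 * p - 3" using k(1,2) by linarith
  have pd: "\<not> p dvd d"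
  proof
    assume "p dvd d"
    then obtain q where q: "d = p * q" by blast
    then have "q > 1" "q < 2" using dp p by auto
    then show False by simp
  qed
  have cpd: "coprime p d" using p(1) pd by (simp add: prime_imp_coprime)
  have pr3: "prime (3::nat)" by simp
  have cp3: "coprime 3 p" "coprime 3 d" using prime_imp_coprime[of "3::nat" p] prime_imp_coprime[of "3::nat" d] p3 d3 pr3
      by simp_all
  have nd: "real n * \<eta> \<le> 1 / 100" if "n \<le> d" for n
  proof -
    have "real n * \<eta> \<le> real d * \<eta>" using that \<eta> by (intro mult_right_mono) auto
    then show ?thesis using \<eta> by simp
  qed
  have bd: "real n \<le> deg f \<and> deg f \<le> real n + 1 / 100" if "deg f = W a" "sz a = n" "n \<le> d" for f a n
    using W_sz_bounds[OF w, of a] nd[OF that(3)] that by (simp add: algebra_simps)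
  have b1: "3 \<le> deg f1" "deg f1 \<le> 3 + 1/100" using bd[OF m(1,2)] dp p by auto
  have b2: "real p \<le> deg f2" "deg f2 \<le> real p + 1/100" using bd[OF m(3,4)] dp by auto
  have b3: "real d \<le> deg f3" "deg f3 \<le> real d + 1/100" using bd[OF m(5,6)] by auto
  have rp: "real p > 3" "real d \<ge> real p + 1" "real d \<le> 2 * real p - 3" using p dp d2 by linarith+
  have mx: "deg f1 < deg f3" "deg f2 < deg f3" using b1 b2 b3 rp by linarith+
  from A show False
  proof (cases rule: A_cases3)
    case base
    then have "deg f1 \<in> {w1, w2, w3}" unfolding mset3_eq by auto
    moreover have "\<eta> \<le> 1 / 100" using nd[of 1] dp p by simp
    ultimately show False using w b1 by auto
  next
    case e3
    from red_bound[OF gt e3 w(1-3) m(1,3,5)] show False unfolding m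
    proof
      assume "\<exists>i j. d = i * 3 + j * p"
      then obtain i j where ij: "d = i * 3 + j * p" by blast
      consider "j = 0" | "j = 1" | "j \<ge> 2" by linarith
      then show False
      proof cases
        case 1 then show False using ij d3 by simp
      next
        case 2
        then have "p = 3 * (i + k)" using ij k(1) by simp
        then show False using p3 by simp
      next
        case 3
        then have "2 * p \<le> j * p" by simp
        then show False using ij dp by linarith
      qed
    next
      assume "\<exists>q r. q \<ge> 1 \<and> q * 3 = r * p \<and> real q * W m1 \<le> W m3 + W m1 + W m2 - 1"
      then obtain q r where q: "q \<ge> 1" "q * 3 = r * p" "real q * W m1 \<le> W m3 + W m1 + W m2 - 1" by blast
      have "p dvd 3 * q" using q(2) by (metis dvd_triv_right mult.commute)
      then have "p dvd q" using cp3(1) by (simp add: coprime_dvd_mult_right_iff coprime_commute)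
      then have "p \<le> q" using q(1) by (auto dest: dvd_imp_le)
      \<comment> \<open>The tight case: as d is at most 2p - 3, the bound d + 3 + p - 1 is at most
        3p - 1, and the weights add an error of at most 3/100.\<close>
      then have "real p * 3 \<le> real q * W m1" using b1 m by (intro mult_mono) auto
      then show False using q(3) b1 b2 b3 rp m by linarith
    qed
  next
    case e1
    have gt': "gt f2 f3 f1" using gt gt_perm by blast
    from red_bound[OF gt' e1 w(1-3) m(3,5,1)] show False unfolding m
    proof
      assume "\<exists>i j. 3 = i * p + j * d"
      then obtain i j where ij: "3 = i * p + j * d" by blast
      have "i = 0"
      proof (rule ccontr)
        assume "i \<noteq> 0"
        then have "p \<le> i * p" by simp
        then show False using ij p by linarith
      qed
      moreover have "j = 0"
      proof (rule ccontr)
        assume "j \<noteq> 0"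
        then have "d \<le> j * d" by simp
        then show False using ij p dp by linarith
      qed
      ultimately show False using ij by simp
    next
      assume "\<exists>q r. q \<ge> 1 \<and> q * p = r * d \<and> real q * W m2 \<le> W m1 + W m2 + W m3 - 1"
      then obtain q r where q: "q \<ge> 1" "q * p = r * d" "real q * W m2 \<le> W m1 + W m2 + W m3 - 1" by blast
      have "d dvd q * p" using q(2) by simp
      then have "d dvd q" using cpd by (simp add: coprime_dvd_mult_left_iff coprime_commute)
      then have "d \<le> q" using q(1) by (auto dest: dvd_imp_le)
      then have "real d * real p \<le> real q * W m2" using b2 m by (intro mult_mono) auto
      moreover have "real d * 4 \<le> real d * real p" using p by (intro mult_left_mono) auto
      ultimately show False using q(3) b1 b2 b3 rp m by linarith
    qed
  next
    case e2
    have gt': "gt f1 f3 f2" using gt gt_perm by blast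
    from red_bound[OF gt' e2 w(1-3) m(1,5,3)] show False unfolding m
    proof
      assume "\<exists>i j. p = i * 3 + j * d"
      then obtain i j where ij: "p = i * 3 + j * d" by blast
      have "j = 0"
      proof (rule ccontr)
        assume "j \<noteq> 0"
        then have "d \<le> j * d" by simp
        then show False using ij dp by linarith
      qed
      then show False using ij p3 by simp
    next
      assume "\<exists>q r. q \<ge> 1 \<and> q * 3 = r * d \<and> real q * W m1 \<le> W m2 + W m1 + W m3 - 1"
      then obtain q r where q: "q \<ge> 1" "q * 3 = r * d" "real q * W m1 \<le> W m2 + W m1 + W m3 - 1" by blast
      have "d dvd 3 * q" using q(2) by (metis dvd_triv_right mult.commute)
      then have "d dvd q" using cp3(2) by (simp add: coprime_dvd_mult_right_iff coprime_commute)
      then have "d \<le> q" using q(1) by (auto dest: dvd_imp_le)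
      then have "real d * 3 \<le> real q * W m1" using b1 m by (intro mult_mono) auto
      then show False using q(3) b1 b2 b3 rp m by linarith
    qed
  next
    case (K g1 g2 x1 x2 x3 a b c)
    note kc = Kcen_facts[OF K(2)] and fc = Kf_facts[OF K(2,3)]
    from K(2) obtain s where s: "odd s" "2 * deg g1 = real s * deg g2" unfolding Kcen_def by blast
    from K(1) have x: "x1 = f3 \<and> (x2 = f1 \<and> x3 = f2 \<or> x2 = f2 \<and> x3 = f1)"
      using mx fc(9,10) unfolding mset3_eq by (metis less_asym)
    show False
    proof (cases "deg x1 = deg g1")
      case True
      then have e: "real 2 * deg f3 = real s * deg x2 + real 0 * deg x2" using s fc(4) x by simp
      from x show False
      proof (elim conjE disjE)
        assume "x2 = f1"
        then have "2 * d = s * 3" using W_lin_sz[of 2 m3 s m1 0 m1] e m by simp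
        then have "3 dvd 2 * d" by simp
        then have "3 dvd d" using coprime_dvd_mult_right_iff[of 3 2 d] by (simp add: coprime_iff_gcd_eq_1 gcd_non_0_nat)
        then show False using d3 by blast
      next
        assume "x2 = f2"
        then have "2 * d = s * p" using W_lin_sz[of 2 m3 s m2 0 m2] e m by simp
        then have "p dvd 2 * d" by simp
        moreover have "coprime p 2" using p prime_imp_coprime[of p 2] by (auto dest: dvd_imp_le)
        ultimately have "p dvd d" by (simp add: coprime_dvd_mult_right_iff)
        then show False using pd by blast
      qed
    next
      case False
      then have "2 * deg x3 = deg g1" "2 * deg g1 = 3 * deg g2" using fc(7) by auto
      then have e: "real 4 * deg x3 = real 3 * deg x2 + real 0 * deg x2" using fc(4) by simp
      from x show False
      proof (elim conjE disjE)
        assume "x2 = f1" "x3 = f2"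
        then have "4 * p = 3 * 3" using W_lin_sz[of 4 m2 3 m1 0 m1] e m by simp
        then show False by presburger
      next
        assume "x2 = f2" "x3 = f1"
        then have "4 * 3 = 3 * p" using W_lin_sz[of 4 m1 3 m2 0 m2] e m by simp
        then have "p = 4" by simp
        then show False using prime_odd_nat[OF p(1)] p(2) by simp
      qed
    qed
  qed
qed


section \<open>Tame automorphisms\<close>

text \<open>Multidegrees refer to functions, whereas \<open>A\<close> speaks of formal polynomials;
  \<open>ev\<close> connects the two and is injective.\<close>

definition A_fun :: "(pt3 \<Rightarrow> complex) \<Rightarrow> (pt3 \<Rightarrow> complex) \<Rightarrow> (pt3 \<Rightarrow> complex) \<Rightarrow> bool" where
  "A_fun a b c \<longleftrightarrow> (\<exists>f g h. a = ev f \<and> b = ev g \<and> c = ev h \<and> A {#f, g, h#})"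

lemma A_fun_perm: "A_fun a b c \<Longrightarrow> A_fun b a c" "A_fun a b c \<Longrightarrow> A_fun a c b"
proof -
  assume "A_fun a b c"
  then obtain f g h where f: "a = ev f" "b = ev g" "c = ev h" "A {#f, g, h#}" unfolding A_fun_def by blast
  have "A {#g, f, h#}" "A {#f, h, g#}" using f(4) mset_perms(1,2) by metis+
  then show "A_fun b a c" "A_fun a c b" using f unfolding A_fun_def by blast+
qed

lemma A_fun_perms: "A_fun a b c \<longleftrightarrow> A_fun b a c" "A_fun a b c \<longleftrightarrow> A_fun a c b" "A_fun a b c \<longleftrightarrow> A_fun c b a"
  using A_fun_perm by blast+

lemma A_fun_step_imp:
  assumes "A_fun a b c" "k \<noteq> 0" "finite S"
  shows "A_fun a b (\<lambda>v. k * c v + (\<Sum>p\<in>S. q p * a v ^ fst p * b v ^ snd p))"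
proof -
  from assms(1) obtain f g h where f: "a = ev f" "b = ev g" "c = ev h" "A {#f, g, h#}" unfolding A_fun_def by blast
  define r where "r = (\<Sum>p\<in>S. C (q p) * f ^ fst p * g ^ snd p)"
  have "r \<in> alg f g" unfolding alg_def r_def using assms(3) by blast
  then have "A {#f, g, C k * h + r#}" using A_closed[OF f(4)] nbI assms(2) by blast
  moreover have "(\<lambda>v. k * c v + (\<Sum>p\<in>S. q p * a v ^ fst p * b v ^ snd p)) = ev (C k * h + r)"
    by (rule ext) (simp add: r_def f ev_add ev_mult ev_sum ev_power)
  ultimately show ?thesis unfolding A_fun_def using f(1,2) by blast
qed

text \<open>The inverse transformation has the same form, with scalar 1 / k and coefficients - q /
  k.\<close>

lemma A_fun_step:
  assumes "k \<noteq> 0" "finite S"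
  shows "A_fun a b (\<lambda>v. k * c v + (\<Sum>p\<in>S. q p * a v ^ fst p * b v ^ snd p)) \<longleftrightarrow> A_fun a b c"
proof
  assume *: "A_fun a b (\<lambda>v. k * c v + (\<Sum>p\<in>S. q p * a v ^ fst p * b v ^ snd p))"
  have "A_fun a b (\<lambda>v. (1 / k) * (k * c v + (\<Sum>p\<in>S. q p * a v ^ fst p * b v ^ snd p))
      + (\<Sum>p\<in>S. (- q p / k) * a v ^ fst p * b v ^ snd p))"
    by (rule A_fun_step_imp[OF *]) (use assms in auto)
  moreover have "(1 / k) * (k * c v + (\<Sum>p\<in>S. q p * a v ^ fst p * b v ^ snd p))
      + (\<Sum>p\<in>S. (- q p / k) * a v ^ fst p * b v ^ snd p) = c v" for v
  proof -
    have "(\<Sum>p\<in>S. (- q p / k) * a v ^ fst p * b v ^ snd p) = - (1 / k) * (\<Sum>p\<in>S. q p * a v ^ fst p * b v ^ snd p)"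
      unfolding sum_distrib_left by (intro sum.cong refl) simp
    then show ?thesis using assms(1) by (simp add: distrib_left)
  qed
  ultimately show "A_fun a b c" by simp
qed (rule A_fun_step_imp[OF _ assms])

lemma A_fun_lin:
  assumes "\<gamma> \<noteq> 0"
  shows "A_fun a b (\<lambda>v. \<alpha> * a v + \<beta> * b v + \<gamma> * c v + \<delta>) \<longleftrightarrow> A_fun a b c"
proof -
  define q where "q p = (if p = (1, 0) then \<alpha> else if p = (0, 1) then \<beta> else \<delta>)" for p :: "nat \<times> nat"
  have "(\<Sum>p\<in>{(1, 0), (0, 1), (0, 0)}. q p * x ^ fst p * y ^ snd p) = \<alpha> * x + \<beta> * y + \<delta>" for x y
    by (simp add: q_def)
  then show ?thesis using A_fun_step[OF assms, of "{(1, 0), (0, 1), (0, 0)}" a b c q] by (simp add: algebra_simps)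
qed

text \<open>Gaussian elimination; surjectivity provides the pivots.\<close>
lemma A_fun_aff_pivots:
  fixes a1 b1 c1 d1 a2 b2 c2 d2 a3 b3 c3 d3 :: complex
  assumes sj: "\<And>u v w. \<exists>x y z. a1 * x + b1 * y + c1 * z + d1 = u \<and> a2 * x + b2 * y + c2 * z + d2 = v \<and> a3 * x + b3 * y + c3 * z + d3 = w"
    and p: "a1 \<noteq> 0" "b2 - a2 / a1 * b1 \<noteq> 0"
  shows "A_fun (\<lambda>t. a1 * x t + b1 * y t + c1 * z t + d1) (\<lambda>t. a2 * x t + b2 * y t + c2 * z t + d2)
      (\<lambda>t. a3 * x t + b3 * y t + c3 * z t + d3) \<longleftrightarrow> A_fun x y z"
proof -
  define L1 where "L1 t = a1 * x t + b1 * y t + c1 * z t + d1" for t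
  define m2 where "m2 = a2 / a1"
  define B2 where "B2 = b2 - m2 * b1"
  define C2 where "C2 = c2 - m2 * c1"
  define D2 where "D2 = d2 - m2 * d1"
  define L2 where "L2 t = m2 * L1 t + B2 * y t + C2 * z t + D2" for t
  have a2: "a2 = m2 * a1" using p by (simp add: m2_def)
  have L2: "(\<lambda>t. a2 * x t + b2 * y t + c2 * z t + d2) = L2"
    by (rule ext) (simp add: L2_def L1_def B2_def C2_def D2_def a2 algebra_simps)
  define m3 where "m3 = a3 / a1"
  define n3 where "n3 = (b3 - m3 * b1) / B2"
  define C3 where "C3 = c3 - m3 * c1 - n3 * C2"
  define D3 where "D3 = d3 - m3 * d1 - n3 * D2"
  have B2: "B2 \<noteq> 0" using p by (simp add: B2_def m2_def)
  have a3: "a3 = m3 * a1" using p by (simp add: m3_def)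
  have b3: "b3 = m3 * b1 + n3 * B2" using B2 by (simp add: n3_def)
  have id3: "a3 * X + b3 * Y + c3 * Z + d3
      = m3 * (a1 * X + b1 * Y + c1 * Z + d1) + n3 * (a2 * X + b2 * Y + c2 * Z + d2 - m2 * (a1 * X + b1 * Y + c1 * Z + d1)) + C3 * Z + D3" for X Y Z
    unfolding a3 b3 C3_def D3_def B2_def C2_def D2_def a2 by (simp add: algebra_simps)
  have L3: "(\<lambda>t. a3 * x t + b3 * y t + c3 * z t + d3) = (\<lambda>t. (m3 - n3 * m2) * L1 t + n3 * L2 t + C3 * z t + D3)"
    unfolding L2[symmetric] unfolding id3 L1_def by (rule ext) (simp add: algebra_simps)
  have C3: "C3 \<noteq> 0"
  proof
    assume z: "C3 = 0"
    obtain X Y Z where *: "a1 * X + b1 * Y + c1 * Z + d1 = 0" "a2 * X + b2 * Y + c2 * Z + d2 = 0" "a3 * X + b3 * Y + c3 * Z + d3 = D3 + 1"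
      using sj[of 0 0 "D3 + 1"] by blast
    show False using id3[of X Y Z] unfolding * z by simp
  qed
  have "A_fun L1 L2 (\<lambda>t. (m3 - n3 * m2) * L1 t + n3 * L2 t + C3 * z t + D3) \<longleftrightarrow> A_fun L1 L2 z"
    by (rule A_fun_lin[OF C3])
  also have "\<dots> \<longleftrightarrow> A_fun L1 z L2" by (rule A_fun_perms(2))
  also have "A_fun L1 z L2 \<longleftrightarrow> A_fun L1 z (\<lambda>t. m2 * L1 t + C2 * z t + B2 * y t + D2)"
    by (simp add: L2_def[abs_def] algebra_simps)
  also have "\<dots> \<longleftrightarrow> A_fun L1 z y" by (rule A_fun_lin[OF B2])
  also have "\<dots> \<longleftrightarrow> A_fun y z L1" using A_fun_perms(1,3) by blast
  also have "\<dots> \<longleftrightarrow> A_fun y z (\<lambda>t. b1 * y t + c1 * z t + a1 * x t + d1)"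
    by (simp add: L1_def[abs_def] algebra_simps)
  also have "\<dots> \<longleftrightarrow> A_fun y z x" by (rule A_fun_lin[OF p(1)])
  also have "\<dots> \<longleftrightarrow> A_fun x y z" using A_fun_perms by blast
  finally show ?thesis unfolding L2 L3 L1_def[abs_def, symmetric] .
qed

lemma A_fun_aff_pivot1:
  fixes a1 b1 c1 d1 a2 b2 c2 d2 a3 b3 c3 d3 :: complex
  assumes sj: "\<And>u v w. \<exists>x y z. a1 * x + b1 * y + c1 * z + d1 = u \<and> a2 * x + b2 * y + c2 * z + d2 = v \<and> a3 * x + b3 * y + c3 * z + d3 = w"
    and p: "a1 \<noteq> 0"
  shows "A_fun (\<lambda>t. a1 * x t + b1 * y t + c1 * z t + d1) (\<lambda>t. a2 * x t + b2 * y t + c2 * z t + d2)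
      (\<lambda>t. a3 * x t + b3 * y t + c3 * z t + d3) \<longleftrightarrow> A_fun x y z"
proof (cases "b2 - a2 / a1 * b1 = 0")
  case False
  then show ?thesis by (rule A_fun_aff_pivots[OF sj p])
next
  case b: True
  \<comment> \<open>If both candidates for a second pivot vanished, the second component would be a
    function of the first, against surjectivity.\<close>
  have c: "c2 - a2 / a1 * c1 \<noteq> 0"
  proof
    assume c: "c2 - a2 / a1 * c1 = 0"
    define m where "m = a2 / a1"
    have e: "a2 = m * a1" "b2 = m * b1" "c2 = m * c1" using p b c by (simp_all add: m_def)
    have id2: "a2 * X + b2 * Y + c2 * Z + d2 = m * (a1 * X + b1 * Y + c1 * Z + d1) + (d2 - m * d1)" for X Y Z
      by (simp add: e algebra_simps)
    obtain X Y Z where *: "a1 * X + b1 * Y + c1 * Z + d1 = 0" "a2 * X + b2 * Y + c2 * Z + d2 = d2 - m * d1 + 1"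
      using sj[of 0 "d2 - m * d1 + 1" 0] by blast
    show False using id2[of X Y Z] unfolding * by simp
  qed
  have sj': "\<exists>x y z. a1 * x + c1 * y + b1 * z + d1 = u \<and> a2 * x + c2 * y + b2 * z + d2 = v \<and> a3 * x + c3 * y + b3 * z + d3 = w" for u v w
  proof -
    obtain x y z where "a1 * x + b1 * y + c1 * z + d1 = u" "a2 * x + b2 * y + c2 * z + d2 = v" "a3 * x + b3 * y + c3 * z + d3 = w"
      using sj by blast
    then show ?thesis by (intro exI[of _ x] exI[of _ z] exI[of _ y]) (simp add: algebra_simps)
  qed
  have sw: "(\<lambda>t. a * x t + b * y t + c * z t + d) = (\<lambda>t. a * x t + c * z t + b * y t + d)" for a b c d
    by (simp add: algebra_simps)
  show ?thesis unfolding sw using A_fun_aff_pivots[OF sj' p c] A_fun_perms(2) by blast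
qed

lemma A_fun_aff:
  fixes a1 b1 c1 d1 a2 b2 c2 d2 a3 b3 c3 d3 :: complex
  assumes sj: "\<And>u v w. \<exists>x y z. a1 * x + b1 * y + c1 * z + d1 = u \<and> a2 * x + b2 * y + c2 * z + d2 = v \<and> a3 * x + b3 * y + c3 * z + d3 = w"
  shows "A_fun (\<lambda>t. a1 * x t + b1 * y t + c1 * z t + d1) (\<lambda>t. a2 * x t + b2 * y t + c2 * z t + d2)
      (\<lambda>t. a3 * x t + b3 * y t + c3 * z t + d3) \<longleftrightarrow> A_fun x y z"
proof -
  have "a1 \<noteq> 0 \<or> b1 \<noteq> 0 \<or> c1 \<noteq> 0"
  proof (rule ccontr)
    assume "\<not> ?thesis"
    then have "a1 = 0" "b1 = 0" "c1 = 0" by auto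
    then show False using sj[of "d1 + 1" 0 0] by simp
  qed
  then consider "a1 \<noteq> 0" | "b1 \<noteq> 0" | "c1 \<noteq> 0" by blast
  then show ?thesis
  proof cases
    case 1 then show ?thesis by (rule A_fun_aff_pivot1[OF sj])
  next
    case 2
    have sj': "\<exists>x y z. b1 * x + a1 * y + c1 * z + d1 = u \<and> b2 * x + a2 * y + c2 * z + d2 = v \<and> b3 * x + a3 * y + c3 * z + d3 = w" for u v w
    proof -
      obtain x y z where "a1 * x + b1 * y + c1 * z + d1 = u" "a2 * x + b2 * y + c2 * z + d2 = v" "a3 * x + b3 * y + c3 * z + d3 = w"
        using sj by blast
      then show ?thesis by (intro exI[of _ y] exI[of _ x] exI[of _ z]) (simp add: algebra_simps)
    qed
    have sw: "(\<lambda>t. a * x t + b * y t + c * z t + d) = (\<lambda>t. b * y t + a * x t + c * z t + d)" for a b c d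
      by (simp add: algebra_simps)
    show ?thesis unfolding sw using A_fun_aff_pivot1[OF sj' 2] A_fun_perms(1) by blast
  next
    case 3
    have sj': "\<exists>x y z. c1 * x + b1 * y + a1 * z + d1 = u \<and> c2 * x + b2 * y + a2 * z + d2 = v \<and> c3 * x + b3 * y + a3 * z + d3 = w" for u v w
    proof -
      obtain x y z where "a1 * x + b1 * y + c1 * z + d1 = u" "a2 * x + b2 * y + c2 * z + d2 = v" "a3 * x + b3 * y + c3 * z + d3 = w"
        using sj by blast
      then show ?thesis by (intro exI[of _ z] exI[of _ y] exI[of _ x]) (simp add: algebra_simps)
    qed
    have sw: "(\<lambda>t. a * x t + b * y t + c * z t + d) = (\<lambda>t. c * z t + b * y t + a * x t + d)" for a b c d
      by (simp add: algebra_simps)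
    show ?thesis unfolding sw using A_fun_aff_pivot1[OF sj' 3] A_fun_perms(3) by blast
  qed
qed

definition A_map :: "map3 \<Rightarrow> bool" where
  "A_map G \<longleftrightarrow> A_fun (\<lambda>v. fst (G v)) (\<lambda>v. fst (snd (G v))) (\<lambda>v. snd (snd (G v)))"

lemma A_map_affine:
  assumes "affine_aut F" shows "A_map (F \<circ> G) \<longleftrightarrow> A_map G"
proof -
  from assms obtain a :: "nat \<Rightarrow> nat \<Rightarrow> complex" and b where bj: "bij F" and F: "\<And>x y z. F (x, y, z) =
       (a 0 0 * x + a 0 1 * y + a 0 2 * z + b 0,
        a 1 0 * x + a 1 1 * y + a 1 2 * z + b 1,
        a 2 0 * x + a 2 1 * y + a 2 2 * z + b (2::nat))" unfolding affine_aut_def by blast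
  have sj: "\<exists>x y z. a 0 0 * x + a 0 1 * y + a 0 2 * z + b 0 = u \<and> a 1 0 * x + a 1 1 * y + a 1 2 * z + b 1 = v
     \<and> a 2 0 * x + a 2 1 * y + a 2 2 * z + b 2 = w" for u v w
  proof -
    obtain p where "F p = (u, v, w)" using bj by (metis bij_pointE)
    then show ?thesis using F[of "fst p" "fst (snd p)" "snd (snd p)"] by auto
  qed
  have "F (G v) = F (fst (G v), fst (snd (G v)), snd (snd (G v)))" for v by simp
  then show ?thesis unfolding A_map_def o_def F using A_fun_aff[OF sj] by (simp add: F)
qed

lemma triangular_bij: assumes "triangular_aut F" shows "bij F"
proof -
  from assms obtain f2 n c where F: "\<And>x y z. F (x, y, z) =
       (x, y + poly f2 x, z + (\<Sum>i\<le>n. \<Sum>j\<le>n. c i j * x ^ i * y ^ j))" unfolding triangular_aut_def by blast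
  show ?thesis
  proof (rule bijI)
    show "inj F"
    proof (rule injI)
      fix p q assume "F p = F q"
      then show "p = q" by (cases p; cases q) (auto simp: F)
    qed
    show "surj F"
    proof (rule surjI)
      fix p :: pt3
      obtain u v w where p: "p = (u, v, w)" by (cases p)
      show "F ((\<lambda>(u, v, w). (u, v - poly f2 u, w - (\<Sum>i\<le>n. \<Sum>j\<le>n. c i j * u ^ i * (v - poly f2 u) ^ j))) p) = p"
        by (simp add: p F)
    qed
  qed
qed

lemma A_map_triangular:
  assumes "triangular_aut F" shows "A_map (F \<circ> G) \<longleftrightarrow> A_map G"
proof -
  from assms obtain f2 n c where F: "\<And>x y z. F (x, y, z) =
       (x, y + poly f2 x, z + (\<Sum>i\<le>n. \<Sum>j\<le>n. c i j * x ^ i * y ^ j))" unfolding triangular_aut_def by blast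
  define x y z where "x v = fst (G v)" and "y v = fst (snd (G v))" and "z v = snd (snd (G v))" for v
  have G: "G v = (x v, y v, z v)" for v by (simp add: x_def y_def z_def)
  \<comment> \<open>The third component is computed from the old second one, so it is treated first;
    then the second changes while x and the new third component stay fixed.\<close>
  have s1: "A_fun x y (\<lambda>v. z v + (\<Sum>i\<le>n. \<Sum>j\<le>n. c i j * x v ^ i * y v ^ j)) \<longleftrightarrow> A_fun x y z"
    using A_fun_step[of 1 "{..n} \<times> {..n}" x y z "\<lambda>p. c (fst p) (snd p)"]
    by (simp add: sum.cartesian_product case_prod_beta)
  define z' where "z' v = z v + (\<Sum>i\<le>n. \<Sum>j\<le>n. c i j * x v ^ i * y v ^ j)" for v
  have s2: "A_fun x z' (\<lambda>v. y v + poly f2 (x v)) \<longleftrightarrow> A_fun x z' y"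
  proof -
    have "(\<Sum>p\<in>{..degree f2} \<times> {0}. coeff f2 (fst p) * x v ^ fst p * z' v ^ snd p) = poly f2 (x v)" for v
    proof -
      have e: "{..degree f2} \<times> {0::nat} = (\<lambda>i. (i, 0)) ` {..degree f2}" by auto
      have "(\<Sum>p\<in>{..degree f2} \<times> {0}. coeff f2 (fst p) * x v ^ fst p * z' v ^ snd p)
          = (\<Sum>i\<le>degree f2. coeff f2 i * x v ^ i)"
        unfolding e by (subst sum.reindex) (auto simp: inj_on_def)
      then show ?thesis by (simp only: poly_altdef)
    qed
    then show ?thesis using A_fun_step[of 1 "{..degree f2} \<times> {0}" x z' y "\<lambda>p. coeff f2 (fst p)"] by simp
  qed
  have "A_map (F \<circ> G) \<longleftrightarrow> A_fun x (\<lambda>v. y v + poly f2 (x v)) z'"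
    by (simp add: A_map_def F G z'_def[abs_def])
  also have "\<dots> \<longleftrightarrow> A_fun x y z'" using s2 A_fun_perms(2) by blast
  also have "\<dots> \<longleftrightarrow> A_fun x y z" using s1 by (simp add: z'_def[abs_def])
  also have "\<dots> \<longleftrightarrow> A_map G" by (simp add: A_map_def G)
  finally show ?thesis .
qed

text \<open>An equivalence, quantified over all maps G, passes to compositions and to inverses.
  Bijectivity is carried along so that F cancels against its inverse.\<close>

lemma Tame3_A_map_iff: "F \<in> Tame3 \<Longrightarrow> bij F \<and> (\<forall>G. A_map (F \<circ> G) \<longleftrightarrow> A_map G)"
proof (induction rule: Tame3.induct)
  case (aff F)
  then have "bij F" unfolding affine_aut_def by blast
  then show ?case using A_map_affine[OF aff] by blast
next
  case (tri F)
  then show ?case using A_map_triangular[OF tri] triangular_bij[OF tri] by blast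
next
  case (comp F G)
  then show ?case using bij_comp by (metis comp_assoc)
next
  case (inv F)
  have "A_map (Hilbert_Choice.inv F \<circ> G) \<longleftrightarrow> A_map G" for G
  proof -
    have "F \<circ> (Hilbert_Choice.inv F \<circ> G) = G" using inv by (auto simp: fun_eq_iff bij_is_surj surj_f_inv_f)
    then show ?thesis using inv by metis
  qed
  then show ?case using inv bij_imp_bij_inv by blast
qed

lemma A_variables: "A {#single (1, 0, 0) 1, single (0, 1, 0) 1, single (0, 0, 1) 1#}"
proof (rule base)
  show "gt (single (1, 0, 0) 1) (single (0, 1, 0) 1) (single (0, 0, 1) 1)"
    unfolding gt_def by (rule exI[of _ 1]) (simp add: jac_def D_single ex_def mult_single)
qed (simp_all add: deg_single W_def)

lemma Tame3_A_map: assumes "F \<in> Tame3" shows "A_map F"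
proof -
  have "A_map id" unfolding A_map_def A_fun_def
    by (rule exI[of _ "single (1, 0, 0) 1"], rule exI[of _ "single (0, 1, 0) 1"], rule exI[of _ "single (0, 0, 1) 1"])
       (simp add: A_variables[simplified] fun_eq_iff ev_single)
  then show ?thesis using Tame3_A_map_iff[OF assms] by (metis comp_id)
qed

end

section \<open>Rationally independent weights close to 1\<close>

lemma square_eq_imp_0:
  fixes x y n q :: nat
  assumes "prime q" "multiplicity q n = 1" "x\<^sup>2 = n * y\<^sup>2"
  shows "y = 0"
proof (rule ccontr)
  assume y: "y \<noteq> 0"
  have n: "n \<noteq> 0" using assms(2) by (metis multiplicity_zero zero_neq_one)
  then have x: "x \<noteq> 0" using assms(3) y by (metis no_zero_divisors power_eq_0_iff zero_neq_numeral power_zero_numeral)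
  have q: "prime_elem q" using assms(1) by simp
  have "2 * multiplicity q x = multiplicity q (x\<^sup>2)"
    using prime_elem_multiplicity_power_distrib[OF q x, of 2] by simp
  also have "\<dots> = 1 + 2 * multiplicity q y"
    unfolding assms(3) using prime_elem_multiplicity_mult_distrib[OF q n, of "y\<^sup>2"]
      prime_elem_multiplicity_power_distrib[OF q y, of 2] y assms(2) by simp
  finally show False by presburger
qed

lemma square_eq_imp_0_int:
  fixes x y :: int and n q :: nat
  assumes "prime q" "multiplicity q n = 1" "x\<^sup>2 = int n * y\<^sup>2"
  shows "y = 0"
proof -
  have "int ((nat \<bar>x\<bar>)\<^sup>2) = int (n * (nat \<bar>y\<bar>)\<^sup>2)" using assms(3) by simp
  then have "(nat \<bar>x\<bar>)\<^sup>2 = n * (nat \<bar>y\<bar>)\<^sup>2" unfolding of_nat_eq_iff .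
  then have "nat \<bar>y\<bar> = 0" by (rule square_eq_imp_0[OF assms(1,2)])
  then show ?thesis by simp
qed

lemma multiplicity_2_3_6: "multiplicity 2 (2::nat) = 1" "multiplicity 2 (6::nat) = 1" "multiplicity 3 (3::nat) = 1"
proof -
  have "multiplicity (2::nat) (2 * 3) = 1"
    by (subst prime_elem_multiplicity_mult_distrib) (auto simp: not_dvd_imp_multiplicity_0)
  moreover have "(2::nat) * 3 = 6" by simp
  ultimately show "multiplicity 2 (6::nat) = 1" by (simp only:)
qed simp_all

text \<open>Squaring isolates a multiple of sqrt 2, whose coefficient 2 s b must vanish. The
  equations s^2 = 3 c^2 and (3c)^2 = 6 b^2 that remain have only the zero solution, by the parity of
  a prime multiplicity.\<close>

lemma sqrt_2_3_independent:
  assumes "of_int s + of_int b * sqrt 2 + of_int c * sqrt 3 = 0"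
  shows "s = 0 \<and> b = 0 \<and> c = 0"
proof -
  have e: "of_int s + of_int b * sqrt 2 = - of_int c * sqrt 3" using assms by simp
  have "(of_int s + of_int b * sqrt 2)\<^sup>2 = (of_int c)\<^sup>2 * 3" unfolding e by (simp add: power_mult_distrib)
  then have q: "(of_int s)\<^sup>2 + 2 * (of_int b)\<^sup>2 + 2 * of_int s * of_int b * sqrt 2 = 3 * (of_int c :: real)\<^sup>2"
    by (simp add: power2_sum power_mult_distrib algebra_simps)
  have "2 * of_int s * of_int b * sqrt 2 = (of_int (3 * c\<^sup>2 - s\<^sup>2 - 2 * b\<^sup>2) :: real)" using q by simp
  then have "(2 * of_int s * of_int b * sqrt 2)\<^sup>2 = ((of_int (3 * c\<^sup>2 - s\<^sup>2 - 2 * b\<^sup>2))\<^sup>2 :: real)" by simp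
  then have "of_int (2 * (2 * s * b)\<^sup>2) = (of_int ((3 * c\<^sup>2 - s\<^sup>2 - 2 * b\<^sup>2)\<^sup>2) :: real)"
    by (simp add: power_mult_distrib algebra_simps)
  then have "(3 * c\<^sup>2 - s\<^sup>2 - 2 * b\<^sup>2)\<^sup>2 = int 2 * (2 * s * b)\<^sup>2" unfolding of_int_eq_iff by simp
  then have "2 * s * b = 0" by (rule square_eq_imp_0_int[where q = 2, rotated 2]) (use multiplicity_2_3_6 in auto)
  then have "s = 0 \<or> b = 0" by simp
  moreover from \<open>2 * s * b = 0\<close> have q': "of_int (s\<^sup>2 + 2 * b\<^sup>2) = (of_int (3 * c\<^sup>2) :: real)" using q by auto
  then have q'': "s\<^sup>2 + 2 * b\<^sup>2 = 3 * c\<^sup>2" unfolding of_int_eq_iff .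
  ultimately show ?thesis
  proof (elim disjE)
    assume "b = 0"
    then have "s\<^sup>2 = int 3 * c\<^sup>2" using q'' by simp
    then have "c = 0" by (rule square_eq_imp_0_int[where q = 3, rotated 2]) (use multiplicity_2_3_6 in auto)
    then show ?thesis using q'' \<open>b = 0\<close> by simp
  next
    assume "s = 0"
    then have "(3 * c)\<^sup>2 = int 6 * b\<^sup>2" using q'' by (simp add: power_mult_distrib)
    then have "b = 0" by (rule square_eq_imp_0_int[where q = 2, rotated 2]) (use multiplicity_2_3_6 in auto)
    then show ?thesis using q'' \<open>s = 0\<close> by simp
  qed
qed

lemma weights_near_1:
  fixes N :: nat
  assumes N: "N > 0"
  shows "weights 1 (1 + sqrt 2 / N) (1 + sqrt 3 / N)"
proof
  show "1 + sqrt 2 / N > 0" "1 + sqrt 3 / N > 0" by (simp_all add: add_pos_nonneg)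
  fix a b c :: int
  assume "of_int a * 1 + of_int b * (1 + sqrt 2 / N) + of_int c * (1 + sqrt 3 / N) = 0"
  moreover have "real N * (of_int a * 1 + of_int b * (1 + sqrt 2 / N) + of_int c * (1 + sqrt 3 / N))
      = of_int (int N * (a + b + c)) + of_int b * sqrt 2 + of_int c * sqrt 3"
    using N by (simp add: ring_distribs)
  ultimately have "of_int (int N * (a + b + c)) + of_int b * sqrt 2 + of_int c * sqrt 3 = 0" by simp
  from sqrt_2_3_independent[OF this] show "a = 0 \<and> b = 0 \<and> c = 0" using N by auto
qed simp

lemma not_tame:
  fixes p d k :: nat
  assumes p: "prime p" "p > 3" and k: "d + 3 * k = 2 * p" "k \<ge> 1" "d \<ge> p"
    and F: "F \<in> Tame3" "mdeg F = (3, p, d)"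
  shows False
proof -
  \<comment> \<open>Chosen so that \<eta> = 2 / N satisfies d \<eta> = 1/100; the numerator 2 bounds
    sqrt 2 and sqrt 3.\<close>
  define N where "N = 200 * d"
  have d0: "d > 0" using p k by simp
  then have N: "N > 0" by (simp add: N_def)
  define \<eta> where "\<eta> = 2 / real N"
  have \<eta>: "\<eta> \<ge> 0" "real d * \<eta> \<le> 1 / 100" using d0 by (simp_all add: \<eta>_def N_def)
  interpret weights 1 "1 + sqrt 2 / N" "1 + sqrt 3 / N" by (rule weights_near_1[OF N])
  have "sqrt 2 \<le> 2" "sqrt 3 \<le> 2" by (auto intro!: real_le_lsqrt)
  then have w: "1 \<le> (1::real)" "1 \<le> 1 + sqrt 2 / N" "1 \<le> 1 + sqrt 3 / N" "1 \<le> 1 + \<eta>"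
    "1 + sqrt 2 / N \<le> 1 + \<eta>" "1 + sqrt 3 / N \<le> 1 + \<eta>"
    using \<eta> N by (auto simp: \<eta>_def intro!: divide_right_mono)
  from Tame3_A_map[OF F(1)] obtain f g h where fgh: "(\<lambda>v. fst (F v)) = ev f" "(\<lambda>v. fst (snd (F v))) = ev g"
    "(\<lambda>v. snd (snd (F v))) = ev h" "A {#f, g, h#}" unfolding A_map_def A_fun_def by blast
  have dg: "deg3 (ev f) = 3" "deg3 (ev g) = p" "deg3 (ev h) = d"
    using F(2) unfolding mdeg_def fgh(1-3) by auto
  have small: "real n * \<eta> < 1" if "n \<le> d" for n
  proof -
    have "real n * \<eta> \<le> real d * \<eta>" using that \<eta> by (intro mult_right_mono) auto
    then show ?thesis using \<eta> by simp
  qed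
  obtain m1 where m1: "deg f = W m1" "sz m1 = 3"
    by (rule deg_deg3[OF w, of f]) (use dg small[of 3] p k in auto)
  obtain m2 where m2: "deg g = W m2" "sz m2 = p"
    by (rule deg_deg3[OF w, of g]) (use dg small[of p] p k in auto)
  obtain m3 where m3: "deg h = W m3" "sz m3 = d"
    by (rule deg_deg3[OF w, of h]) (use dg small[of d] p k in auto)
  show False using deg_3_p_d_not_A[OF w \<eta> p k m1 m2 m3] fgh(4) by blast
qed

section \<open>Multidegrees in the semigroup generated by 3 and p\<close>

text \<open>On the z-axis only the pure powers of z remain. This gives the lower bounds for
  \<open>deg3\<close> in the example.\<close>

lemma poly3_le_axis:
  assumes "poly3_le g n" "\<And>t. g (0, 0, t) = poly Q t"
  shows "degree Q \<le> n"
proof -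
  from assms(1) obtain c where c: "\<And>x y z. g (x, y, z) = (\<Sum>i\<le>n. \<Sum>j\<le>n. \<Sum>k\<le>n.
        if i + j + k \<le> n then c i j k * x ^ i * y ^ j * z ^ k else 0)" unfolding poly3_le_def by blast
  define P where "P = (\<Sum>i\<le>n. \<Sum>j\<le>n. \<Sum>k\<le>n. if i + j + k \<le> n then monom (c i j k * 0 ^ i * 0 ^ j) k else 0)"
  have "poly P t = poly Q t" for t
    unfolding assms(2)[symmetric] c P_def poly_sum by (intro sum.cong refl) (simp add: poly_monom)
  then have "poly Q = poly P" by (simp add: fun_eq_iff)
  then have "Q = P" by (simp only: poly_eq_poly_eq_iff)
  moreover have "degree P \<le> n" unfolding P_def
    by (intro degree_sum_le) (auto intro: order.trans[OF degree_monom_le])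
  ultimately show ?thesis by simp
qed

lemma deg3_eqI:
  assumes "tdeg_le f n" "\<And>t. ev f (0, 0, t) = poly Q t" "degree Q = n"
  shows "deg3 (ev f) = n"
  unfolding deg3_def by (rule Least_equality) (use assms poly3_le_ev poly3_le_axis in auto)

lemma tdeg_le_add: "tdeg_le f n \<Longrightarrow> tdeg_le g n \<Longrightarrow> tdeg_le (f + g) n"
  using keys_add[of f g] unfolding tdeg_le_def by blast

lemma tdeg_le_mono: "tdeg_le f n \<Longrightarrow> n \<le> m \<Longrightarrow> tdeg_le f m"
  unfolding tdeg_le_def by force

lemma tdeg_le_mult: assumes "tdeg_le f n" "tdeg_le g m" shows "tdeg_le (f * g) (n + m)"
  unfolding tdeg_le_def
proof
  fix x assume "x \<in> keys (f * g)"
  then obtain a b where "a \<in> keys f" "b \<in> keys g" "x = a + b" using keys_mult[of f g] by blast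
  then show "sz x \<le> n + m" using assms unfolding tdeg_le_def by (simp add: sz_add add_mono)
qed

lemma tdeg_le_power: "tdeg_le f n \<Longrightarrow> tdeg_le (f ^ k) (k * n)"
proof (induction k)
  case (Suc k)
  then show ?case using tdeg_le_mult[of f n "f ^ k" "k * n"] by simp
qed (simp add: tdeg_le_def sz_def)

lemma tdeg_le_single: "sz m \<le> n \<Longrightarrow> tdeg_le (single m c) n"
  by (simp add: tdeg_le_def)

text \<open>Triangular maps add polynomials in earlier coordinates only, so cyclic shifts bring z to
  the front and back. On the z-axis the last component is t^d + t with d = 3i + pj, and d > 1 keeps
  its degree equal to d.\<close>

lemma Tame3_example:
  fixes p i j :: nat
  assumes p: "p > 3" and d: "3 * i + p * j > 1"
  shows "(3, p, 3 * i + p * j) \<in> mdeg ` Tame3"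
proof -
  define \<sigma> :: map3 where "\<sigma> v = (snd (snd v), fst v, fst (snd v))" for v
  define \<tau> :: map3 where "\<tau> v = (fst (snd v), snd (snd v), fst v)" for v
  have st: "\<sigma> \<circ> \<tau> = id" "\<tau> \<circ> \<sigma> = id" by (auto simp: \<sigma>_def \<tau>_def fun_eq_iff)
  then have bj: "bij \<sigma>" "bij \<tau>" by (auto intro: o_bij)
  have sg: "\<sigma> \<in> Tame3"
    by (rule Tame3.aff, unfold affine_aut_def, intro conjI bj(1), rule exI[of _ "\<lambda>r s. if s = (r + 2) mod 3 then 1 else 0"], rule exI[of _ "\<lambda>_. 0"])
       (simp add: \<sigma>_def)
  have ta: "\<tau> \<in> Tame3"
    by (rule Tame3.aff, unfold affine_aut_def, intro conjI bj(2), rule exI[of _ "\<lambda>r s. if s = (r + 1) mod 3 then 1 else 0"], rule exI[of _ "\<lambda>_. 0"])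
       (simp add: \<tau>_def)
  define T1 :: map3 where "T1 v = (fst v, fst (snd v) + fst v ^ 3, snd (snd v) + fst v ^ p)" for v
  have s1: "(\<Sum>a\<le>n. \<Sum>b\<le>n. (if a = k \<and> b = l then 1 else 0) * x ^ a * y ^ b) = x ^ k * y ^ l"
    if "k \<le> n" "l \<le> n" for n k l and x y :: complex
  proof -
    have "(\<Sum>a\<le>n. \<Sum>b\<le>n. (if a = k \<and> b = l then 1 else 0) * x ^ a * y ^ b)
        = (\<Sum>a\<le>n. if k = a then (\<Sum>b\<le>n. if l = b then x ^ k * y ^ l else 0) else 0)"
    proof (rule sum.cong[OF refl])
      fix a
      show "(\<Sum>b\<le>n. (if a = k \<and> b = l then 1 else 0) * x ^ a * y ^ b)
        = (if k = a then (\<Sum>b\<le>n. if l = b then x ^ k * y ^ l else 0) else 0)"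
      proof (cases "a = k")
        case True
        then show ?thesis by (auto simp del: sum.delta' intro!: sum.cong)
      qed simp
    qed
    also have "\<dots> = x ^ k * y ^ l" unfolding sum.delta'[OF finite_atMost] using that by simp
    finally show ?thesis .
  qed
  have T1: "T1 \<in> Tame3"
    by (rule Tame3.tri, unfold triangular_aut_def, rule exI[of _ "monom 1 3"], rule exI[of _ p],
        rule exI[of _ "\<lambda>a b. if a = p \<and> b = 0 then 1 else 0"])
       (simp add: T1_def poly_monom s1)
  define T2 :: map3 where "T2 v = (fst v, fst (snd v), snd (snd v) + fst v ^ i * fst (snd v) ^ j)" for v
  have T2: "T2 \<in> Tame3"
    by (rule Tame3.tri, unfold triangular_aut_def, rule exI[of _ 0], rule exI[of _ "i + j"],
        rule exI[of _ "\<lambda>a b. if a = i \<and> b = j then 1 else 0"])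
       (simp add: T2_def s1)
  define F where "F = T2 \<circ> (\<tau> \<circ> (T1 \<circ> \<sigma>))"
  have FT: "F \<in> Tame3" unfolding F_def by (intro Tame3.comp T2 ta T1 sg)
  define X Y Z :: poly3 where "X = single (1, 0, 0) 1" and "Y = single (0, 1, 0) 1" and "Z = single (0, 0, 1) 1"
  define f g where "f = X + Z ^ 3" and "g = Y + Z ^ p"
  define h where "h = Z + f ^ i * g ^ j"
  have e: "ev X v = fst v" "ev Y v = fst (snd v)" "ev Z v = snd (snd v)" for v
    by (simp_all add: X_def Y_def Z_def ev_single)
  have t: "tdeg_le X 1" "tdeg_le Y 1" "tdeg_le Z 1" by (auto simp: X_def Y_def Z_def sz_def intro!: tdeg_le_single)
  have tf: "tdeg_le f 3" unfolding f_def using tdeg_le_power[OF t(3), of 3] tdeg_le_mono[OF t(1)] by (intro tdeg_le_add) auto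
  have tg: "tdeg_le g p" unfolding g_def using tdeg_le_power[OF t(3), of p] tdeg_le_mono[OF t(2)] p by (intro tdeg_le_add) auto
  have th: "tdeg_le h (3 * i + p * j)" unfolding h_def
    using tdeg_le_mult[OF tdeg_le_power[OF tf, of i] tdeg_le_power[OF tg, of j]] tdeg_le_mono[OF t(3)] d
    by (intro tdeg_le_add) (auto simp: mult.commute)
  have Fe: "(\<lambda>v. fst (F v)) = ev f" "(\<lambda>v. fst (snd (F v))) = ev g" "(\<lambda>v. snd (snd (F v))) = ev h"
    by (simp_all add: F_def T2_def \<tau>_def T1_def \<sigma>_def f_def g_def h_def e ev_add ev_mult ev_power fun_eq_iff)
  have "deg3 (ev f) = 3"
    by (rule deg3_eqI[OF tf, of "monom 1 3"]) (simp_all add: f_def e ev_add ev_power poly_monom degree_monom_eq)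
  moreover have "deg3 (ev g) = p"
    by (rule deg3_eqI[OF tg, of "monom 1 p"]) (simp_all add: g_def e ev_add ev_power poly_monom degree_monom_eq)
  moreover have "deg3 (ev h) = 3 * i + p * j"
  proof (rule deg3_eqI[OF th, of "monom 1 (3 * i + p * j) + [:0, 1:]"])
    show "degree (monom 1 (3 * i + p * j) + [:0, 1:] :: complex poly) = 3 * i + p * j"
      using d by (subst degree_add_eq_left) (simp_all add: degree_monom_eq)
    show "ev h (0, 0, t) = poly (monom 1 (3 * i + p * j) + [:0, 1:]) t" for t
      by (simp add: h_def f_def g_def e ev_add ev_mult ev_power poly_monom power_add power_mult)
  qed
  ultimately have "mdeg F = (3, p, 3 * i + p * j)" unfolding mdeg_def Fe by simp
  then show ?thesis using FT by (metis imageI)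
qed

text \<open>As 3 does not divide p, the classes of 0, p and 2p exhaust the residues modulo 3. The
  first two admit j = 0 or j = 1 because d is at least p. The third needs d at least 2p, and what
  lies below is the exceptional set.\<close>

lemma semigroup_3_p:
  fixes p d :: nat
  assumes "prime p" "p > 3" "d \<ge> p" "d \<notin> {2 * p - 3 * k | k. k \<in> {1..p div 3}}"
  shows "\<exists>i j. d = 3 * i + p * j"
proof -
  have p3: "p mod 3 \<noteq> 0"
  proof
    assume "p mod 3 = 0"
    then have "3 dvd p" by presburger
    then show False using assms(1,2) by (auto simp: prime_nat_iff)
  qed
  consider "d mod 3 = 0" | "d mod 3 = p mod 3" | "d mod 3 = (2 * p) mod 3"
  proof -
    have "p mod 3 = 1 \<or> p mod 3 = 2" "d mod 3 = 0 \<or> d mod 3 = 1 \<or> d mod 3 = 2" using p3 by presburger+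
    then have "d mod 3 = 0 \<or> d mod 3 = p mod 3 \<or> d mod 3 = (2 * p) mod 3" by presburger
    then show ?thesis using that by argo
  qed
  then show ?thesis
  proof cases
    case 1
    then have "d = 3 * (d div 3) + p * 0" by presburger
    then show ?thesis by blast
  next
    case 2
    then have "3 dvd d - p" using mod_eq_dvd_iff_nat[OF assms(3)] by blast
    then have "d = 3 * ((d - p) div 3) + p * 1" using assms(3) by simp
    then show ?thesis by blast
  next
    case 3
    show ?thesis
    proof (cases "d \<ge> 2 * p")
      case True
      then have "3 dvd d - 2 * p" using mod_eq_dvd_iff_nat[OF True] 3 by blast
      then have "d = 3 * ((d - 2 * p) div 3) + p * 2" using True by simp
      then show ?thesis by blast
    next
      case False
      define k where "k = (2 * p - d) div 3"
      have "3 dvd 2 * p - d" using mod_eq_dvd_iff_nat[of d "2 * p" 3] False 3 by simp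
      then have k: "d + 3 * k = 2 * p" using False unfolding k_def by simp
      then have "k \<in> {1..p div 3}" "d = 2 * p - 3 * k" using False assms(3) by auto
      then show ?thesis using assms(4) by blast
    qed
  qed
qed

theorem mainTheorem2:
  fixes p2 d3 :: nat
  assumes "prime p2" and "p2 > 3" and "d3 \<ge> p2"
  shows "(3, p2, d3) \<in> mdeg ` Tame3 \<longleftrightarrow>
         d3 \<notin> {2 * p2 - 3 * k | k. k \<in> {1..p2 div 3}}"
proof
  assume "(3, p2, d3) \<in> mdeg ` Tame3"
  then obtain F where F: "F \<in> Tame3" "mdeg F = (3, p2, d3)" by force
  show "d3 \<notin> {2 * p2 - 3 * k | k. k \<in> {1..p2 div 3}}"
  proof
    assume "d3 \<in> {2 * p2 - 3 * k | k. k \<in> {1..p2 div 3}}"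
    then obtain k where k: "d3 = 2 * p2 - 3 * k" "k \<ge> 1" "k \<le> p2 div 3" by auto
    then have "d3 + 3 * k = 2 * p2" by linarith
    then show False using not_tame[OF assms(1,2) _ k(2) assms(3) F] by blast
  qed
next
  assume "d3 \<notin> {2 * p2 - 3 * k | k. k \<in> {1..p2 div 3}}"
  then obtain i j where "d3 = 3 * i + p2 * j" using semigroup_3_p assms by blast
  then show "(3, p2, d3) \<in> mdeg ` Tame3" using Tame3_example[of p2 i j] assms by simp
qed

end
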